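(* Let $q$ be a prime power and let $\ell, m, n, k$ be positive integers with $1\le k\le n$, $\ell\le q-1$, and let $(n_1,\dots,n_\ell)$ be an ordered partition of $n$ (positive integers with $\sum_l n_l=n$). Let $Z_1,\dots,Z_k\subseteq[n]$. Suppose $q\ge \ell+1$ and $m\ge \max_{l\in[\ell]}\{k-1+\log_q k,\ n_l\}$. Then there exists an $[n,k]_{q^m}$ linearized Reed–Solomon code with $\ell$ blocks of lengths $n_1,\dots,n_\ell$ having a generator matrix $\boldsymbol G\in\mathbb F_{q^m}^{k\times n}$ with $G_{ij}=0$ for all $i\in[k]$ and all $j\in Z_i$ if and only if for every nonempty $\Omega\subseteq[k]$, $$\Big|\bigcap_{i\in\Omega}Z_i\Big|+|\Omega|\le k .$$
   Context: $[a]=\{1,\dots,a\}$. Let $\sigma:\mathbb F_{q^m}\to\mathbb F_{q^m}$, $\sigma(a)=a^q$. Two elements $a,b\in\mathbb F_{q^m}$ are $\sigma$-conjugate if $b=a c^{q-1}$ for some $c\in\mathbb F_{q^m}^*$; this is an equivalence relation whose classes partition $\mathbb F_{q^m}$ ($\{0\}$ plus $q-1$ classes of nonzero elements). For $a\in\mathbb F_{q^m}$ and $i\ge0$ let $N_i(a)=a^{(q^i-1)/(q-1)}$. Columns are indexed by pairs $(l,t)$, $l\in[\ell]$, $t\in[n_l]$, with column index $j=t+\sum_{r<l}n_r$. A linearized Reed–Solomon (LRS) code of dimension $k$ with blocks $(n_1,\dots,n_\ell)$ (requiring $n_l\le m$) is specified by block representatives $a_1,\dots,a_\ell\in\mathbb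 F_{q^m}^*$ lying in pairwise distinct $\sigma$-conjugacy classes and column multipliers $\beta_{l,1},\dots,\beta_{l,n_l}\in\mathbb F_{q^m}$ that are $\mathbb F_q$-linearly independent for each $l$; it is the $\mathbb F_{q^m}$-row space of the $k\times n$ matrix whose entry in row $i\in\{0,\dots,k-1\}$ and column $(l,t)$ is $N_i(a_l)\,\beta_{l,t}^{q^i}$. Equivalently, it is $\{(\beta_{l,t}\, f(a_l\beta_{l,t}^{q-1}))_{(l,t)} : f=\sum_{i<k} f_iX^i\}$ with $f(\alpha)=\sum_i f_iN_i(\alpha)$. *)

theory Defs
  imports "HOL-Computational_Algebra.Primes" "HOL-Library.Cardinality" Complex_Main
begin

definition Nrm :: "nat \<Rightarrow> nat \<Rightarrow> 'a::field \<Rightarrow> 'a" where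
  "Nrm q i a = a ^ ((q ^ i - 1) div (q - 1))"

definition sigma_conj :: "nat \<Rightarrow> 'a::field \<Rightarrow> 'a \<Rightarrow> bool" where
  "sigma_conj q a b \<longleftrightarrow> (\<exists>c. c \<noteq> 0 \<and> b = a * c ^ (q - 1))"

(* F_q-linear independence of b 1, ..., b r, where F_q = {x. x^q = x} *)
definition Fq_lin_indep :: "nat \<Rightarrow> nat \<Rightarrow> (nat \<Rightarrow> 'a::field) \<Rightarrow> bool" where
  "Fq_lin_indep q r b \<longleftrightarrow>
     (\<forall>c. (\<forall>t\<in>{1..r}. c t ^ q = c t) \<and> (\<Sum>t=1..r. c t * b t) = 0
          \<longrightarrow> (\<forall>t\<in>{1..r}. c t = 0))"

(* column index of position t in block l (1-based) *)
definition col_of :: "(nat \<Rightarrow> nat) \<Rightarrow> nat \<Rightarrow> nat \<Rightarrow> nat" where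
  "col_of ns l t = t + (\<Sum>r\<in>{1..<l}. ns r)"

definition LRS_params :: "nat \<Rightarrow> nat \<Rightarrow> nat \<Rightarrow> (nat \<Rightarrow> nat) \<Rightarrow> (nat \<Rightarrow> 'a::field)
    \<Rightarrow> (nat \<Rightarrow> nat \<Rightarrow> 'a) \<Rightarrow> bool" where
  "LRS_params q m L ns a beta \<longleftrightarrow>
     (\<forall>l\<in>{1..L}. a l \<noteq> 0 \<and> ns l \<le> m \<and> Fq_lin_indep q (ns l) (beta l)) \<and>
     (\<forall>l\<in>{1..L}. \<forall>l'\<in>{1..L}. l \<noteq> l' \<longrightarrow> \<not> sigma_conj q (a l) (a l'))"

(* entry in row i (1-based, i.e. exponent i-1) and column (l,t) of the LRS generator matrix *)
definition lrs_entry :: "nat \<Rightarrow> (nat \<Rightarrow> 'a::field) \<Rightarrow> (nat \<Rightarrow> nat \<Rightarrow> 'a) \<Rightarrow> nat \<Rightarrow> nat \<Rightarrow> nat \<Rightarrow> 'a" where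
  "lrs_entry q a beta i l t = Nrm q (i - 1) (a l) * beta l t ^ (q ^ (i - 1))"

(* the LRS code: F_{q^m}-row space of the k x n matrix above; vectors are functions
   on {1..n}, extended by 0 outside *)
definition LRS_code :: "nat \<Rightarrow> nat \<Rightarrow> (nat \<Rightarrow> nat) \<Rightarrow> nat \<Rightarrow> nat \<Rightarrow> (nat \<Rightarrow> 'a::field)
    \<Rightarrow> (nat \<Rightarrow> nat \<Rightarrow> 'a) \<Rightarrow> (nat \<Rightarrow> 'a) set" where
  "LRS_code q L ns n k a beta =
     {v. (\<exists>c. \<forall>l\<in>{1..L}. \<forall>t\<in>{1..ns l}.
              v (col_of ns l t) = (\<Sum>i=1..k. c i * lrs_entry q a beta i l t))
         \<and> (\<forall>j. j \<notin> {1..n} \<longrightarrow> v j = 0)}"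

definition rowspace :: "nat \<Rightarrow> nat \<Rightarrow> (nat \<Rightarrow> nat \<Rightarrow> 'a::field) \<Rightarrow> (nat \<Rightarrow> 'a) set" where
  "rowspace k n G =
     {v. \<exists>c. \<forall>j. v j = (if j \<in> {1..n} then (\<Sum>i=1..k. c i * G i j) else 0)}"

definition rows_indep :: "nat \<Rightarrow> nat \<Rightarrow> (nat \<Rightarrow> nat \<Rightarrow> 'a::field) \<Rightarrow> bool" where
  "rows_indep k n G \<longleftrightarrow>
     (\<forall>c. (\<forall>j\<in>{1..n}. (\<Sum>i=1..k. c i * G i j) = 0) \<longrightarrow> (\<forall>i\<in>{1..k}. c i = 0))"

definition is_generator_matrix :: "nat \<Rightarrow> nat \<Rightarrow> (nat \<Rightarrow> nat \<Rightarrow> 'a::field) \<Rightarrow> (nat \<Rightarrow> 'a) set \<Rightarrow> bool" where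
  "is_generator_matrix k n G C \<longleftrightarrow> rowspace k n G = C \<and> rows_indep k n G"

end

theory Submission
  imports "HOL-Algebra.Algebraic_Closure_Type" "HOL-Number_Theory.Residues"
    "Jordan_Normal_Form.Determinant" Defs
begin

text \<open>
  Over the algebraic closure choose \<open>c\<^sub>l\<close> with \<open>c\<^sub>l ^ (q - 1) = a\<^sub>l\<close>. Then the entry in row \<open>i\<close> and column
  \<open>(l, t)\<close> is \<open>\<gamma> ^ (q ^ i) / c\<^sub>l\<close> with \<open>\<gamma> = c\<^sub>l * \<beta>\<close>, so codewords are evaluations of \<open>q\<close>-linearized
  polynomials at the points \<open>\<gamma>\<close>. The \<open>c\<^sub>l\<close> are eigenvectors of the map \<open>x \<mapsto> x ^ (q ^ m)\<close> whose eigenvalues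
  are the norms of the \<open>a\<^sub>l\<close>; these are distinct exactly if the \<open>a\<^sub>l\<close> are pairwise not conjugate, and then all
  points \<open>\<gamma>\<close> are linearly independent over the field with \<open>q\<close> elements. Hence a codeword with \<open>k\<close> zeros
  vanishes, which gives the necessity of the condition by counting.

  For the sufficiency, pad every \<open>Z i\<close> with fresh indices to \<open>k - 1\<close> elements and let \<open>f\<^sub>i\<close> be the monic
  linearized polynomial whose roots form the span of the points indexed by \<open>Z i\<close>. That the \<open>f\<^sub>i\<close> are linearly
  independent for some choice of points is the linearized analogue of the GM-MDS theorem. It is proved for
  families of Frobenius twists of the \<open>f\<^sub>i\<close> by induction, via splitting at a tight index set,
  specialising a point to zero, and extracting \<open>q\<close>-th roots. An evaluation determinant of the \<open>f\<^sub>i\<close> is a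
  polynomial of degree at most \<open>(k - 1) * (q ^ (k - 1) - q ^ (k - 2))\<close> in every single point, which is less
  than \<open>q ^ m - q ^ (m - 1)\<close>, so the points can be moved one after the other into the cosets
  \<open>c\<^sub>l * F\<close> of the ground field \<open>F\<close> while avoiding the span of the previous points of the same block.
\<close>

section \<open>Functions that are polynomial in each variable\<close>

text \<open>Specialising a point \<open>z\<close> to zero does not simply delete it: the subspace
  polynomial of \<open>Z i\<close> becomes the \<open>q\<close>-th power of the one for
  \<open>Z i - {z}\<close>, so the family of the \<open>f_i\<close> alone is not closed under
  specialisation. This is why each set comes with a lower bound \<open>\<tau> i\<close> on its
  twists. For \<open>t\<close> the least of these bounds,
  \<open>t + card (\<Inter>i\<in>\<Omega>. Z i)\<close> is the \<open>q\<close>-degree of the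
  greatest common right divisor of the twists at independent points. When at most one bound is zero,
  progress comes from lowering \<open>k\<close>, which requires \<open>q\<close>-th roots of
  coefficients, hence a perfect field. The two halves of a tight split must hold at the same points,
  hence the notion \<open>generic\<close> and an infinite field.

  The logarithmic condition on \<open>m\<close> means \<open>k * q ^ (k - 1) \<le> q ^ m\<close> and
  is what the final move of the points into cosets of \<open>F\<close> costs. The factor
  \<open>k - 1\<close> in the degree arises because sets with a common element number at most
  \<open>k - 1\<close>. Padding points are moved into such cosets too: then the \<open>k - 1\<close>
  conditions on a row are linear equations over \<open>F\<close>, so that its coefficients can be
  found in \<open>F\<close>.\<close>

definition poly_in :: "nat \<Rightarrow> nat \<Rightarrow> ((nat \<Rightarrow> 'e::field) \<Rightarrow> 'e) \<Rightarrow> bool" where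
  "poly_in j d P \<longleftrightarrow> (\<forall>v. \<exists>p. Polynomial.degree p \<le> d \<and> (\<forall>x. P (v(j := x)) = poly p x))"

lemma poly_in_mono: "poly_in j d P \<Longrightarrow> d \<le> d' \<Longrightarrow> poly_in j d' P"
  unfolding poly_in_def by (meson order_trans)

lemma poly_in_invariant: "(\<And>v x. P (v(j := x)) = P v) \<Longrightarrow> poly_in j d P"
  unfolding poly_in_def
proof (intro allI exI conjI)
  fix v x assume "\<And>v x. P (v(j := x)) = P v"
  then show "P (v(j := x)) = poly [:P v:] x" by simp
qed simp

lemma poly_in_coord: "poly_in j 1 (\<lambda>v. v i)"
proof (cases "i = j")
  case True
  have "\<exists>p. Polynomial.degree p \<le> 1 \<and> (\<forall>x. (v(j := x)) i = poly p x)" for v :: "nat \<Rightarrow> 'a"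
    by (rule exI[of _ "[:0, 1:]"]) (simp add: True)
  then show ?thesis unfolding poly_in_def by blast
qed (auto intro: poly_in_invariant)

lemma poly_in_add:
  assumes "poly_in j d P" "poly_in j d Q"
  shows "poly_in j d (\<lambda>v. P v + Q v)"
  unfolding poly_in_def
proof
  fix v
  from assms obtain p r where "Polynomial.degree p \<le> d" "\<forall>x. P (v(j := x)) = poly p x"
    "Polynomial.degree r \<le> d" "\<forall>x. Q (v(j := x)) = poly r x"
    unfolding poly_in_def by meson
  then show "\<exists>p. Polynomial.degree p \<le> d \<and> (\<forall>x. P (v(j := x)) + Q (v(j := x)) = poly p x)"
    by (intro exI[of _ "p + r"]) (auto intro: degree_add_le)
qed

lemma poly_in_mult:
  assumes "poly_in j d P" "poly_in j d' Q"
  shows "poly_in j (d + d') (\<lambda>v. P v * Q v)"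
  unfolding poly_in_def
proof
  fix v
  from assms obtain p r where pr: "Polynomial.degree p \<le> d" "\<forall>x. P (v(j := x)) = poly p x"
    "Polynomial.degree r \<le> d'" "\<forall>x. Q (v(j := x)) = poly r x"
    unfolding poly_in_def by meson
  have "Polynomial.degree (p * r) \<le> d + d'"
    using pr degree_mult_le[of p r] by linarith
  then show "\<exists>p. Polynomial.degree p \<le> d + d' \<and> (\<forall>x. P (v(j := x)) * Q (v(j := x)) = poly p x)"
    using pr by (intro exI[of _ "p * r"]) auto
qed

lemma poly_in_const: "poly_in j d (\<lambda>_. c)"
  by (rule poly_in_invariant) simp

lemma poly_in_cmult: "poly_in j d P \<Longrightarrow> poly_in j d (\<lambda>v. c * P v)"
  using poly_in_mult[OF poly_in_const[of j 0 c]] by simp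

lemma poly_in_diff:
  assumes "poly_in j d P" "poly_in j d Q"
  shows "poly_in j d (\<lambda>v. P v - Q v)"
  using poly_in_add[OF assms(1) poly_in_cmult[OF assms(2), of "-1"]] by simp

lemma poly_in_sum:
  "(\<And>a. a \<in> A \<Longrightarrow> poly_in j d (P a)) \<Longrightarrow> poly_in j d (\<lambda>v. \<Sum>a\<in>A. P a v)"
  by (induction A rule: infinite_finite_induct) (auto intro: poly_in_add poly_in_const)

lemma poly_in_prod:
  "(\<And>a. a \<in> A \<Longrightarrow> poly_in j (d a) (P a)) \<Longrightarrow> poly_in j (\<Sum>a\<in>A. d a) (\<lambda>v. \<Prod>a\<in>A. P a v)"
  by (induction A rule: infinite_finite_induct) (auto intro: poly_in_mult poly_in_const)

lemma poly_in_power: "poly_in j d P \<Longrightarrow> poly_in j (r * d) (\<lambda>v. P v ^ r)"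
  by (induction r) (auto intro: poly_in_mult poly_in_const)

text \<open>Each Leibniz term takes one entry from every row, so degree bounds that depend on the
  row alone add up. This keeps the later bound sharp: a point contributes only through the rows
  whose set contains it.\<close>

lemma poly_in_det:
  assumes "\<And>i s. i < r \<Longrightarrow> s < r \<Longrightarrow> poly_in j (d i) (h i s)"
  shows "poly_in j (\<Sum>i<r. d i) (\<lambda>v. det (mat r r (\<lambda>(i, s). h i s v)))"
proof -
  have eq: "det (mat r r (\<lambda>(i, s). h i s v)) =
      (\<Sum>p | p permutes {0..<r}. of_int (sign p) * (\<Prod>i = 0..<r. h i (p i) v))" for v
    by (subst det_def'[of _ r]) (auto intro!: sum.cong prod.cong simp: permutes_in_image)
  have "poly_in j (\<Sum>i\<in>{0..<r}. d i) (\<lambda>v. \<Prod>i = 0..<r. h i (p i) v)"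
    if "p permutes {0..<r}" for p
    by (rule poly_in_prod) (use assms permutes_in_image[OF that] in auto)
  then show ?thesis
    unfolding eq atLeast0LessThan[symmetric]
    by (intro poly_in_sum poly_in_cmult) auto
qed

text \<open>Being polynomial in each variable separately is all that is needed, since nonvanishing is always
  propagated by changing one coordinate at a time.\<close>
definition generic :: "((nat \<Rightarrow> 'e::field) \<Rightarrow> bool) \<Rightarrow> bool" where
  "generic Q \<longleftrightarrow> (\<exists>V P. finite V \<and> (\<forall>v w. (\<forall>j\<in>V. v j = w j) \<longrightarrow> P v = P w) \<and>
     (\<forall>j. \<exists>d. poly_in j d P) \<and> (\<exists>v. P v \<noteq> 0) \<and> (\<forall>v. P v \<noteq> 0 \<longrightarrow> Q v))"

lemma genericI:
  assumes "finite V" "\<And>v w. (\<And>j. j \<in> V \<Longrightarrow> v j = w j) \<Longrightarrow> P v = P w"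
    "\<And>j. \<exists>d. poly_in j d P" "P v \<noteq> 0" "\<And>v. P v \<noteq> 0 \<Longrightarrow> Q v"
  shows "generic Q"
  unfolding generic_def
proof (intro exI[of _ V] exI[of _ P] conjI allI impI)
  show "P a = P b" if "\<forall>j\<in>V. a j = b j" for a b
    by (rule assms(2)) (use that in simp)
  show "\<exists>v. P v \<noteq> 0" by (rule exI) (rule assms(4))
qed (fact assms)+

lemma generic_witness: "generic Q \<Longrightarrow> \<exists>v. Q v"
  unfolding generic_def by blast

lemma generic_mono: "generic Q \<Longrightarrow> (\<And>v. Q v \<Longrightarrow> R v) \<Longrightarrow> generic R"
  unfolding generic_def by (elim exE conjE) (intro exI conjI, assumption+, blast)

text \<open>The two nonvanishing points are made to agree on one coordinate after another. The
  common new value has to avoid the roots of two nonzero univariate polynomials, which an infinite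
  field permits; after finitely many steps one point serves both functions.\<close>

lemma generic_conj:
  fixes Q R :: "(nat \<Rightarrow> 'e::field) \<Rightarrow> bool"
  assumes inf: "infinite (UNIV :: 'e set)" and "generic Q" "generic R"
  shows "generic (\<lambda>v. Q v \<and> R v)"
proof -
  obtain V P p0 where P: "finite V" "\<forall>v w. (\<forall>j\<in>V. v j = w j) \<longrightarrow> P v = P w"
    "\<forall>j. \<exists>d. poly_in j d P" "P p0 \<noteq> 0" "\<forall>v. P v \<noteq> 0 \<longrightarrow> Q v"
    using \<open>generic Q\<close> unfolding generic_def by (elim exE conjE) (rule that)
  obtain W S s0 where S: "finite W" "\<forall>v w. (\<forall>j\<in>W. v j = w j) \<longrightarrow> S v = S w"
    "\<forall>j. \<exists>d. poly_in j d S" "S s0 \<noteq> 0" "\<forall>v. S v \<noteq> 0 \<longrightarrow> R v"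
    using \<open>generic R\<close> unfolding generic_def by (elim exE conjE) (rule that)
  have "\<exists>v w. P v \<noteq> 0 \<and> S w \<noteq> 0 \<and> (\<forall>j\<in>U. v j = w j)" if "finite U" for U
    using that
  proof (induction U)
    case empty
    then show ?case using P(4) S(4) by auto
  next
    case (insert z U)
    then obtain v w where vw: "P v \<noteq> 0" "S w \<noteq> 0" "\<forall>j\<in>U. v j = w j" by blast
    obtain p where p: "\<forall>x. P (v(z := x)) = poly p x"
      using P(3) unfolding poly_in_def by blast
    obtain r where r: "\<forall>x. S (w(z := x)) = poly r x"
      using S(3) unfolding poly_in_def by blast
    have "poly p (v z) \<noteq> 0" "poly r (w z) \<noteq> 0" using p r vw by (metis fun_upd_triv)+
    then have "p * r \<noteq> 0" by auto
    then have "finite {x. poly (p * r) x = 0}" by (rule poly_roots_finite)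
    then obtain x where "poly (p * r) x \<noteq> 0" using inf by (metis (mono_tags) UNIV_eq_I mem_Collect_eq)
    then have "P (v(z := x)) \<noteq> 0" "S (w(z := x)) \<noteq> 0" using p r by auto
    moreover have "\<forall>j\<in>insert z U. (v(z := x)) j = (w(z := x)) j" using vw(3) by simp
    ultimately show ?case by blast
  qed
  from this[of "V \<union> W"] P(1) S(1) obtain v w
    where vw: "P v \<noteq> 0" "S w \<noteq> 0" "\<forall>j\<in>V \<union> W. v j = w j" by auto
  have "S v = S w" using S(2) vw(3) by simp
  with vw have nz: "P v * S v \<noteq> 0" by simp
  show ?thesis
  proof (rule genericI[of "V \<union> W" "\<lambda>v. P v * S v", OF _ _ _ nz])
    fix a b :: "nat \<Rightarrow> 'e" assume "\<And>j. j \<in> V \<union> W \<Longrightarrow> a j = b j"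
    then have "P a = P b" "S a = S b" using P(2) S(2) by simp_all
    then show "P a * S a = P b * S b" by simp
  next
    fix j show "\<exists>d. poly_in j d (\<lambda>v. P v * S v)"
      using P(3)[rule_format, of j] S(3)[rule_format, of j] by (auto intro: poly_in_mult)
  next
    fix a assume "P a * S a \<noteq> 0"
    then show "Q a \<and> R a" using P(5) S(5) by auto
  qed (use P(1) S(1) in simp)
qed

lemma generic_ball:
  fixes Q :: "'i \<Rightarrow> (nat \<Rightarrow> 'e::field) \<Rightarrow> bool"
  assumes inf: "infinite (UNIV :: 'e set)" and "finite A" "\<And>a. a \<in> A \<Longrightarrow> generic (Q a)"
  shows "generic (\<lambda>v. \<forall>a\<in>A. Q a v)"
  using assms(2,3)
proof (induction A)
  case empty
  show ?case
  proof (rule genericI[of "{}" "\<lambda>_. 1" "\<lambda>_. 0"])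
    show "\<exists>d. poly_in j d (\<lambda>_. 1 :: 'e)" for j
      by (rule exI[of _ 0]) (rule poly_in_const)
  qed simp_all
next
  case (insert a A)
  have "generic (\<lambda>v. Q a v \<and> (\<forall>a\<in>A. Q a v))"
    by (rule generic_conj[OF inf]) (use insert in simp_all)
  then show ?case by simp
qed

section \<open>Determinants and linear independence of functions\<close>

text \<open>The last evaluation point is left free. Expansion along its column writes the
  determinant as a combination of the \<open>g i\<close>, in which the coefficient of
  \<open>g r\<close> is the minor that is nonzero by induction, so the combination cannot vanish
  identically.\<close>

lemma det_evaluation_nonzero:
  fixes g :: "nat \<Rightarrow> 'x \<Rightarrow> 'e::field"
  assumes "\<And>c. (\<forall>x. (\<Sum>i<r. c i * g i x) = 0) \<Longrightarrow> \<forall>i<r. c i = 0"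
  shows "\<exists>xs. det (mat r r (\<lambda>(i, s). g i (xs s))) \<noteq> 0"
  using assms
proof (induction r)
  case 0
  show ?case by (simp add: det_def)
next
  case (Suc r)
  have "\<forall>i<r. c i = 0" if "\<forall>x. (\<Sum>i<r. c i * g i x) = 0" for c
  proof -
    have "\<forall>x. (\<Sum>i<Suc r. (c(r := 0)) i * g i x) = 0" using that by simp
    from Suc.prems[OF this] show ?thesis by (metis fun_upd_apply less_SucI less_irrefl)
  qed
  then obtain xs where xs: "det (mat r r (\<lambda>(i, s). g i (xs s))) \<noteq> 0"
    using Suc.IH by blast
  define M where "M x = mat (Suc r) (Suc r) (\<lambda>(i, s). g i ((xs(r := x)) s))" for x
  define D where "D i = mat r r (\<lambda>(a, s). g (if a < i then a else Suc a) (xs s))" for i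
  have del: "mat_delete (M x) i r = D i" if "i < Suc r" for i x
    unfolding mat_delete_def M_def D_def using that by (intro eq_matI) auto
  have expand: "det (M x) = (\<Sum>i<Suc r. ((-1) ^ (i + r) * det (D i)) * g i x)" for x
  proof -
    have "det (M x) = (\<Sum>i<Suc r. M x $$ (i, r) * cofactor (M x) i r)"
      by (rule laplace_expansion_column) (auto simp: M_def)
    also have "\<dots> = (\<Sum>i<Suc r. ((-1) ^ (i + r) * det (D i)) * g i x)"
    proof (intro sum.cong refl)
      fix i assume "i \<in> {..<Suc r}"
      moreover from this have "M x $$ (i, r) = g i x" by (simp add: M_def)
      ultimately show "M x $$ (i, r) * cofactor (M x) i r = ((-1) ^ (i + r) * det (D i)) * g i x"
        by (simp add: cofactor_def del)
    qed
    finally show ?thesis .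
  qed
  have "D r = mat r r (\<lambda>(i, s). g i (xs s))"
    unfolding D_def by (intro eq_matI) auto
  with xs have "(-1) ^ (r + r) * det (D r) \<noteq> 0" by simp
  then have "\<not> (\<forall>i<Suc r. (-1) ^ (i + r) * det (D i) = 0)" by blast
  then have "\<not> (\<forall>x. det (M x) = 0)" unfolding expand
    using Suc.prems[of "\<lambda>i. (-1) ^ (i + r) * det (D i)"] by blast
  then obtain x where "det (M x) \<noteq> 0" by blast
  then show ?case unfolding M_def by (rule exI[of _ "xs(r := x)"])
qed

lemma det_nonzero_rows_independent:
  fixes A :: "'e::field mat"
  assumes A: "A \<in> carrier_mat r r" "det A \<noteq> 0"
    and zero: "\<And>s. s < r \<Longrightarrow> (\<Sum>i<r. c i * A $$ (i, s)) = 0" and "i < r"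
  shows "c i = 0"
proof (rule ccontr)
  assume "c i \<noteq> 0"
  let ?v = "vec r c"
  have "?v \<noteq> 0\<^sub>v r" using \<open>c i \<noteq> 0\<close> \<open>i < r\<close> by (metis index_vec index_zero_vec(1))
  moreover have "transpose_mat A *\<^sub>v ?v = 0\<^sub>v r"
  proof (rule eq_vecI)
    fix s assume "s < dim_vec (0\<^sub>v r :: 'e vec)"
    then have s: "s < r" by simp
    have "(transpose_mat A *\<^sub>v ?v) $ s = (\<Sum>i = 0..<r. A $$ (i, s) * c i)"
      using s A by (simp add: scalar_prod_def)
    also have "\<dots> = 0" using zero[OF s] by (simp add: mult.commute atLeast0LessThan)
    finally show "(transpose_mat A *\<^sub>v ?v) $ s = 0\<^sub>v r $ s" using s by simp
  qed (use A in auto)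
  ultimately have "det (transpose_mat A) = 0"
    unfolding det_0_iff_vec_prod_zero_field[OF transpose_carrier_mat[THEN iffD2, OF A(1)]]
    by (intro exI[of _ ?v] conjI) simp_all
  then show False using A det_transpose[OF A(1)] by simp
qed

definition functions_independent :: "'s set \<Rightarrow> ('s \<Rightarrow> 'x \<Rightarrow> 'e::field) \<Rightarrow> bool" where
  "functions_independent S \<phi> \<longleftrightarrow>
     (\<forall>c. (\<forall>x. (\<Sum>s\<in>S. c s * \<phi> s x) = 0) \<longrightarrow> (\<forall>s\<in>S. c s = 0))"

lemma functions_independentI:
  "(\<And>c s. (\<And>x. (\<Sum>s\<in>S. c s * \<phi> s x) = 0) \<Longrightarrow> s \<in> S \<Longrightarrow> c s = 0) \<Longrightarrow> functions_independent S \<phi>"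
  unfolding functions_independent_def by blast

lemma functions_independentD:
  "functions_independent S \<phi> \<Longrightarrow> (\<And>x. (\<Sum>s\<in>S. c s * \<phi> s x) = 0) \<Longrightarrow> s \<in> S \<Longrightarrow> c s = 0"
  unfolding functions_independent_def by blast

lemma functions_independent_det:
  fixes \<phi> :: "'s \<Rightarrow> 'x \<Rightarrow> 'e::field"
  assumes ind: "functions_independent S \<phi>" and h: "bij_betw h {..<r} S"
  shows "\<exists>xs. det (mat r r (\<lambda>(i, s). \<phi> (h i) (xs s))) \<noteq> 0"
proof (rule det_evaluation_nonzero)
  fix c :: "nat \<Rightarrow> 'e" assume zero: "\<forall>x. (\<Sum>i<r. c i * \<phi> (h i) x) = 0"
  define c' where "c' s = c (inv_into {..<r} h s)" for s
  have c': "c' (h i) = c i" if "i < r" for i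
    unfolding c'_def using that h by (simp add: bij_betw_inv_into_left)
  have "(\<Sum>s\<in>S. c' s * \<phi> s x) = 0" for x
    using zero sum.reindex_bij_betw[OF h, of "\<lambda>s. c' s * \<phi> s x"] c' by simp
  then have "c' s = 0" if "s \<in> S" for s
    using functions_independentD[OF ind] that by blast
  then show "\<forall>i<r. c i = 0" using c' h by (metis bij_betwE lessThan_iff)
qed

lemma det_functions_independent:
  assumes nz: "det (mat r r (\<lambda>(i, s). \<phi> (h i) (xs s))) \<noteq> 0" and h: "bij_betw h {..<r} S"
  shows "functions_independent S \<phi>"
proof (rule functions_independentI)
  fix c s assume zero: "\<And>x. (\<Sum>s\<in>S. c s * \<phi> s x) = 0" and "s \<in> S"
  then have "s \<in> h ` {..<r}" using bij_betw_imp_surj_on[OF h] by simp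
  then obtain i where i: "i < r" "s = h i" by blast
  have "(c \<circ> h) i = 0"
  proof (rule det_nonzero_rows_independent[OF _ nz])
    fix t assume "t < r"
    then have "(\<Sum>i<r. (c \<circ> h) i * mat r r (\<lambda>(i, s). \<phi> (h i) (xs s)) $$ (i, t))
      = (\<Sum>i<r. c (h i) * \<phi> (h i) (xs t))" by simp
    also have "\<dots> = 0"
      using zero[of "xs t"] sum.reindex_bij_betw[OF h, of "\<lambda>s. c s * \<phi> s (xs t)"] by simp
    finally show "(\<Sum>i<r. (c \<circ> h) i * mat r r (\<lambda>(i, s). \<phi> (h i) (xs s)) $$ (i, t)) = 0" .
  qed (use i in auto)
  then show "c s = 0" using i by simp
qed

text \<open>The arguments \<open>xs\<close> that detect independence at \<open>g0\<close> are
  frozen; as a function of \<open>g\<close> the evaluation determinant at them is the polynomial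
  that witnesses genericity.\<close>

lemma generic_functions_independent:
  fixes \<phi> :: "(nat \<Rightarrow> 'e::field) \<Rightarrow> 's \<Rightarrow> 'x \<Rightarrow> 'e"
  assumes "finite S" and ind: "functions_independent S (\<phi> g0)"
    and pol: "\<And>s x j. s \<in> S \<Longrightarrow> \<exists>d. poly_in j d (\<lambda>g. \<phi> g s x)"
    and V: "finite V" "\<And>g g' s x. s \<in> S \<Longrightarrow> (\<And>j. j \<in> V \<Longrightarrow> g j = g' j) \<Longrightarrow> \<phi> g s x = \<phi> g' s x"
  shows "generic (\<lambda>g. functions_independent S (\<phi> g))"
proof -
  obtain h where "bij_betw h {0..<card S} S" using ex_bij_betw_nat_finite[OF \<open>finite S\<close>] by blast
  then have h: "bij_betw h {..<card S} S" by (simp add: atLeast0LessThan)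
  have hS: "h i \<in> S" if "i < card S" for i using h that by (auto dest: bij_betwE)
  let ?r = "card S"
  obtain xs where xs: "det (mat ?r ?r (\<lambda>(i, s). \<phi> g0 (h i) (xs s))) \<noteq> 0"
    using functions_independent_det[OF ind h] by blast
  show ?thesis
  proof (rule genericI[OF V(1), of "\<lambda>g. det (mat ?r ?r (\<lambda>(i, s). \<phi> g (h i) (xs s)))", OF _ _ xs])
    fix g g' :: "nat \<Rightarrow> 'e" assume "\<And>j. j \<in> V \<Longrightarrow> g j = g' j"
    then have "\<phi> g (h i) x = \<phi> g' (h i) x" if "i < ?r" for i x
      by (rule V(2)[OF hS[OF that]])
    then show "det (mat ?r ?r (\<lambda>(i, s). \<phi> g (h i) (xs s))) = det (mat ?r ?r (\<lambda>(i, s). \<phi> g' (h i) (xs s)))"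
      by (intro arg_cong[of _ _ det] eq_matI) auto
  next
    fix j
    have "\<exists>D. \<forall>i<?r. \<forall>s<?r. poly_in j D (\<lambda>g. \<phi> g (h i) (xs s))"
    proof -
      have "\<exists>d. poly_in j d (\<lambda>g. \<phi> g (h (fst p)) (xs (snd p)))" if "p \<in> {..<?r} \<times> {..<?r}" for p
        using pol[OF hS] that by auto
      then obtain d where d: "\<And>p. p \<in> {..<?r} \<times> {..<?r} \<Longrightarrow>
          poly_in j (d p) (\<lambda>g. \<phi> g (h (fst p)) (xs (snd p)))" by metis
      have "poly_in j (\<Sum>p\<in>{..<?r} \<times> {..<?r}. d p) (\<lambda>g. \<phi> g (h i) (xs s))" if "i < ?r" "s < ?r" for i s
      proof (rule poly_in_mono)
        show "poly_in j (d (i, s)) (\<lambda>g. \<phi> g (h i) (xs s))" using d[of "(i, s)"] that by simp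
        show "d (i, s) \<le> (\<Sum>p\<in>{..<?r} \<times> {..<?r}. d p)"
          by (rule member_le_sum) (use that in auto)
      qed
      then show ?thesis by blast
    qed
    then obtain D where D: "\<And>i s. i < ?r \<Longrightarrow> s < ?r \<Longrightarrow> poly_in j D (\<lambda>g. \<phi> g (h i) (xs s))" by blast
    have "poly_in j (\<Sum>i<?r. D) (\<lambda>g. det (mat ?r ?r (\<lambda>(i, s). \<phi> g (h i) (xs s))))"
      by (rule poly_in_det[of _ _ "\<lambda>_. D"]) (rule D)
    then show "\<exists>d. poly_in j d (\<lambda>g. det (mat ?r ?r (\<lambda>(i, s). \<phi> g (h i) (xs s))))" by blast
  next
    fix g assume "det (mat ?r ?r (\<lambda>(i, s). \<phi> g (h i) (xs s))) \<noteq> 0"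
    then show "functions_independent S (\<phi> g)" by (rule det_functions_independent[OF _ h])
  qed
qed

text \<open>An exchange argument without dimension counting: a relation over
  \<open>C \<union> A\<close> rewrites to one over \<open>C \<union> B\<close>. That kills the
  coefficients over \<open>C\<close>, and what remains is a relation inside
  \<open>A\<close>.\<close>

lemma functions_independent_replace:
  assumes fin: "finite A" "finite B" "finite C" and disj: "A \<inter> C = {}" "B \<inter> C = {}"
    and A: "functions_independent A \<phi>" and CB: "functions_independent (C \<union> B) \<psi>"
    and same: "\<And>s x. s \<in> C \<Longrightarrow> \<psi> s x = \<phi> s x"
    and span: "\<And>s. s \<in> A \<Longrightarrow> \<exists>b. \<forall>x. \<phi> s x = (\<Sum>r\<in>B. b r * \<psi> r x)"
  shows "functions_independent (C \<union> A) \<phi>"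
proof (rule functions_independentI)
  fix c s assume zero: "\<And>x. (\<Sum>s\<in>C \<union> A. c s * \<phi> s x) = 0" and s: "s \<in> C \<union> A"
  have "\<exists>b. \<forall>s\<in>A. \<forall>x. \<phi> s x = (\<Sum>r\<in>B. b s r * \<psi> r x)"
    by (rule bchoice, rule ballI) (rule span)
  then obtain b where b: "\<And>s x. s \<in> A \<Longrightarrow> \<phi> s x = (\<Sum>r\<in>B. b s r * \<psi> r x)" by blast
  define c' where "c' r = (if r \<in> C then c r else \<Sum>s\<in>A. c s * b s r)" for r
  have A_eq: "(\<Sum>s\<in>A. c s * \<phi> s x) = (\<Sum>r\<in>B. c' r * \<psi> r x)" for x
  proof -
    have "(\<Sum>s\<in>A. c s * \<phi> s x) = (\<Sum>s\<in>A. \<Sum>r\<in>B. c s * b s r * \<psi> r x)"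
      by (intro sum.cong refl) (simp add: b sum_distrib_left mult.assoc)
    also have "\<dots> = (\<Sum>r\<in>B. \<Sum>s\<in>A. c s * b s r * \<psi> r x)" by (rule sum.swap)
    also have "\<dots> = (\<Sum>r\<in>B. c' r * \<psi> r x)"
      using disj by (intro sum.cong refl) (auto simp: c'_def sum_distrib_right)
    finally show ?thesis .
  qed
  have "(\<Sum>r\<in>C \<union> B. c' r * \<psi> r x) = 0" for x
  proof -
    have "(\<Sum>r\<in>C \<union> B. c' r * \<psi> r x) = (\<Sum>r\<in>C. c' r * \<psi> r x) + (\<Sum>r\<in>B. c' r * \<psi> r x)"
      using fin disj by (intro sum.union_disjoint) auto
    also have "(\<Sum>r\<in>C. c' r * \<psi> r x) = (\<Sum>s\<in>C. c s * \<phi> s x)"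
      by (intro sum.cong refl) (simp add: c'_def same)
    also have "\<dots> + (\<Sum>r\<in>B. c' r * \<psi> r x) = (\<Sum>s\<in>C \<union> A. c s * \<phi> s x)"
      unfolding A_eq[symmetric] using fin disj by (intro sum.union_disjoint[symmetric]) auto
    finally show ?thesis using zero by simp
  qed
  then have c'0: "c' r = 0" if "r \<in> C \<union> B" for r
    using functions_independentD[OF CB] that by blast
  have "(\<Sum>s\<in>A. c s * \<phi> s x) = 0" for x unfolding A_eq using c'0 by simp
  then have "c s = 0" if "s \<in> A" using functions_independentD[OF A] that by blast
  moreover have "c s = 0" if "s \<in> C" using c'0[of s] that by (simp add: c'_def)
  ultimately show "c s = 0" using s by blast
qed

lemma functions_independent_reindex:
  assumes h: "bij_betw h S S'" and eq: "\<And>s x. s \<in> S \<Longrightarrow> \<phi> s x = \<psi> (h s) x"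
    and ind: "functions_independent S' \<psi>"
  shows "functions_independent S \<phi>"
proof (rule functions_independentI)
  fix c s assume zero: "\<And>x. (\<Sum>s\<in>S. c s * \<phi> s x) = 0" and s: "s \<in> S"
  define c' where "c' t = c (inv_into S h t)" for t
  have c': "c' (h s) = c s" if "s \<in> S" for s
    unfolding c'_def using that h by (simp add: bij_betw_inv_into_left)
  have "(\<Sum>t\<in>S'. c' t * \<psi> t x) = 0" for x
  proof -
    have "(\<Sum>t\<in>S'. c' t * \<psi> t x) = (\<Sum>s\<in>S. c' (h s) * \<psi> (h s) x)"
      by (rule sum.reindex_bij_betw[OF h, symmetric])
    also have "\<dots> = (\<Sum>s\<in>S. c s * \<phi> s x)" by (intro sum.cong refl) (simp add: c' eq)
    finally show ?thesis using zero by simp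
  qed
  then have "c' (h s) = 0"
    using functions_independentD[OF ind] bij_betwE[OF h] s by blast
  then show "c s = 0" using c' s by simp
qed

lemma functions_independent_empty: "functions_independent {} \<phi>"
  unfolding functions_independent_def by simp

section \<open>Subspace polynomials\<close>

text \<open>This isolates what the algebraic closure contributes: an additive and surjective
  \<open>q\<close>-th power map with \<open>q\<close> fixed points, and enough elements for generic
  choices.\<close>

locale frobenius_field =
  fixes q :: nat and K :: "'e::field set"
  assumes K_def: "K = {x. x ^ q = x}" and card_K: "card K = q" and q_ge2: "q \<ge> 2"
    and frob_add: "\<And>x y :: 'e. (x + y) ^ q = x ^ q + y ^ q"
    and root_exists: "\<And>x :: 'e. \<exists>y. y ^ q = x"
    and infinite_UNIV: "infinite (UNIV :: 'e set)"
begin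

lemma q_pos: "q > 0" using q_ge2 by simp

lemma finite_K: "finite K"
  using card_K q_pos card_ge_0_finite by metis

lemma frob_0: "(0 :: 'e) ^ q = 0" using q_pos by simp

lemma frob_minus: "(- x :: 'e) ^ q = - (x ^ q)"
proof -
  have "x ^ q + (- x) ^ q = 0" using frob_add[of x "- x"] frob_0 by simp
  then show ?thesis by (simp add: add_eq_0_iff)
qed

lemma frob_diff: "(x - y :: 'e) ^ q = x ^ q - y ^ q"
  using frob_add[of x "- y"] by (simp add: frob_minus)

lemma frob_sum: "(\<Sum>a\<in>A. f a :: 'e) ^ q = (\<Sum>a\<in>A. f a ^ q)"
  by (induction A rule: infinite_finite_induct) (auto simp: frob_add frob_0)

lemma frob_power_sum: "(\<Sum>a\<in>A. f a :: 'e) ^ (q ^ e) = (\<Sum>a\<in>A. f a ^ (q ^ e))"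
proof (induction e)
  case (Suc e)
  have "(\<Sum>a\<in>A. f a) ^ (q ^ Suc e) = ((\<Sum>a\<in>A. f a) ^ (q ^ e)) ^ q"
    by (simp add: power_mult[symmetric] mult.commute)
  also have "\<dots> = (\<Sum>a\<in>A. (f a ^ (q ^ e)) ^ q)" unfolding Suc.IH by (rule frob_sum)
  finally show ?case by (simp add: power_mult[symmetric] mult.commute)
qed simp

lemma K_0: "0 \<in> K" and K_1: "1 \<in> K"
  unfolding K_def using frob_0 by auto

lemma K_uminus: "a \<in> K \<Longrightarrow> - a \<in> K"
  unfolding K_def by (simp add: frob_minus)

lemma K_diff: "a \<in> K \<Longrightarrow> b \<in> K \<Longrightarrow> a - b \<in> K"
  unfolding K_def by (simp add: frob_diff)

lemma K_divide: "a \<in> K \<Longrightarrow> b \<in> K \<Longrightarrow> a / b \<in> K"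
  unfolding K_def by (simp add: power_divide)

text \<open>The homogenised form of \<open>X ^ q - X = (\<Prod>a\<in>K. X - a)\<close>; the
  factorisation itself holds because both sides are monic of degree \<open>q\<close> and agree on
  the \<open>q\<close> elements of \<open>K\<close>.\<close>

lemma prod_K: "(\<Prod>a\<in>K. x - a * y) = x ^ q - y ^ (q - 1) * x"
proof (cases "y = 0")
  case True
  then show ?thesis using card_K q_ge2 by (simp add: power_0_left)
next
  case False
  define p where "p = (\<Prod>a\<in>K. [:- a, 1:])"
  define r where "r = Polynomial.monom (1::'e) q - Polynomial.monom 1 1"
  have degp: "Polynomial.degree p = q"
    unfolding p_def by (simp add: degree_prod_eq_sum_degree card_K)
  have "Polynomial.lead_coeff p = (\<Prod>a\<in>K. Polynomial.lead_coeff [:- a, 1:])"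
    unfolding p_def by (rule lead_coeff_prod)
  then have leadp: "poly.coeff p q = 1" using degp by simp
  have "p = r"
  proof (rule poly_eqI_degree_lead_coeff[of _ q _ K])
    show "poly.coeff p q = poly.coeff r q" using leadp q_ge2 by (simp add: r_def)
    show "Polynomial.degree r \<le> q" unfolding r_def
      by (rule degree_diff_le) (use q_ge2 in \<open>auto intro: order_trans[OF degree_monom_le]\<close>)
    fix z assume z: "z \<in> K"
    have "poly p z = 0" unfolding p_def poly_prod using z finite_K by (intro prod_zero) auto
    moreover have "poly r z = 0" using z unfolding r_def K_def by (simp add: poly_monom)
    ultimately show "poly p z = poly r z" by simp
  qed (use degp card_K in auto)
  from arg_cong[OF this, of "\<lambda>p. poly p (x / y)"]
  have "(\<Prod>a\<in>K. x / y - a) = (x / y) ^ q - x / y" unfolding p_def r_def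
    by (simp add: poly_prod poly_monom)
  moreover have "(\<Prod>a\<in>K. x - a * y) = (\<Prod>a\<in>K. y * (x / y - a))"
    using False by (intro prod.cong refl) (simp add: field_simps)
  ultimately have "(\<Prod>a\<in>K. x - a * y) = y ^ q * ((x / y) ^ q - x / y)"
    by (simp add: prod.distrib card_K)
  also have "\<dots> = x ^ q - y ^ (q - 1) * x"
  proof -
    have "y ^ q = y ^ (q - 1) * y" using q_pos by (metis power_minus_mult)
    then have "y ^ q * (x / y) = y ^ (q - 1) * x" using False by simp
    moreover have "y ^ q * (x / y) ^ q = x ^ q" using False by (simp add: power_divide)
    ultimately show ?thesis by (simp add: right_diff_distrib)
  qed
  finally show ?thesis .
qed

text \<open>The product runs over coefficient vectors rather than over the elements of the span. So
  dependent points yield repeated roots, the degree in \<open>x\<close> is \<open>q ^ card Z\<close>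
  for all \<open>g\<close> (with \<open>Z\<close> finite), and the value is polynomial in the
  points.\<close>

definition span_poly :: "(nat \<Rightarrow> 'e) \<Rightarrow> nat set \<Rightarrow> 'e \<Rightarrow> 'e" where
  "span_poly g Z x = (\<Prod>c\<in>Z \<rightarrow>\<^sub>E K. x - (\<Sum>j\<in>Z. c j * g j))"

lemma span_poly_empty: "span_poly g {} x = x"
  by (simp add: span_poly_def)

lemma span_poly_insert_prod:
  assumes "finite Z" "z \<notin> Z"
  shows "span_poly g (insert z Z) x = (\<Prod>a\<in>K. span_poly g Z (x - a * g z))"
proof -
  have "span_poly g (insert z Z) x =
      (\<Prod>c\<in>K \<times> (Z \<rightarrow>\<^sub>E K). x - (\<Sum>j\<in>insert z Z. ((\<lambda>(y, f). f(z := y)) c) j * g j))"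
    unfolding span_poly_def PiE_insert_eq
    by (subst prod.reindex[OF inj_combinator[OF assms(2)]]) (simp add: comp_def)
  also have "\<dots> = (\<Prod>a\<in>K. \<Prod>f\<in>Z \<rightarrow>\<^sub>E K. x - (\<Sum>j\<in>insert z Z. (f(z := a)) j * g j))"
    by (simp add: prod.cartesian_product case_prod_unfold)
  also have "\<dots> = (\<Prod>a\<in>K. span_poly g Z (x - a * g z))"
    unfolding span_poly_def
  proof (intro prod.cong refl)
    fix a f
    have "(\<Sum>j\<in>Z. (f(z := a)) j * g j) = (\<Sum>j\<in>Z. f j * g j)"
      using assms by (intro sum.cong) auto
    then show "x - (\<Sum>j\<in>insert z Z. (f(z := a)) j * g j) = x - a * g z - (\<Sum>j\<in>Z. f j * g j)"
      using assms by simp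
  qed
  finally show ?thesis .
qed

text \<open>The recursion relies on linearity for the smaller set, while linearity for the larger
  set is read off from the recursion. Stating it conditionally lets one induction deliver
  both.\<close>

lemma span_poly_insert_if_linear:
  assumes "finite Z" "z \<notin> Z"
    and add: "\<And>x y. span_poly g Z (x + y) = span_poly g Z x + span_poly g Z y"
    and scale: "\<And>a x. a \<in> K \<Longrightarrow> span_poly g Z (a * x) = a * span_poly g Z x"
  shows "span_poly g (insert z Z) x = span_poly g Z x ^ q - span_poly g Z (g z) ^ (q - 1) * span_poly g Z x"
proof -
  have "span_poly g Z (x - a * g z) = span_poly g Z x - a * span_poly g Z (g z)" if "a \<in> K" for a
    using add[of x "(- a) * g z"] scale[OF K_uminus[OF that], of "g z"] by simp
  then show ?thesis
    unfolding span_poly_insert_prod[OF assms(1,2)] using prod_K by simp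
qed

lemma span_poly_linear:
  assumes "finite Z"
  shows "span_poly g Z (x + y) = span_poly g Z x + span_poly g Z y"
    and "a \<in> K \<Longrightarrow> span_poly g Z (a * x) = a * span_poly g Z x"
proof -
  have "(\<forall>x y. span_poly g Z (x + y) = span_poly g Z x + span_poly g Z y) \<and>
    (\<forall>a x. a \<in> K \<longrightarrow> span_poly g Z (a * x) = a * span_poly g Z x)"
    using assms
  proof (induction Z)
    case empty
    show ?case by (simp add: span_poly_empty)
  next
    case (insert z Z)
    then have eq: "span_poly g (insert z Z) x
        = span_poly g Z x ^ q - span_poly g Z (g z) ^ (q - 1) * span_poly g Z x" for x
      by (intro span_poly_insert_if_linear) simp_all
    have "(a * b) ^ q = a * b ^ q" if "a \<in> K" for a b
      using that unfolding K_def by (simp add: power_mult_distrib)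
    with insert.IH show ?case
      unfolding eq by (simp add: frob_add algebra_simps)
  qed
  then show "span_poly g Z (x + y) = span_poly g Z x + span_poly g Z y"
    and "a \<in> K \<Longrightarrow> span_poly g Z (a * x) = a * span_poly g Z x" by blast+
qed

lemma span_poly_insert:
  assumes "finite Z" "z \<notin> Z"
  shows "span_poly g (insert z Z) x = span_poly g Z x ^ q - span_poly g Z (g z) ^ (q - 1) * span_poly g Z x"
  by (rule span_poly_insert_if_linear[OF assms]) (use span_poly_linear[OF assms(1)] in auto)

lemma span_poly_eq_0_iff:
  assumes "finite Z"
  shows "span_poly g Z x = 0 \<longleftrightarrow> (\<exists>c\<in>Z \<rightarrow>\<^sub>E K. x = (\<Sum>j\<in>Z. c j * g j))"
  unfolding span_poly_def using assms finite_K by (simp add: prod_zero_iff finite_PiE)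

lemma span_poly_cong:
  "(\<And>j. j \<in> Z \<Longrightarrow> g j = g' j) \<Longrightarrow> span_poly g Z x = span_poly g' Z x"
  unfolding span_poly_def by (intro prod.cong refl) (simp cong: sum.cong)

text \<open>In the recursion the linear term carries the factor \<open>0 ^ (q - 1) = 0\<close>, so a
  Frobenius power is all that is left. This is the origin of the twists.\<close>

lemma span_poly_zero_vector:
  assumes "finite Z" "z \<in> Z" "g z = 0"
  shows "span_poly g Z x = span_poly g (Z - {z}) x ^ q"
proof -
  have "span_poly g (Z - {z}) 0 = 0"
    using span_poly_linear(2)[of "Z - {z}" 0] assms(1) K_0 by simp
  then show ?thesis
    using span_poly_insert[of "Z - {z}" z g x] assms q_ge2 by (simp add: insert_absorb power_0_left)
qed

text \<open>A factor involves \<open>g j\<close> exactly if its coefficient \<open>c j\<close> is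
  nonzero, and then linearly. Counting those coefficient vectors gives the difference of two powers
  of \<open>q\<close>, which is sharper than the full degree \<open>q ^ card Z\<close>.\<close>

lemma poly_in_span_poly:
  assumes "finite Z"
  shows "poly_in j (if j \<in> Z then q ^ card Z - q ^ (card Z - 1) else 0) (\<lambda>g. span_poly g Z x)"
proof (cases "j \<in> Z")
  case False
  have "poly_in j 0 (\<lambda>g. span_poly g Z x)"
    by (rule poly_in_invariant, rule span_poly_cong) (use False in auto)
  with False show ?thesis by simp
next
  case True
  let ?D = "{c \<in> Z \<rightarrow>\<^sub>E K. c j \<noteq> 0}" and ?E = "{c \<in> Z \<rightarrow>\<^sub>E K. c j = 0}"
  have fin: "finite (Z \<rightarrow>\<^sub>E K)" using assms finite_K by (simp add: finite_PiE)
  \<comment> \<open>Vectors with \<open>c j = 0\<close> are vectors on \<open>Z - {j}\<close>; the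
    switch between \<open>0\<close> and \<open>undefined\<close> at \<open>j\<close> is due to the
    extensional function space.\<close>
  have "bij_betw (\<lambda>c. c(j := 0)) ((Z - {j}) \<rightarrow>\<^sub>E K) ?E"
  proof (rule bij_betw_byWitness[where f' = "\<lambda>c. c(j := undefined)"])
    show "\<forall>c\<in>(Z - {j}) \<rightarrow>\<^sub>E K. (c(j := 0))(j := undefined) = c"
      by (auto simp: fun_eq_iff PiE_def extensional_def)
    show "\<forall>c\<in>?E. (c(j := undefined))(j := 0) = c" by (auto simp: fun_eq_iff)
    show "(\<lambda>c. c(j := 0)) ` ((Z - {j}) \<rightarrow>\<^sub>E K) \<subseteq> ?E"
      using True K_0 by (auto simp: PiE_def extensional_def Pi_def)
    show "(\<lambda>c. c(j := undefined)) ` ?E \<subseteq> (Z - {j}) \<rightarrow>\<^sub>E K"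
      by (auto simp: PiE_def extensional_def Pi_def)
  qed
  then have "card ?E = card ((Z - {j}) \<rightarrow>\<^sub>E K)" by (simp add: bij_betw_same_card)
  also have "\<dots> = q ^ (card Z - 1)" using assms True by (simp add: card_PiE card_K)
  finally have cE: "card ?E = q ^ (card Z - 1)" .
  have "card (Z \<rightarrow>\<^sub>E K) = q ^ card Z" using assms by (simp add: card_PiE card_K)
  moreover have "card (Z \<rightarrow>\<^sub>E K) = card (?D \<union> ?E)" by (rule arg_cong[of _ _ card]) auto
  moreover have "card (?D \<union> ?E) = card ?D + card ?E"
    using fin by (intro card_Un_disjoint) auto
  ultimately have cD: "card ?D = q ^ card Z - q ^ (card Z - 1)" using cE by simp
  have "poly_in j (\<Sum>c\<in>Z \<rightarrow>\<^sub>E K. if c j \<noteq> 0 then 1 else 0) (\<lambda>g. span_poly g Z x)"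
    unfolding span_poly_def
  proof (rule poly_in_prod)
    fix c
    show "poly_in j (if c j \<noteq> 0 then 1 else 0) (\<lambda>g. x - (\<Sum>i\<in>Z. c i * g i))"
    proof (cases "c j = 0")
      case True
      then have "(\<Sum>i\<in>Z. c i * (g(j := y)) i) = (\<Sum>i\<in>Z. c i * g i)" for g y
        by (intro sum.cong) auto
      then show ?thesis by (intro poly_in_invariant) simp
    next
      case False
      then show ?thesis
        by (auto intro!: poly_in_diff poly_in_const poly_in_sum poly_in_cmult poly_in_coord[unfolded One_nat_def])
    qed
  qed
  moreover have "(\<Sum>c\<in>Z \<rightarrow>\<^sub>E K. if c j \<noteq> 0 then 1 else 0) = card ?D"
    using fin by (simp add: sum.If_cases Int_def)
  ultimately show ?thesis using True cD by simp
qed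

section \<open>Linear independence over the field with \<open>q\<close> elements\<close>

definition K_indep :: "(nat \<Rightarrow> 'e) \<Rightarrow> nat set \<Rightarrow> bool" where
  "K_indep g Z \<longleftrightarrow>
     (\<forall>c. (\<forall>j\<in>Z. c j \<in> K) \<and> (\<Sum>j\<in>Z. c j * g j) = 0 \<longrightarrow> (\<forall>j\<in>Z. c j = 0))"

lemma K_indepI:
  "(\<And>c j. (\<And>j. j \<in> Z \<Longrightarrow> c j \<in> K) \<Longrightarrow> (\<Sum>j\<in>Z. c j * g j) = 0 \<Longrightarrow> j \<in> Z \<Longrightarrow> c j = 0) \<Longrightarrow> K_indep g Z"
  unfolding K_indep_def by blast

lemma K_indepD:
  "K_indep g Z \<Longrightarrow> (\<And>j. j \<in> Z \<Longrightarrow> c j \<in> K) \<Longrightarrow> (\<Sum>j\<in>Z. c j * g j) = 0 \<Longrightarrow> j \<in> Z \<Longrightarrow> c j = 0"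
  unfolding K_indep_def by blast

lemma K_indep_subset:
  assumes "K_indep g Z" "finite Z" "Y \<subseteq> Z"
  shows "K_indep g Y"
proof (rule K_indepI)
  fix c j assume c: "\<And>j. j \<in> Y \<Longrightarrow> c j \<in> K" "(\<Sum>j\<in>Y. c j * g j) = 0" "j \<in> Y"
  let ?c = "\<lambda>j. if j \<in> Y then c j else 0"
  have "(\<Sum>j\<in>Z. ?c j * g j) = (\<Sum>j\<in>Y. c j * g j)"
    using assms by (intro sum.mono_neutral_cong_right) auto
  then have "?c j = 0"
    by (intro K_indepD[OF assms(1), of ?c]) (use c assms K_0 in auto)
  then show "c j = 0" using c by simp
qed

lemma K_indep_insertD:
  assumes ind: "K_indep g (insert z Z)" and Z: "finite Z" "z \<notin> Z"
  shows "span_poly g Z (g z) \<noteq> 0"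
proof
  assume "span_poly g Z (g z) = 0"
  then obtain c where c: "c \<in> Z \<rightarrow>\<^sub>E K" "g z = (\<Sum>j\<in>Z. c j * g j)"
    using span_poly_eq_0_iff[OF Z(1)] by blast
  let ?c = "c(z := - 1)"
  have "(\<Sum>j\<in>Z. ?c j * g j) = g z" using Z(2) unfolding c(2) by (intro sum.cong) auto
  then have "(\<Sum>j\<in>insert z Z. ?c j * g j) = 0" using Z by simp
  then have "?c z = 0"
    by (intro K_indepD[OF ind, of ?c]) (use c(1) K_uminus[OF K_1] in auto)
  then show False by simp
qed

lemma K_indep_insertI:
  assumes ind: "K_indep g Z" and Z: "finite Z" "z \<notin> Z" and nz: "span_poly g Z (g z) \<noteq> 0"
  shows "K_indep g (insert z Z)"
proof (rule K_indepI)
  fix c j assume c: "\<And>j. j \<in> insert z Z \<Longrightarrow> c j \<in> K" "(\<Sum>j\<in>insert z Z. c j * g j) = 0"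
    and j: "j \<in> insert z Z"
  have sum: "c z * g z + (\<Sum>j\<in>Z. c j * g j) = 0" using c(2) Z by simp
  have "c z = 0"
  proof (rule ccontr)
    assume cz: "c z \<noteq> 0"
    let ?d = "\<lambda>j\<in>Z. - (c j / c z)"
    have "g z = - (\<Sum>j\<in>Z. c j * g j) / c z"
      using cz sum by (simp add: field_simps eq_neg_iff_add_eq_0)
    also have "\<dots> = (\<Sum>j\<in>Z. ?d j * g j)"
      by (simp add: sum_negf[symmetric] sum_divide_distrib)
    finally have "g z = (\<Sum>j\<in>Z. ?d j * g j)" .
    moreover have "?d \<in> Z \<rightarrow>\<^sub>E K" using c(1) by (auto intro!: K_uminus K_divide)
    ultimately have "span_poly g Z (g z) = 0" using span_poly_eq_0_iff[OF Z(1)] by blast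
    with nz show False by simp
  qed
  moreover from this sum have "(\<Sum>j\<in>Z. c j * g j) = 0" by simp
  then have "c j = 0" if "j \<in> Z" by (rule K_indepD[OF ind, rotated]) (use c that in auto)
  ultimately show "c j = 0" using j by blast
qed

lemma K_indep_empty: "K_indep g {}"
  unfolding K_indep_def by simp

text \<open>Fits the greedy choice of points: when a point is chosen, it has to avoid the span of
  its predecessors, and nothing about later points matters.\<close>

lemma K_indep_sequential:
  assumes "finite Z" "\<And>j. j \<in> Z \<Longrightarrow> span_poly g {i \<in> Z. i < j} (g j) \<noteq> 0"
  shows "K_indep g Z"
  using assms
proof (induction Z rule: finite_linorder_max_induct)
  case empty
  show ?case by (rule K_indep_empty)
next
  case (insert b A)
  have eq: "{i \<in> insert b A. i < b} = A" "b \<notin> A" using insert.hyps by auto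
  have "K_indep g A"
  proof (rule insert.IH)
    fix j assume j: "j \<in> A"
    then have "{i \<in> insert b A. i < j} = {i \<in> A. i < j}" using insert.hyps by auto
    then show "span_poly g {i \<in> A. i < j} (g j) \<noteq> 0" using insert.prems[of j] j by simp
  qed
  then show ?case using insert.prems[of b] eq insert.hyps by (intro K_indep_insertI) auto
qed

lemma K_indep_inj_on:
  assumes "K_indep g Z"
  shows "inj_on (\<lambda>c. \<Sum>j\<in>Z. c j * g j) (Z \<rightarrow>\<^sub>E K)"
proof (rule inj_onI)
  fix c d assume cd: "c \<in> Z \<rightarrow>\<^sub>E K" "d \<in> Z \<rightarrow>\<^sub>E K" "(\<Sum>j\<in>Z. c j * g j) = (\<Sum>j\<in>Z. d j * g j)"
  then have "(\<Sum>j\<in>Z. (c j - d j) * g j) = 0" by (simp add: left_diff_distrib sum_subtractf)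
  then have "c j - d j = 0" if "j \<in> Z" for j
    by (rule K_indepD[OF assms, rotated]) (use cd that K_diff in auto)
  then show "c = d" using cd by (intro PiE_ext[of c Z "\<lambda>_. K" d]) auto
qed

lemma card_K_span:
  assumes "K_indep g Z" "finite Z"
  shows "card ((\<lambda>c. \<Sum>j\<in>Z. c j * g j) ` (Z \<rightarrow>\<^sub>E K)) = q ^ card Z"
  using assms by (simp add: card_image[OF K_indep_inj_on] card_PiE card_K)

text \<open>Since \<open>K\<close> is finite, independence is the nonvanishing of finitely many
  nonzero linear forms in the points.\<close>

lemma generic_K_indep:
  assumes "finite Z"
  shows "generic (\<lambda>g. K_indep g Z)"
proof -
  let ?A = "{c \<in> Z \<rightarrow>\<^sub>E K. \<exists>j\<in>Z. c j \<noteq> 0}"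
  have "finite (Z \<rightarrow>\<^sub>E K)" using assms finite_K by (simp add: finite_PiE)
  then have "generic (\<lambda>g. \<forall>c\<in>?A. (\<Sum>j\<in>Z. c j * g j) \<noteq> 0)"
  proof (intro generic_ball[OF infinite_UNIV])
    fix c assume "c \<in> ?A"
    then obtain i where i: "i \<in> Z" "c i \<noteq> 0" by blast
    let ?v = "\<lambda>j. if j = i then 1 else 0"
    have "(\<Sum>j\<in>Z. c j * ?v j) = (\<Sum>j\<in>Z. if j = i then c j else 0)"
      by (intro sum.cong) auto
    also have "\<dots> = c i" using assms i by simp
    finally have nz: "(\<Sum>j\<in>Z. c j * ?v j) \<noteq> 0" using i by simp
    show "generic (\<lambda>g. (\<Sum>j\<in>Z. c j * g j) \<noteq> 0)"
    proof (rule genericI[OF assms, of "\<lambda>g. \<Sum>j\<in>Z. c j * g j", OF _ _ nz])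
      show "\<exists>d. poly_in j d (\<lambda>g. \<Sum>j\<in>Z. c j * g j)" for j
        by (rule exI[of _ 1]) (intro poly_in_sum poly_in_cmult poly_in_coord)
    qed simp_all
  qed simp
  moreover have "K_indep g Z" if "\<forall>c\<in>?A. (\<Sum>j\<in>Z. c j * g j) \<noteq> 0" for g
  proof (rule K_indepI, rule ccontr)
    fix c j assume c: "\<And>j. j \<in> Z \<Longrightarrow> c j \<in> K" "(\<Sum>j\<in>Z. c j * g j) = 0" "j \<in> Z" "c j \<noteq> 0"
    then have "restrict c Z \<in> ?A" by auto
    moreover have "(\<Sum>j\<in>Z. restrict c Z j * g j) = 0" using c(2) by simp
    ultimately show False using that by blast
  qed
  ultimately show ?thesis by (rule generic_mono)
qed

section \<open>Linear terms and right divisors of subspace polynomials\<close>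

lemma span_poly_is_poly: "\<exists>p. \<forall>x. span_poly g Z x = poly p x"
  by (rule exI[of _ "\<Prod>c\<in>Z \<rightarrow>\<^sub>E K. [:- (\<Sum>j\<in>Z. c j * g j), 1:]"])
    (simp add: span_poly_def poly_prod)

lemma poly_vanishing: "(\<And>x. poly p x = 0) \<Longrightarrow> p = (0 :: 'e poly)"
  using poly_roots_finite[of p] infinite_UNIV by auto

text \<open>Each recursion step multiplies the linear coefficient by \<open>- b\<close>, where
  \<open>b\<close> is nonzero by independence. All other terms stay a \<open>q\<close>-th power,
  because constants have \<open>q\<close>-th roots.\<close>

lemma span_poly_linear_part:
  assumes "finite Z" "K_indep g Z"
  shows "\<exists>\<alpha> p. \<alpha> \<noteq> 0 \<and> (\<forall>x. span_poly g Z x = \<alpha> * x + poly p x ^ q)"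
  using assms
proof (induction Z)
  case empty
  show ?case by (rule exI[of _ 1], rule exI[of _ 0]) (use q_pos in \<open>simp add: span_poly_empty\<close>)
next
  case (insert z Z)
  have "K_indep g Z" by (rule K_indep_subset[OF insert.prems]) (use insert.hyps in auto)
  then obtain \<alpha> p where \<alpha>: "\<alpha> \<noteq> 0" and p: "\<And>x. span_poly g Z x = \<alpha> * x + poly p x ^ q"
    using insert.IH by blast
  obtain r where r: "\<And>x. span_poly g Z x = poly r x" using span_poly_is_poly by blast
  define b where "b = span_poly g Z (g z) ^ (q - 1)"
  have b: "b \<noteq> 0" unfolding b_def using K_indep_insertD insert by auto
  \<comment> \<open>The root \<open>d\<close> moves the factor \<open>b\<close> under the
    \<open>q\<close>-th power.\<close>
  obtain d where d: "d ^ q = b" using root_exists by blast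
  have "span_poly g (insert z Z) x = (- (b * \<alpha>)) * x + poly (r - smult d p) x ^ q" for x
  proof -
    have "span_poly g (insert z Z) x = span_poly g Z x ^ q - b * span_poly g Z x"
      unfolding b_def using insert.hyps by (rule span_poly_insert)
    also have "\<dots> = poly r x ^ q - b * (\<alpha> * x + poly p x ^ q)" using r p by metis
    also have "\<dots> = (- (b * \<alpha>)) * x + poly (r - smult d p) x ^ q"
      by (simp add: frob_diff power_mult_distrib d algebra_simps)
    finally show ?thesis .
  qed
  then show ?case using b \<alpha> by (intro exI[of _ "- (b * \<alpha>)"] exI[of _ "r - smult d p"]) auto
qed

text \<open>Right divisibility of linearized polynomials: the polynomial of
  \<open>A \<union> Y\<close> is a linearized polynomial of \<open>q\<close>-degree
  \<open>card A\<close> applied to that of \<open>Y\<close>.\<close>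

lemma span_poly_in_span:
  assumes "finite A" "finite Y" "A \<inter> Y = {}"
  shows "\<exists>b. \<forall>x. span_poly g (A \<union> Y) x = (\<Sum>s\<le>card A. b s * span_poly g Y x ^ (q ^ s))"
  using assms
proof (induction A)
  case empty
  show ?case by (rule exI[of _ "\<lambda>_. 1"]) simp
next
  case (insert z A)
  then obtain b where b: "\<And>x. span_poly g (A \<union> Y) x = (\<Sum>s\<le>card A. b s * span_poly g Y x ^ (q ^ s))"
    by auto
  define \<kappa> where "\<kappa> = span_poly g (A \<union> Y) (g z) ^ (q - 1)"
  \<comment> \<open>The first term is the Frobenius image of \<open>b\<close>, shifted by one
    exponent; the second is the multiple subtracted by the recursion.\<close>
  define b' where "b' s = (if s = 0 then 0 else b (s - 1) ^ q) - \<kappa> * (if s \<le> card A then b s else 0)" for s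
  have "span_poly g (insert z A \<union> Y) x = (\<Sum>s\<le>card (insert z A). b' s * span_poly g Y x ^ (q ^ s))" for x
  proof -
    let ?f = "\<lambda>s. span_poly g Y x ^ (q ^ s)"
    have "span_poly g (insert z A \<union> Y) x = span_poly g (A \<union> Y) x ^ q - \<kappa> * span_poly g (A \<union> Y) x"
      unfolding \<kappa>_def Un_insert_left by (rule span_poly_insert) (use insert in auto)
    also have "\<dots> = (\<Sum>s\<le>card A. b s ^ q * ?f (Suc s)) - \<kappa> * (\<Sum>s\<le>card A. b s * ?f s)"
      unfolding b frob_sum
      by (simp add: power_mult_distrib power_mult[symmetric] mult.commute)
    also have "(\<Sum>s\<le>card A. b s ^ q * ?f (Suc s)) =
        (\<Sum>s\<le>Suc (card A). (if s = 0 then 0 else b (s - 1) ^ q) * ?f s)"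
      by (subst sum.atMost_Suc_shift) simp
    also have "(\<Sum>s\<le>card A. b s * ?f s) = (\<Sum>s\<le>Suc (card A). (if s \<le> card A then b s else 0) * ?f s)"
      by simp
    also have "(\<Sum>s\<le>Suc (card A). (if s = 0 then 0 else b (s - 1) ^ q) * ?f s)
        - \<kappa> * (\<Sum>s\<le>Suc (card A). (if s \<le> card A then b s else 0) * ?f s)
        = (\<Sum>s\<le>Suc (card A). b' s * ?f s)"
      unfolding b'_def sum_distrib_left sum_subtractf[symmetric]
      by (intro sum.cong refl) (simp add: algebra_simps)
    finally show ?thesis using insert.hyps by simp
  qed
  then show ?case by blast
qed

section \<open>Frobenius twists and their counting condition\<close>

definition frob_family :: "(nat \<Rightarrow> 'e) \<Rightarrow> (nat \<Rightarrow> nat set) \<Rightarrow> nat \<times> nat \<Rightarrow> 'e \<Rightarrow> 'e" where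
  "frob_family g Z s x = span_poly g (Z (fst s)) x ^ (q ^ snd s)"

text \<open>The member \<open>(i, e)\<close> has \<open>q\<close>-degree
  \<open>card (Z i) + e\<close>, so the upper end of the range keeps the family in the
  \<open>k\<close>-dimensional space of linearized polynomials of \<open>q\<close>-degree below
  \<open>k\<close>.\<close>

definition frob_index :: "nat \<Rightarrow> nat set \<Rightarrow> (nat \<Rightarrow> nat set) \<Rightarrow> (nat \<Rightarrow> nat) \<Rightarrow> (nat \<times> nat) set" where
  "frob_index k I Z \<tau> = Sigma I (\<lambda>i. {\<tau> i..<k - card (Z i)})"

text \<open>The number \<open>t\<close> ranges over the lower bounds of \<open>\<tau>\<close> on \<open>\<Omega>\<close>, so the inequality really involves the minimum
  of \<open>\<tau>\<close>. It says that the twists indexed by \<open>\<Omega>\<close> are not more numerous than the dimension of the space of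
  linearized polynomials divisible by their greatest common right divisor.\<close>
definition admissible :: "nat \<Rightarrow> nat set \<Rightarrow> (nat \<Rightarrow> nat set) \<Rightarrow> (nat \<Rightarrow> nat) \<Rightarrow> bool" where
  "admissible k I Z \<tau> \<longleftrightarrow> finite I \<and> (\<forall>i\<in>I. finite (Z i) \<and> \<tau> i + card (Z i) \<le> k) \<and>
     (\<forall>\<Omega> t. \<Omega> \<subseteq> I \<and> \<Omega> \<noteq> {} \<and> (\<forall>i\<in>\<Omega>. t \<le> \<tau> i) \<longrightarrow>
        (\<Sum>i\<in>\<Omega>. k - \<tau> i - card (Z i)) + t + card (\<Inter>i\<in>\<Omega>. Z i) \<le> k)"

lemma admissibleD:
  assumes "admissible k I Z \<tau>"
  shows "finite I" "i \<in> I \<Longrightarrow> finite (Z i)" "i \<in> I \<Longrightarrow> \<tau> i + card (Z i) \<le> k"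
    "\<Omega> \<subseteq> I \<Longrightarrow> \<Omega> \<noteq> {} \<Longrightarrow> (\<And>i. i \<in> \<Omega> \<Longrightarrow> t \<le> \<tau> i) \<Longrightarrow>
      (\<Sum>i\<in>\<Omega>. k - \<tau> i - card (Z i)) + t + card (\<Inter>i\<in>\<Omega>. Z i) \<le> k"
  using assms unfolding admissible_def by blast+

lemma admissibleI:
  assumes "finite I" "\<And>i. i \<in> I \<Longrightarrow> finite (Z i)" "\<And>i. i \<in> I \<Longrightarrow> \<tau> i + card (Z i) \<le> k"
    "\<And>\<Omega> t. \<Omega> \<subseteq> I \<Longrightarrow> \<Omega> \<noteq> {} \<Longrightarrow> (\<And>i. i \<in> \<Omega> \<Longrightarrow> t \<le> \<tau> i) \<Longrightarrow>
      (\<Sum>i\<in>\<Omega>. k - \<tau> i - card (Z i)) + t + card (\<Inter>i\<in>\<Omega>. Z i) \<le> k"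
  shows "admissible k I Z \<tau>"
  using assms unfolding admissible_def by blast

lemma admissible_subset: "admissible k I Z \<tau> \<Longrightarrow> J \<subseteq> I \<Longrightarrow> admissible k J Z \<tau>"
  unfolding admissible_def by (meson finite_subset subset_trans subsetD)

lemma finite_frob_index: "finite I \<Longrightarrow> finite (frob_index k I Z \<tau>)"
  unfolding frob_index_def by auto

text \<open>A single good choice of points is upgraded to a generic one, so that several induction
  hypotheses can be realised at the same points.\<close>

lemma generic_frob_family:
  assumes "admissible k I Z \<tau>" "functions_independent (frob_index k I Z \<tau>) (frob_family g0 Z)"
  shows "generic (\<lambda>g. functions_independent (frob_index k I Z \<tau>) (frob_family g Z))"
proof (rule generic_functions_independent[where V = "\<Union>i\<in>I. Z i" and \<phi> = "\<lambda>g. frob_family g Z", OF _ assms(2)])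
  show "finite (frob_index k I Z \<tau>)" "finite (\<Union>i\<in>I. Z i)"
    using admissibleD[OF assms(1)] by (auto intro: finite_frob_index)
next
  fix s x j assume "s \<in> frob_index k I Z \<tau>"
  then have "finite (Z (fst s))" using admissibleD(2)[OF assms(1)] unfolding frob_index_def by auto
  from poly_in_power[OF poly_in_span_poly[OF this]]
  show "\<exists>d. poly_in j d (\<lambda>g. frob_family g Z s x)" unfolding frob_family_def by blast
next
  fix g g' :: "nat \<Rightarrow> 'e" and s x
  assume "s \<in> frob_index k I Z \<tau>" "\<And>j. j \<in> (\<Union>i\<in>I. Z i) \<Longrightarrow> g j = g' j"
  moreover from this have "fst s \<in> I" unfolding frob_index_def by auto
  ultimately have "g j = g' j" if "j \<in> Z (fst s)" for j using that by blast
  from span_poly_cong[OF this] show "frob_family g Z s x = frob_family g' Z s x"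
    unfolding frob_family_def by simp
qed

text \<open>The only member with exponent zero has a nonzero linear term, while all others are \<open>q\<close>-th powers of
  polynomials; so its coefficient vanishes and \<open>q\<close>-th roots can be extracted.\<close>
lemma frob_family_independent_root:
  assumes I: "finite I" "\<And>i. i \<in> I \<Longrightarrow> finite (Z i)" "\<And>i. i \<in> I \<Longrightarrow> \<tau> i + card (Z i) < k"
    and uniq: "\<And>i j. i \<in> I \<Longrightarrow> j \<in> I \<Longrightarrow> \<tau> i = 0 \<Longrightarrow> \<tau> j = 0 \<Longrightarrow> i = j"
    and Kind: "\<And>i. i \<in> I \<Longrightarrow> \<tau> i = 0 \<Longrightarrow> K_indep g (Z i)"
    and ind: "functions_independent (frob_index (k - 1) I Z (\<lambda>i. \<tau> i - 1)) (frob_family g Z)"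
  shows "functions_independent (frob_index k I Z \<tau>) (frob_family g Z)"
proof (rule functions_independentI)
  let ?S = "frob_index k I Z \<tau>" and ?S' = "frob_index (k - 1) I Z (\<lambda>i. \<tau> i - 1)"
  let ?h = "\<lambda>s. (fst s, Suc (snd s)) :: nat \<times> nat"
  let ?T = "{i \<in> I. \<tau> i = 0} \<times> {0 :: nat}"
  fix c s assume zero: "\<And>x. (\<Sum>s\<in>?S. c s * frob_family g Z s x) = 0" and s: "s \<in> ?S"
  \<comment> \<open>Positive exponents are the successors of the indices for \<open>k - 1\<close>.
    Truncated subtraction is harmless here: if \<open>\<tau> i = 0\<close>, the exponents
    \<open>e \<ge> 1\<close> still correspond to \<open>e - 1 \<ge> 0\<close>.\<close>
  have S_eq: "?S = ?T \<union> ?h ` ?S'"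
  proof (rule Set.set_eqI)
    fix p :: "nat \<times> nat"
    obtain i e where p: "p = (i, e)" by (cases p)
    show "p \<in> ?S \<longleftrightarrow> p \<in> ?T \<union> ?h ` ?S'"
    proof (cases e)
      case 0
      then show ?thesis using I(3)[of i] unfolding p frob_index_def by auto
    next
      case (Suc e')
      have "(i, Suc e') \<in> ?h ` ?S' \<longleftrightarrow> (i, e') \<in> ?S'" by force
      then show ?thesis unfolding p Suc frob_index_def by auto
    qed
  qed
  have fin: "finite ?T" "finite ?S'" using I(1) finite_frob_index by auto
  \<comment> \<open>With \<open>q\<close>-th roots of the coefficients, the part with positive
    exponents is the \<open>q\<close>-th power of \<open>R\<close>, a combination of the smaller
    family.\<close>
  define b where "b s = (SOME y. y ^ q = c s)" for s
  have b: "b s ^ q = c s" for s unfolding b_def by (rule someI_ex) (rule root_exists)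
  have inj: "inj_on ?h ?S'" by (auto simp: inj_on_def)
  define R where "R x = (\<Sum>s\<in>?S'. b (?h s) * frob_family g Z s x)" for x
  have split: "(\<Sum>s\<in>?T. c s * frob_family g Z s x) + R x ^ q = 0" for x
  proof -
    have "(\<Sum>s\<in>?h ` ?S'. c s * frob_family g Z s x) = (\<Sum>s\<in>?S'. c (?h s) * frob_family g Z (?h s) x)"
      by (rule sum.reindex_cong[OF inj]) auto
    also have "\<dots> = (\<Sum>s\<in>?S'. (b (?h s) * frob_family g Z s x) ^ q)"
      by (intro sum.cong refl) (simp add: power_mult_distrib b frob_family_def power_mult[symmetric] mult.commute)
    also have "\<dots> = R x ^ q" unfolding R_def by (rule frob_sum[symmetric])
    finally have "(\<Sum>s\<in>?h ` ?S'. c s * frob_family g Z s x) = R x ^ q" .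
    moreover have "(\<Sum>s\<in>?S. c s * frob_family g Z s x)
        = (\<Sum>s\<in>?T. c s * frob_family g Z s x) + (\<Sum>s\<in>?h ` ?S'. c s * frob_family g Z s x)"
      unfolding S_eq using fin by (intro sum.union_disjoint) auto
    ultimately show ?thesis using zero[of x] by simp
  qed
  have c0: "c s = 0" if sT: "s \<in> ?T" for s
  proof -
    obtain i where s: "s = (i, 0)" and i: "i \<in> I" "\<tau> i = 0" using sT by auto
    \<comment> \<open>By uniqueness at most one linear term occurs, so no cancellation between
      linear terms is possible.\<close>
    have S0: "?T = {(i, 0)}" using uniq i by auto
    obtain \<alpha> p where \<alpha>: "\<alpha> \<noteq> 0" and p: "\<And>x. span_poly g (Z i) x = \<alpha> * x + poly p x ^ q"
      using span_poly_linear_part[OF I(2)[OF i(1)] Kind[OF i]] by blast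
    have "\<exists>u. \<forall>j x. span_poly g (Z j) x = poly (u j) x"
      by (intro choice allI span_poly_is_poly)
    then obtain u where u: "\<And>j x. span_poly g (Z j) x = poly (u j) x" by blast
    define r where "r = (\<Sum>s\<in>?S'. smult (b (?h s)) (u (fst s) ^ (q ^ snd s)))"
    have r: "R x = poly r x" for x unfolding R_def r_def frob_family_def by (simp add: poly_sum u)
    define w where "w = smult (b (i, 0)) p + r"
    have "poly ([:0, c (i, 0) * \<alpha>:] + w ^ q) x = 0" for x
    proof -
      have "c (i, 0) * (\<alpha> * x + poly p x ^ q) + poly r x ^ q = 0"
        using split[of x] unfolding S0 r by (simp add: frob_family_def p)
      then show ?thesis
        by (simp add: w_def frob_add power_mult_distrib b algebra_simps)
    qed
    then have "[:0, c (i, 0) * \<alpha>:] + w ^ q = 0" by (rule poly_vanishing)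
    then have eq: "w ^ q = [:0, - (c (i, 0) * \<alpha>):]" by (simp add: add_eq_0_iff)
    \<comment> \<open>A \<open>q\<close>-th power of a polynomial has degree divisible by
      \<open>q \<ge> 2\<close>, hence cannot equal a nonzero multiple of \<open>x\<close>.\<close>
    have "c (i, 0) * \<alpha> = 0"
    proof (rule ccontr)
      assume nz: "c (i, 0) * \<alpha> \<noteq> 0"
      then have "Polynomial.degree (w ^ q) = 1" unfolding eq by simp
      moreover have "w \<noteq> 0" using nz eq q_pos by (auto simp: power_0_left)
      ultimately have "q * Polynomial.degree w = 1" by (simp add: degree_power_eq)
      then show False using q_ge2 by simp
    qed
    then show "c s = 0" using \<alpha> s by simp
  qed
  have "R x = 0" for x using split[of x] c0 by (simp add: sum.neutral)
  then have b0: "b (?h s) = 0" if "s \<in> ?S'" for s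
    using functions_independentD[OF ind, of "\<lambda>s. b (?h s)"] that unfolding R_def by blast
  have "c (?h s) = 0" if "s \<in> ?S'" for s
    using b0[OF that] b[of "?h s"] frob_0 by simp
  then have "c s = 0" if "s \<in> ?h ` ?S'" for s using that by auto
  moreover have "s \<in> ?T \<or> s \<in> ?h ` ?S'" using s unfolding S_eq by simp
  ultimately show "c s = 0" using c0 by blast
qed

text \<open>Setting the point \<open>z\<close> to zero trades membership of \<open>z\<close> in \<open>Z i\<close> for one Frobenius twist.\<close>
lemma frob_family_independent_specialise:
  assumes I: "\<And>i. i \<in> I \<Longrightarrow> finite (Z i)"
    and ind: "functions_independent
      (frob_index k I (\<lambda>i. Z i - {z}) (\<lambda>i. \<tau> i + (if z \<in> Z i then 1 else 0)))
      (frob_family g (\<lambda>i. Z i - {z}))"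
  shows "functions_independent (frob_index k I Z \<tau>) (frob_family (g(z := 0)) Z)"
proof (rule functions_independent_reindex[OF _ _ ind])
  let ?\<delta> = "\<lambda>i. if z \<in> Z i then 1 else 0 :: nat"
  let ?h = "\<lambda>s :: nat \<times> nat. (fst s, snd s + ?\<delta> (fst s))"
  let ?h' = "\<lambda>s :: nat \<times> nat. (fst s, snd s - ?\<delta> (fst s))"
  let ?S = "frob_index k I Z \<tau>" and ?S' = "frob_index k I (\<lambda>i. Z i - {z}) (\<lambda>i. \<tau> i + ?\<delta> i)"
  \<comment> \<open>Losing one element raises the upper end of the exponent range by one, just as
    the twist raises the lower end, so the range is merely shifted.\<close>
  have card: "card (Z i) = card (Z i - {z}) + ?\<delta> i" if "i \<in> I" for i
    using card_Suc_Diff1[OF I[OF that], of z] by (cases "z \<in> Z i") simp_all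
  show "bij_betw ?h ?S ?S'"
  proof (rule bij_betw_byWitness[where f' = ?h'])
    show "\<forall>s\<in>?S. ?h' (?h s) = s" by auto
    show "\<forall>s\<in>?S'. ?h (?h' s) = s" unfolding frob_index_def by auto
    show "?h ` ?S \<subseteq> ?S'"
    proof
      fix p assume "p \<in> ?h ` ?S"
      then obtain s where s: "s \<in> ?S" "p = ?h s" by blast
      obtain i e where "s = (i, e)" by (cases s)
      with s have ie: "i \<in> I" "\<tau> i \<le> e" "e < k - card (Z i)" "p = (i, e + ?\<delta> i)"
        unfolding frob_index_def by simp_all
      have "e + ?\<delta> i < k - card (Z i - {z})" using ie(3) card[OF ie(1)] by linarith
      then show "p \<in> ?S'" using ie unfolding frob_index_def by simp
    qed
    show "?h' ` ?S' \<subseteq> ?S"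
    proof
      fix p assume "p \<in> ?h' ` ?S'"
      then obtain s where s: "s \<in> ?S'" "p = ?h' s" by blast
      obtain i e where "s = (i, e)" by (cases s)
      with s have ie: "i \<in> I" "\<tau> i + ?\<delta> i \<le> e" "e < k - card (Z i - {z})" "p = (i, e - ?\<delta> i)"
        unfolding frob_index_def by simp_all
      have "e - ?\<delta> i < k - card (Z i)" using ie(2,3) card[OF ie(1)] by linarith
      moreover have "\<tau> i \<le> e - ?\<delta> i" using ie(2) by linarith
      ultimately show "p \<in> ?S" using ie(1,4) unfolding frob_index_def by simp
    qed
  qed
  fix s x assume "s \<in> ?S"
  then have "fst s \<in> I" unfolding frob_index_def by auto
  from I[OF this] have fin: "finite (Z (fst s))" .
  have eq: "span_poly (g(z := 0)) (Z (fst s) - {z}) x = span_poly g (Z (fst s) - {z}) x"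
    by (rule span_poly_cong) auto
  show "frob_family (g(z := 0)) Z s x = frob_family g (\<lambda>i. Z i - {z}) (?h s) x"
  proof (cases "z \<in> Z (fst s)")
    case True
    then show ?thesis
      using span_poly_zero_vector[OF fin True, of "g(z := 0)" x] eq
      by (simp add: frob_family_def power_mult[symmetric])
  next
    case False
    then show ?thesis using eq by (simp add: frob_family_def)
  qed
qed

text \<open>The right-hand side drops by one, and so must the left. If \<open>\<Omega>\<close>
  contains the index with bound zero, that index loses one twist and \<open>t = 0\<close>. Otherwise
  all counts persist, but the old inequality is available for \<open>t + 1\<close>.\<close>

lemma admissible_root:
  assumes adm: "admissible k I Z \<tau>" and lt: "\<And>i. i \<in> I \<Longrightarrow> \<tau> i + card (Z i) < k"
    and uniq: "\<And>i j. i \<in> I \<Longrightarrow> j \<in> I \<Longrightarrow> \<tau> i = 0 \<Longrightarrow> \<tau> j = 0 \<Longrightarrow> i = j"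
  shows "admissible (k - 1) I Z (\<lambda>i. \<tau> i - 1)"
proof (rule admissibleI)
  fix i assume "i \<in> I"
  then show "\<tau> i - 1 + card (Z i) \<le> k - 1" using lt[of i] by linarith
next
  fix \<Omega> t assume \<Omega>: "\<Omega> \<subseteq> I" "\<Omega> \<noteq> {}" and t: "\<And>i. i \<in> \<Omega> \<Longrightarrow> t \<le> \<tau> i - 1"
  have fin: "finite \<Omega>" using \<Omega>(1) admissibleD(1)[OF adm] finite_subset by blast
  let ?d' = "\<lambda>i. k - 1 - (\<tau> i - 1) - card (Z i)" and ?d = "\<lambda>i. k - \<tau> i - card (Z i)"
  have same: "?d' i = ?d i" if "i \<in> \<Omega>" "\<tau> i \<noteq> 0" for i using that by simp
  show "(\<Sum>i\<in>\<Omega>. ?d' i) + t + card (\<Inter>i\<in>\<Omega>. Z i) \<le> k - 1"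
  proof (cases "\<exists>i0\<in>\<Omega>. \<tau> i0 = 0")
    case True
    then obtain i0 where i0: "i0 \<in> \<Omega>" "\<tau> i0 = 0" by blast
    have t0: "t = 0" using t[OF i0(1)] i0(2) by simp
    have "(\<Sum>i\<in>\<Omega> - {i0}. ?d' i) = (\<Sum>i\<in>\<Omega> - {i0}. ?d i)"
      by (intro sum.cong refl same) (use uniq i0 \<Omega>(1) in auto)
    moreover have "Suc (?d' i0) = ?d i0" using i0 lt[of i0] \<Omega>(1) by auto
    ultimately have "Suc (\<Sum>i\<in>\<Omega>. ?d' i) = (\<Sum>i\<in>\<Omega>. ?d i)"
      using fin i0 by (simp add: sum.remove)
    then show ?thesis using admissibleD(4)[OF adm \<Omega>, of 0] t0 by simp
  next
    case False
    then have "(\<Sum>i\<in>\<Omega>. ?d' i) = (\<Sum>i\<in>\<Omega>. ?d i)" by (intro sum.cong refl same) auto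
    moreover have "Suc t \<le> \<tau> i" if "i \<in> \<Omega>" for i
    proof -
      have "\<tau> i \<noteq> 0" using that False by auto
      then show ?thesis using t[OF that] by linarith
    qed
    ultimately show ?thesis using admissibleD(4)[OF adm \<Omega>, of "Suc t"] by simp
  qed
qed (use admissibleD[OF adm] in auto)

text \<open>The number of twists per index is unchanged, and the danger is that \<open>t\<close>
  grows by one. A single index obeys its own bound, an intermediate \<open>\<Omega>\<close> has one
  unit of slack by strictness, and for the whole of \<open>I\<close> the index \<open>j\<close>
  forces \<open>t = 0\<close>.\<close>

lemma admissible_specialise:
  assumes adm: "admissible k I Z \<tau>"
    and strict: "\<And>\<Omega> t. \<Omega> \<subseteq> I \<Longrightarrow> 2 \<le> card \<Omega> \<Longrightarrow> card \<Omega> < card I \<Longrightarrow> (\<And>i. i \<in> \<Omega> \<Longrightarrow> t \<le> \<tau> i) \<Longrightarrow>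
      (\<Sum>i\<in>\<Omega>. k - \<tau> i - card (Z i)) + t + card (\<Inter>i\<in>\<Omega>. Z i) < k"
    and j: "j \<in> I" "\<tau> j = 0" "z \<notin> Z j"
  shows "admissible k I (\<lambda>i. Z i - {z}) (\<lambda>i. \<tau> i + (if z \<in> Z i then 1 else 0))"
proof (rule admissibleI)
  let ?\<tau> = "\<lambda>i. \<tau> i + (if z \<in> Z i then 1 else 0)"
  have total: "?\<tau> i + card (Z i - {z}) = \<tau> i + card (Z i)" if "i \<in> I" for i
    using card_Suc_Diff1[OF admissibleD(2)[OF adm that], of z] by (cases "z \<in> Z i") simp_all
  show "?\<tau> i + card (Z i - {z}) \<le> k" if "i \<in> I" for i
    unfolding total[OF that] by (rule admissibleD(3)[OF adm that])
  fix \<Omega> t assume \<Omega>: "\<Omega> \<subseteq> I" "\<Omega> \<noteq> {}" and t: "\<And>i. i \<in> \<Omega> \<Longrightarrow> t \<le> ?\<tau> i"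
  have fin: "finite \<Omega>" using \<Omega>(1) admissibleD(1)[OF adm] finite_subset by blast
  have "k - ?\<tau> i - card (Z i - {z}) = k - \<tau> i - card (Z i)" if "i \<in> \<Omega>" for i
    using total[of i] that \<Omega>(1) by (auto simp: diff_diff_left)
  then have sum: "(\<Sum>i\<in>\<Omega>. k - ?\<tau> i - card (Z i - {z})) = (\<Sum>i\<in>\<Omega>. k - \<tau> i - card (Z i))"
    by (rule sum.cong[OF refl])
  obtain i1 where i1: "i1 \<in> \<Omega>" using \<Omega>(2) by blast
  have finI: "finite (\<Inter>i\<in>\<Omega>. Z i)"
    by (rule finite_subset[of _ "Z i1"]) (use i1 \<Omega> admissibleD(2)[OF adm] in auto)
  have cle: "card (\<Inter>i\<in>\<Omega>. Z i - {z}) \<le> card (\<Inter>i\<in>\<Omega>. Z i)"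
    by (rule card_mono[OF finI]) auto
  have "card \<Omega> \<noteq> 0" using \<Omega>(2) fin by simp
  moreover have "card \<Omega> \<le> card I" using card_mono[OF admissibleD(1)[OF adm] \<Omega>(1)] .
  moreover have "\<Omega> = I" if "card \<Omega> = card I"
    using card_subset_eq[OF admissibleD(1)[OF adm] \<Omega>(1) that] .
  ultimately consider "card \<Omega> = 1" | "2 \<le> card \<Omega>" "card \<Omega> < card I" | "\<Omega> = I"
    by linarith
  then show "(\<Sum>i\<in>\<Omega>. k - ?\<tau> i - card (Z i - {z})) + t + card (\<Inter>i\<in>\<Omega>. Z i - {z}) \<le> k"
  proof cases
    case 1
    then obtain i where i: "\<Omega> = {i}" using card_1_singletonE by blast
    then have "i \<in> I" using \<Omega>(1) by simp
    then show ?thesis unfolding sum using total[of i] t[of i] i admissibleD(3)[OF adm, of i] by simp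
  next
    case 2
    have "(\<Sum>i\<in>\<Omega>. k - \<tau> i - card (Z i)) + (t - 1) + card (\<Inter>i\<in>\<Omega>. Z i) < k"
    proof (rule strict[OF \<Omega>(1) 2])
      \<comment> \<open>The bounds have grown by at most one, so lowering \<open>t\<close> by one
        makes it legal for the old bounds; strictness pays for the difference.\<close>
      show "t - 1 \<le> \<tau> i" if "i \<in> \<Omega>" for i using t[OF that] by (auto split: if_splits)
    qed
    then show ?thesis unfolding sum using cle by linarith
  next
    case 3
    then have "t = 0" using t[of j] j by simp
    then show ?thesis unfolding sum using admissibleD(4)[OF adm \<Omega>, of 0] cle by simp
  qed
qed (use admissibleD[OF adm] in auto)

text \<open>For a tight set \<open>\<Omega>0\<close> the twists indexed by \<open>\<Omega>0\<close> may be replaced by those of their greatest common right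
  divisor, which has the root space of \<open>\<Inter>i\<in>\<Omega>0. Z i\<close> and the twist \<open>t0\<close>.\<close>
lemma admissible_merge:
  assumes adm: "admissible k I Z \<tau>" and \<Omega>0: "\<Omega>0 \<subseteq> I" "i1 \<in> \<Omega>0" and t0: "\<And>i. i \<in> \<Omega>0 \<Longrightarrow> t0 \<le> \<tau> i"
    and tight: "(\<Sum>i\<in>\<Omega>0. k - \<tau> i - card (Z i)) + t0 + card (\<Inter>i\<in>\<Omega>0. Z i) = k"
  shows "admissible k (insert i1 (I - \<Omega>0)) (Z(i1 := \<Inter>i\<in>\<Omega>0. Z i)) (\<tau>(i1 := t0))"
proof (rule admissibleI)
  let ?I = "insert i1 (I - \<Omega>0)" and ?Z = "Z(i1 := \<Inter>i\<in>\<Omega>0. Z i)" and ?\<tau> = "\<tau>(i1 := t0)"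
  show "finite ?I" using admissibleD(1)[OF adm] by simp
  have finI: "finite (\<Inter>i\<in>\<Omega>0. Z i)"
    by (rule finite_subset[of _ "Z i1"]) (use \<Omega>0 admissibleD(2)[OF adm] in auto)
  show "finite (?Z i)" if "i \<in> ?I" for i
    using that finI admissibleD(2)[OF adm] by auto
  show "?\<tau> i + card (?Z i) \<le> k" if "i \<in> ?I" for i
    using that tight admissibleD(3)[OF adm] by auto
  fix \<Omega> t assume \<Omega>: "\<Omega> \<subseteq> ?I" "\<Omega> \<noteq> {}" and t: "\<And>i. i \<in> \<Omega> \<Longrightarrow> t \<le> ?\<tau> i"
  let ?d = "\<lambda>i. k - \<tau> i - card (Z i)" and ?d' = "\<lambda>i. k - ?\<tau> i - card (?Z i)"
  show "(\<Sum>i\<in>\<Omega>. ?d' i) + t + card (\<Inter>i\<in>\<Omega>. ?Z i) \<le> k"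
  proof (cases "i1 \<in> \<Omega>")
    case False
    have "(\<Sum>i\<in>\<Omega>. ?d' i) = (\<Sum>i\<in>\<Omega>. ?d i)" using False by (intro sum.cong) auto
    moreover have "(\<Inter>i\<in>\<Omega>. ?Z i) = (\<Inter>i\<in>\<Omega>. Z i)" using False by auto
    moreover have "\<Omega> \<subseteq> I" using False \<Omega> \<Omega>0 by auto
    moreover have "t \<le> \<tau> i" if "i \<in> \<Omega>" for i
      using t[OF that] that False by (auto split: if_splits)
    ultimately show ?thesis using admissibleD(4)[OF adm _ \<Omega>(2), of t] by simp
  next
    case True
    \<comment> \<open>The inequality for the merged family is the old one with \<open>i1\<close>
      expanded back into all of \<open>\<Omega>0\<close>.\<close>
    let ?\<Omega> = "(\<Omega> - {i1}) \<union> \<Omega>0"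
    have fin: "finite \<Omega>" "finite \<Omega>0"
      using \<Omega>(1) \<Omega>0(1) admissibleD(1)[OF adm] finite_subset by blast+
    have disj: "(\<Omega> - {i1}) \<inter> \<Omega>0 = {}" using \<Omega>(1) by auto
    \<comment> \<open>This is where tightness enters: the divisor has exactly as many twists as all
      members of \<open>\<Omega>0\<close> together.\<close>
    have "?d' i1 = (\<Sum>i\<in>\<Omega>0. ?d i)" using tight by simp
    moreover have "(\<Sum>i\<in>\<Omega> - {i1}. ?d' i) = (\<Sum>i\<in>\<Omega> - {i1}. ?d i)" by (intro sum.cong) auto
    moreover have "(\<Sum>i\<in>\<Omega>. ?d' i) = ?d' i1 + (\<Sum>i\<in>\<Omega> - {i1}. ?d' i)"
      using fin True by (simp only: sum.remove)
    moreover have "(\<Sum>i\<in>?\<Omega>. ?d i) = (\<Sum>i\<in>\<Omega> - {i1}. ?d i) + (\<Sum>i\<in>\<Omega>0. ?d i)"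
      using fin disj by (intro sum.union_disjoint) auto
    ultimately have sum: "(\<Sum>i\<in>\<Omega>. ?d' i) = (\<Sum>i\<in>?\<Omega>. ?d i)" by simp
    have "(\<Inter>i\<in>\<Omega>. ?Z i) = ?Z i1 \<inter> (\<Inter>i\<in>\<Omega> - {i1}. ?Z i)" using True by blast
    also have "(\<Inter>i\<in>\<Omega> - {i1}. ?Z i) = (\<Inter>i\<in>\<Omega> - {i1}. Z i)" by auto
    also have "?Z i1 \<inter> (\<Inter>i\<in>\<Omega> - {i1}. Z i) = (\<Inter>i\<in>?\<Omega>. Z i)" by auto
    finally have inter: "(\<Inter>i\<in>\<Omega>. ?Z i) = (\<Inter>i\<in>?\<Omega>. Z i)" .
    have "t \<le> \<tau> i" if "i \<in> ?\<Omega>" for i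
    proof (cases "i \<in> \<Omega>0")
      case True
      have "t \<le> t0" using t[OF \<open>i1 \<in> \<Omega>\<close>] by simp
      then show ?thesis using t0[OF True] by simp
    next
      case False
      then show ?thesis using that t[of i] by auto
    qed
    moreover have "?\<Omega> \<subseteq> I" "?\<Omega> \<noteq> {}" using \<Omega>(1) \<Omega>0 by auto
    ultimately show ?thesis unfolding sum inter by (intro admissibleD(4)[OF adm]) auto
  qed
qed

text \<open>For \<open>i \<in> \<Omega>0\<close> the set \<open>Z i\<close> contains the common
  intersection, so the twists of its polynomial are combinations of twists of the divisor. The
  exchange lemma then combines independence inside \<open>\<Omega>0\<close> with independence of the
  merged family.\<close>

lemma frob_family_independent_merge:
  assumes adm: "admissible k I Z \<tau>" and \<Omega>0: "\<Omega>0 \<subseteq> I" "i1 \<in> \<Omega>0" and t0: "\<And>i. i \<in> \<Omega>0 \<Longrightarrow> t0 \<le> \<tau> i"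
    and ind1: "functions_independent (frob_index k \<Omega>0 Z \<tau>) (frob_family g Z)"
    and ind2: "functions_independent
      (frob_index k (insert i1 (I - \<Omega>0)) (Z(i1 := \<Inter>i\<in>\<Omega>0. Z i)) (\<tau>(i1 := t0)))
      (frob_family g (Z(i1 := \<Inter>i\<in>\<Omega>0. Z i)))"
  shows "functions_independent (frob_index k I Z \<tau>) (frob_family g Z)"
proof -
  let ?Y = "\<Inter>i\<in>\<Omega>0. Z i"
  let ?Z = "Z(i1 := ?Y)"
  let ?A = "frob_index k \<Omega>0 Z \<tau>" and ?B = "{i1} \<times> {t0..<k - card ?Y}" and ?C = "frob_index k (I - \<Omega>0) Z \<tau>"
  have finI: "finite I" by (rule admissibleD(1)[OF adm])
  have "frob_index k (insert i1 (I - \<Omega>0)) ?Z (\<tau>(i1 := t0)) = ?C \<union> ?B"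
    using \<Omega>0(2) unfolding frob_index_def by (auto split: if_splits)
  with ind2 have CB: "functions_independent (?C \<union> ?B) (frob_family g ?Z)" by simp
  have "functions_independent (?C \<union> ?A) (frob_family g Z)"
  proof (rule functions_independent_replace[OF _ _ _ _ _ ind1 CB])
    show "finite ?A" "finite ?B" "finite ?C"
      using finI \<Omega>0(1) by (auto intro!: finite_frob_index intro: finite_subset)
    show "?A \<inter> ?C = {}" "?B \<inter> ?C = {}" using \<Omega>0(2) unfolding frob_index_def by auto
    show "frob_family g ?Z s x = frob_family g Z s x" if "s \<in> ?C" for s x
      using that \<Omega>0(2) unfolding frob_index_def frob_family_def by auto
    fix s assume "s \<in> ?A"
    then obtain i e where s: "s = (i, e)" and i: "i \<in> \<Omega>0" and e: "\<tau> i \<le> e" "e < k - card (Z i)"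
      unfolding frob_index_def by auto
    have fin: "finite (Z i)" using i \<Omega>0(1) admissibleD(2)[OF adm] by blast
    have sub: "?Y \<subseteq> Z i" using i by blast
    have finY: "finite ?Y" using fin sub finite_subset by blast
    define N where "N = card (Z i - ?Y)"
    have N: "N + card ?Y = card (Z i)"
      unfolding N_def using card_Diff_subset[OF finY sub] card_mono[OF fin sub] by linarith
    have "Z i = (Z i - ?Y) \<union> ?Y" using sub by blast
    with span_poly_in_span[of "Z i - ?Y" ?Y g] fin finY
    obtain b where b: "\<And>x. span_poly g (Z i) x = (\<Sum>r\<le>N. b r * span_poly g ?Y x ^ (q ^ r))"
      unfolding N_def by (metis Diff_disjoint Int_commute finite_Diff)
    let ?h = "\<lambda>r. (i1, r + e)"
    let ?H = "?h ` {..N}"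
    \<comment> \<open>Applying the \<open>q ^ e\<close>-th power turns the coefficient
      \<open>b r\<close> into \<open>b r ^ (q ^ e)\<close> and the exponent \<open>r\<close> into
      \<open>r + e\<close>; indices not of this form get coefficient zero.\<close>
    define b' where "b' p = (if p \<in> ?H then b (snd p - e) ^ (q ^ e) else 0)" for p
    have HB: "?H \<subseteq> ?B" using t0[OF i] e N by auto
    have "frob_family g Z s x = (\<Sum>p\<in>?B. b' p * frob_family g ?Z p x)" for x
    proof -
      have "frob_family g Z s x = (\<Sum>r\<le>N. (b r * span_poly g ?Y x ^ (q ^ r)) ^ (q ^ e))"
        unfolding frob_family_def s fst_conv snd_conv b by (rule frob_power_sum)
      also have "\<dots> = (\<Sum>r\<le>N. b' (?h r) * frob_family g ?Z (?h r) x)"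
        by (intro sum.cong refl)
          (auto simp: b'_def frob_family_def power_mult_distrib power_mult[symmetric] power_add)
      also have "\<dots> = (\<Sum>p\<in>?H. b' p * frob_family g ?Z p x)"
        by (rule sum.reindex_cong[symmetric, where l = ?h]) (auto simp: inj_on_def)
      also have "\<dots> = (\<Sum>p\<in>?B. b' p * frob_family g ?Z p x)"
        using HB by (intro sum.mono_neutral_left) (auto simp: b'_def)
      finally show ?thesis .
    qed
    then show "\<exists>b. \<forall>x. frob_family g Z s x = (\<Sum>p\<in>?B. b p * frob_family g ?Z p x)" by blast
  qed
  moreover have "?C \<union> ?A = frob_index k I Z \<tau>" using \<Omega>0(1) unfolding frob_index_def by auto
  ultimately show ?thesis by simp
qed

text \<open>The measure adds three quantities because the reductions lower different ones: deleting
  or merging indices lowers \<open>card I\<close>, extracting roots lowers \<open>k\<close>, and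
  specialising lowers the total size of the sets.\<close>

theorem frob_family_independent:
  assumes "admissible k I Z \<tau>"
  shows "\<exists>g. functions_independent (frob_index k I Z \<tau>) (frob_family g Z)"
  using assms
proof (induction "k + card I + (\<Sum>i\<in>I. card (Z i))" arbitrary: k I Z \<tau> rule: less_induct)
  case less
  note adm = less.prems
  have gen: "generic (\<lambda>g. functions_independent (frob_index k' J Y \<sigma>) (frob_family g Y))"
    if "admissible k' J Y \<sigma>" "k' + card J + (\<Sum>i\<in>J. card (Y i)) < k + card I + (\<Sum>i\<in>I. card (Z i))"
    for k' J Y \<sigma>
    using less.hyps[OF that(2,1)] generic_frob_family[OF that(1)] by blast
  have finI: "finite I" by (rule admissibleD(1)[OF adm])
  let ?tight = "\<lambda>\<Omega> t. \<Omega> \<subseteq> I \<and> 2 \<le> card \<Omega> \<and> card \<Omega> < card I \<and> (\<forall>i\<in>\<Omega>. t \<le> \<tau> i) \<and>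
    (\<Sum>i\<in>\<Omega>. k - \<tau> i - card (Z i)) + t + card (\<Inter>i\<in>\<Omega>. Z i) = k"
  show ?case
  proof (cases "\<exists>i\<in>I. \<tau> i + card (Z i) = k")
    case True
    then obtain i where full: "i \<in> I" "\<tau> i + card (Z i) = k" by blast
    have "frob_index k (I - {i}) Z \<tau> = frob_index k I Z \<tau>"
      using full unfolding frob_index_def by auto
    moreover have "k + card (I - {i}) + (\<Sum>i\<in>I - {i}. card (Z i)) < k + card I + (\<Sum>i\<in>I. card (Z i))"
      using card_Diff1_less[OF finI full(1)] sum_mono2[OF finI, of "I - {i}" "\<lambda>i. card (Z i)"] by auto
    ultimately show ?thesis
      using generic_witness[OF gen[OF admissible_subset[OF adm, of "I - {i}"]]] by auto
  next
    case not_full: False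
    then have lt: "\<And>i. i \<in> I \<Longrightarrow> \<tau> i + card (Z i) < k"
      using admissibleD(3)[OF adm] le_neq_implies_less by blast
    show ?thesis
    proof (cases "\<exists>\<Omega> t. ?tight \<Omega> t")
      case True
      then obtain \<Omega>0 t0 where "?tight \<Omega>0 t0" by blast
      then have \<Omega>0: "\<Omega>0 \<subseteq> I" "2 \<le> card \<Omega>0" "card \<Omega>0 < card I" and t0: "\<And>i. i \<in> \<Omega>0 \<Longrightarrow> t0 \<le> \<tau> i"
        and eq: "(\<Sum>i\<in>\<Omega>0. k - \<tau> i - card (Z i)) + t0 + card (\<Inter>i\<in>\<Omega>0. Z i) = k" by auto
      from \<Omega>0(2) obtain i1 where i1: "i1 \<in> \<Omega>0" by fastforce
      let ?I = "insert i1 (I - \<Omega>0)" and ?Z = "Z(i1 := \<Inter>i\<in>\<Omega>0. Z i)"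
      have fin0: "finite \<Omega>0" using \<Omega>0(1) finI finite_subset by blast
      have sub: "?I \<subseteq> I" using i1 \<Omega>0(1) by auto
      have "card ?I = Suc (card I - card \<Omega>0)"
        using i1 finI fin0 \<Omega>0(1) by (simp add: card_Diff_subset)
      \<comment> \<open>Both sizes in a tight set matter: at least two indices make the merged
        family smaller, and fewer than \<open>card I\<close> make the family on
        \<open>\<Omega>0\<close> smaller.\<close>
      then have cardI: "card ?I < card I" using \<Omega>0(2,3) by linarith
      have "(\<Sum>i\<in>?I. card (?Z i)) \<le> (\<Sum>i\<in>?I. card (Z i))"
      proof (rule sum_mono)
        fix i assume "i \<in> ?I"
        then have "finite (Z i)" using sub admissibleD(2)[OF adm] by blast
        then show "card (?Z i) \<le> card (Z i)" using i1 by (auto intro!: card_mono)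
      qed
      also have "\<dots> \<le> (\<Sum>i\<in>I. card (Z i))" by (rule sum_mono2[OF finI sub]) simp
      finally have less2: "k + card ?I + (\<Sum>i\<in>?I. card (?Z i)) < k + card I + (\<Sum>i\<in>I. card (Z i))"
        using cardI by linarith
      have less1: "k + card \<Omega>0 + (\<Sum>i\<in>\<Omega>0. card (Z i)) < k + card I + (\<Sum>i\<in>I. card (Z i))"
        using \<Omega>0(3) sum_mono2[OF finI \<Omega>0(1), of "\<lambda>i. card (Z i)"] by simp
      from generic_witness[OF generic_conj[OF infinite_UNIV
          gen[OF admissible_subset[OF adm \<Omega>0(1)] less1]
          gen[OF admissible_merge[OF adm \<Omega>0(1) i1 t0 eq] less2]]]
      show ?thesis using frob_family_independent_merge[OF adm \<Omega>0(1) i1 t0] by blast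
    next
      case not_tight: False
      show ?thesis
      proof (cases "I = {}")
        case True
        then show ?thesis by (simp add: frob_index_def functions_independent_empty)
      next
        case nonempty: False
        show ?thesis
        proof (cases "\<forall>i\<in>I. \<forall>j\<in>I. \<tau> i = 0 \<longrightarrow> \<tau> j = 0 \<longrightarrow> i = j")
          case True
          then have uniq: "\<And>i j. i \<in> I \<Longrightarrow> j \<in> I \<Longrightarrow> \<tau> i = 0 \<Longrightarrow> \<tau> j = 0 \<Longrightarrow> i = j" by blast
          obtain i0 where "i0 \<in> I" using nonempty by blast
          from lt[OF this] have k: "k > 0" by simp
          have "generic (\<lambda>g. functions_independent (frob_index (k - 1) I Z (\<lambda>i. \<tau> i - 1)) (frob_family g Z))"
            by (rule gen[OF admissible_root[OF adm lt uniq]]) (use k in auto)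
          moreover have "generic (\<lambda>g. \<forall>i\<in>{i \<in> I. \<tau> i = 0}. K_indep g (Z i))"
            by (rule generic_ball[OF infinite_UNIV])
              (use finI admissibleD(2)[OF adm] in \<open>auto intro: generic_K_indep\<close>)
          ultimately obtain g where
            "functions_independent (frob_index (k - 1) I Z (\<lambda>i. \<tau> i - 1)) (frob_family g Z)"
            "\<forall>i\<in>{i \<in> I. \<tau> i = 0}. K_indep g (Z i)"
            using generic_witness[OF generic_conj[OF infinite_UNIV]] by blast
          then have "functions_independent (frob_index k I Z \<tau>) (frob_family g Z)"
            by (intro frob_family_independent_root[OF finI admissibleD(2)[OF adm] lt uniq]) auto
          then show ?thesis by blast
        next
          case False
          then obtain i j where ij: "i \<in> I" "j \<in> I" "i \<noteq> j" "\<tau> i = 0" "\<tau> j = 0" by blast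
          \<comment> \<open>With inclusion the intersection is \<open>Z i\<close>, and the
            inequality for the pair collapses to \<open>k \<le> card (Z j)\<close>, although no
            index is full. The element \<open>z\<close> so obtained is what specialisation
            needs.\<close>
          have "\<not> Z i \<subseteq> Z j"
          proof
            assume "Z i \<subseteq> Z j"
            then have "(\<Inter>l\<in>{i, j}. Z l) = Z i" by auto
            then have "(k - card (Z i)) + (k - card (Z j)) + card (Z i) \<le> k"
              using admissibleD(4)[OF adm, of "{i, j}" 0] ij by simp
            then show False using lt[OF ij(1)] lt[OF ij(2)] ij(4,5) by linarith
          qed
          then obtain z where z: "z \<in> Z i" "z \<notin> Z j" by blast
          let ?Z = "\<lambda>i. Z i - {z}" and ?\<tau> = "\<lambda>i. \<tau> i + (if z \<in> Z i then 1 else 0)"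
          have strict: "(\<Sum>i\<in>\<Omega>. k - \<tau> i - card (Z i)) + t + card (\<Inter>i\<in>\<Omega>. Z i) < k"
            if "\<Omega> \<subseteq> I" "2 \<le> card \<Omega>" "card \<Omega> < card I" "\<And>i. i \<in> \<Omega> \<Longrightarrow> t \<le> \<tau> i" for \<Omega> t
          proof -
            have "\<Omega> \<noteq> {}" using that(2) by auto
            from admissibleD(4)[OF adm that(1) this that(4)]
            have "(\<Sum>i\<in>\<Omega>. k - \<tau> i - card (Z i)) + t + card (\<Inter>i\<in>\<Omega>. Z i) \<le> k" .
            moreover have "(\<Sum>i\<in>\<Omega>. k - \<tau> i - card (Z i)) + t + card (\<Inter>i\<in>\<Omega>. Z i) \<noteq> k"
              using not_tight that by blast
            ultimately show ?thesis by linarith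
          qed
          have adm': "admissible k I ?Z ?\<tau>"
            by (rule admissible_specialise[OF adm strict ij(2,5) z(2)])
          have "(\<Sum>i\<in>I. card (?Z i)) < (\<Sum>i\<in>I. card (Z i))"
          proof (rule sum_strict_mono_ex1[OF finI])
            show "\<forall>i\<in>I. card (?Z i) \<le> card (Z i)"
              using admissibleD(2)[OF adm] by (blast intro: card_mono)
            show "\<exists>i\<in>I. card (?Z i) < card (Z i)"
              by (rule bexI[OF _ ij(1)]) (rule card_Diff1_less[OF admissibleD(2)[OF adm ij(1)] z(1)])
          qed
          then have "k + card I + (\<Sum>i\<in>I. card (?Z i)) < k + card I + (\<Sum>i\<in>I. card (Z i))" by simp
          from generic_witness[OF gen[OF adm' this]]
          obtain g where g: "functions_independent (frob_index k I ?Z ?\<tau>) (frob_family g ?Z)" by blast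
          have "functions_independent (frob_index k I Z \<tau>) (frob_family (g(z := 0)) Z)"
          proof (rule frob_family_independent_specialise[OF _ g])
            show "finite (Z i)" if "i \<in> I" for i
              using that by (rule admissibleD(2)[OF adm])
          qed
          then show ?thesis by blast
        qed
      qed
    qed
  qed
qed

end

section \<open>Finite fields and their algebraic closures\<close>

text \<open>Euclid's argument: the product of all \<open>x - a\<close> plus one would be a
  nonconstant polynomial without a root.\<close>

lemma infinite_UNIV_alg_closed: "infinite (UNIV :: 'e::alg_closed_field set)"
proof
  assume fin: "finite (UNIV :: 'e set)"
  define p where "p = (\<Prod>a\<in>UNIV. [:- a, 1:]) + (1 :: 'e poly)"
  have deg: "Polynomial.degree (\<Prod>a\<in>UNIV. [:- a, 1:] :: 'e poly) = card (UNIV :: 'e set)"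
    by (simp add: degree_prod_eq_sum_degree)
  moreover have "card (UNIV :: 'e set) > 0" using fin by (simp add: card_gt_0_iff)
  ultimately have "Polynomial.degree p > 0" unfolding p_def by (simp add: degree_add_eq_left)
  then obtain x where "poly p x = 0" using alg_closed_imp_poly_has_root by blast
  moreover have "poly (\<Prod>a\<in>UNIV. [:- a, 1:]) x = 0"
    unfolding poly_prod by (rule prod_zero[OF fin]) auto
  ultimately show False unfolding p_def by simp
qed

lemma card_power_eq_le:
  assumes "r > 0"
  shows "finite {x :: 'f::field. x ^ r = y}" "card {x :: 'f. x ^ r = y} \<le> r"
proof -
  define p where "p = Polynomial.monom (1 :: 'f) r - [:y:]"
  have "poly.coeff p r = 1" using assms by (simp add: p_def coeff_pCons split: nat.split)
  then have nz: "p \<noteq> 0" by auto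
  have deg: "Polynomial.degree p \<le> r" unfolding p_def
    by (rule degree_diff_le) (auto intro: degree_monom_le)
  have eq: "{x. x ^ r = y} = {x. poly p x = 0}" by (simp add: p_def poly_monom)
  show "finite {x :: 'f. x ^ r = y}" unfolding eq by (rule poly_roots_finite[OF nz])
  show "card {x :: 'f. x ^ r = y} \<le> r" unfolding eq using card_poly_roots_bound[OF nz] deg by linarith
qed

lemma card_le_fibres:
  assumes "finite A" "\<And>y. card {x \<in> A. f x = y} \<le> d"
  shows "card A \<le> d * card (f ` A)"
proof -
  have "A = (\<Union>y\<in>f ` A. {x \<in> A. f x = y})" by blast
  then have "card A \<le> (\<Sum>y\<in>f ` A. card {x \<in> A. f x = y})"
    using card_UN_le[of "f ` A" "\<lambda>y. {x \<in> A. f x = y}"] assms(1) by simp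
  also have "\<dots> \<le> (\<Sum>y\<in>f ` A. d)" by (intro sum_mono assms(2))
  finally show ?thesis by (simp add: mult.commute)
qed

lemma geometric_quotient:
  assumes "q \<ge> (2 :: nat)"
  shows "(q - 1) * ((q ^ r - 1) div (q - 1)) = q ^ r - 1"
proof -
  have "\<exists>s. q ^ r = 1 + (q - 1) * s"
  proof (induction r)
    case 0
    show ?case by (rule exI[of _ 0]) simp
  next
    case (Suc r)
    then obtain s where s: "q ^ r = 1 + (q - 1) * s" by blast
    have "q ^ Suc r = q * (1 + (q - 1) * s)" by (simp add: s)
    also have "\<dots> = q + (q - 1) * (q * s)" by (simp add: algebra_simps)
    also have "\<dots> = 1 + (q - 1) * (1 + q * s)" using assms by (simp add: distrib_left)
    finally show ?case by blast
  qed
  then have "(q - 1) dvd q ^ r - 1" by fastforce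
  then show ?thesis by simp
qed

section \<open>Norms and conjugacy classes in a finite field\<close>

locale finite_extension =
  fixes q m :: nat and F :: "'a::{field,finite} itself"
  assumes card_F: "CARD('a) = q ^ m" and prime_power: "\<exists>p e. prime p \<and> e > 0 \<and> q = p ^ e"
    and m_pos: "m > 0"
begin

lemma q_ge2: "q \<ge> 2"
proof -
  obtain p e where p: "prime p" "e > 0" "q = p ^ e" using prime_power by blast
  have "2 ^ 1 \<le> p ^ e"
    using prime_ge_2_nat[OF p(1)] p(2)
    by (metis One_nat_def Suc_leI le_trans one_le_numeral power_increasing power_mono zero_le)
  then show ?thesis using p by simp
qed

lemma prime_char: "prime CHAR('a)" "\<exists>e. q = CHAR('a) ^ e"
proof -
  obtain p e where p: "prime p" "e > 0" "q = p ^ e" using prime_power by blast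
  have "CHAR('a) > 0" by (rule finite_imp_CHAR_pos) simp
  then show pc: "prime CHAR('a)" by (rule prime_CHAR_semidom)
  have "CHAR('a) dvd p ^ (e * m)" using CHAR_dvd_CARD[where 'a = 'a] card_F p(3) by (simp add: power_mult)
  then have "CHAR('a) dvd p" using prime_dvd_power[OF pc] by blast
  then have "CHAR('a) = p" using primes_dvd_imp_eq pc p(1) by blast
  with p(3) show "\<exists>e. q = CHAR('a) ^ e" by blast
qed

lemma card_units: "card (UNIV - {0 :: 'a}) = (q - 1) * ((q ^ m - 1) div (q - 1))"
  using geometric_quotient[OF q_ge2, of m] card_F by (simp add: card_Diff_subset)

lemma norm_exponent_pos: "(q ^ m - 1) div (q - 1) > 0"
proof -
  have "q ^ m > 1" using one_less_power[of q m] q_ge2 m_pos by simp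
  then show ?thesis using geometric_quotient[OF q_ge2, of m] by (metis gr0I mult_0_right not_less zero_less_diff)
qed

lemma power_card_minus_1:
  assumes "(x :: 'a) \<noteq> 0"
  shows "x ^ (q ^ m - 1) = 1"
proof -
  let ?U = "UNIV - {0 :: 'a}"
  have "bij_betw (\<lambda>y. x * y) ?U ?U"
    by (rule bij_betw_byWitness[where f' = "\<lambda>y. y / x"]) (use assms in auto)
  then have "(\<Prod>y\<in>?U. x * y) = (\<Prod>y\<in>?U. y)"
    by (rule prod.reindex_bij_betw)
  then have "x ^ card ?U * (\<Prod>y\<in>?U. y) = (\<Prod>y\<in>?U. y)" by (simp add: prod.distrib)
  moreover have "(\<Prod>y\<in>?U. y) \<noteq> 0" by simp
  ultimately have "x ^ card ?U = 1" by simp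
  then show ?thesis using card_F by (simp add: card_Diff_subset)
qed

lemma power_card: "(x :: 'a) ^ (q ^ m) = x"
proof (cases "x = 0")
  case False
  have "q ^ m = Suc (q ^ m - 1)" using q_ge2 by simp
  then have "x ^ (q ^ m) = x * x ^ (q ^ m - 1)" by (metis power_Suc)
  then show ?thesis using power_card_minus_1[OF False] by simp
qed (use q_ge2 in \<open>simp add: power_0_left\<close>)

text \<open>The fibres of the norm are root sets of size at most
  \<open>(q ^ m - 1) div (q - 1)\<close>, so many units need at least \<open>q - 1\<close> values.
  These values supply both the elements of the subfield and the conjugacy classes.\<close>

lemma card_norm_image: "q - 1 \<le> card (Nrm q m ` (UNIV - {0 :: 'a}))"
proof -
  let ?N = "(q ^ m - 1) div (q - 1)"
  have "card {x \<in> UNIV - {0 :: 'a}. Nrm q m x = y} \<le> ?N" for y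
  proof -
    have "card {x \<in> UNIV - {0 :: 'a}. Nrm q m x = y} \<le> card {x :: 'a. x ^ ?N = y}"
      by (rule card_mono) (auto simp: Nrm_def)
    also have "\<dots> \<le> ?N" by (rule card_power_eq_le(2)[OF norm_exponent_pos])
    finally show ?thesis .
  qed
  then have "card (UNIV - {0 :: 'a}) \<le> ?N * card (Nrm q m ` (UNIV - {0 :: 'a}))"
    by (intro card_le_fibres) auto
  then show ?thesis using card_units norm_exponent_pos by (simp add: mult.commute)
qed

lemma norm_power: "x \<noteq> 0 \<Longrightarrow> Nrm q m x ^ (q - 1) = (1 :: 'a)"
  unfolding Nrm_def power_mult[symmetric] using geometric_quotient[OF q_ge2, of m] power_card_minus_1[of x]
  by (simp add: mult.commute)

lemma norm_conj:
  assumes "sigma_conj q a (b :: 'a)"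
  shows "Nrm q m a = Nrm q m b"
proof -
  obtain c where c: "c \<noteq> 0" "b = a * c ^ (q - 1)" using assms unfolding sigma_conj_def by blast
  have "(c ^ (q - 1)) ^ ((q ^ m - 1) div (q - 1)) = 1"
    unfolding power_mult[symmetric] geometric_quotient[OF q_ge2] by (rule power_card_minus_1[OF c(1)])
  then show ?thesis unfolding Nrm_def c(2) by (simp add: power_mult_distrib)
qed

lemma conj_if_norm_eq:
  assumes "a \<noteq> 0" "b \<noteq> 0" "Nrm q m a = Nrm q m (b :: 'a)"
  shows "sigma_conj q a b"
proof -
  let ?N = "(q ^ m - 1) div (q - 1)" and ?U = "UNIV - {0 :: 'a}"
  have q1: "q - 1 > 0" using q_ge2 by simp
  have "card {x \<in> ?U. x ^ (q - 1) = y} \<le> q - 1" for y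
  proof -
    have "card {x \<in> ?U. x ^ (q - 1) = y} \<le> card {x :: 'a. x ^ (q - 1) = y}"
      by (rule card_mono) auto
    also have "\<dots> \<le> q - 1" by (rule card_power_eq_le(2)[OF q1])
    finally show ?thesis .
  qed
  then have "card ?U \<le> (q - 1) * card ((\<lambda>x. x ^ (q - 1)) ` ?U)" by (intro card_le_fibres) auto
  then have ge: "?N \<le> card ((\<lambda>x. x ^ (q - 1)) ` ?U)" unfolding card_units using q1 by simp
  have sub: "(\<lambda>x. x ^ (q - 1)) ` ?U \<subseteq> {x. x ^ ?N = 1}"
    using geometric_quotient[OF q_ge2, of m] power_card_minus_1 by (auto simp: power_mult[symmetric])
  have "card {x :: 'a. x ^ ?N = 1} \<le> card ((\<lambda>x. x ^ (q - 1)) ` ?U)"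
    using ge card_power_eq_le(2)[OF norm_exponent_pos, where 'f = 'a] order_trans by blast
  then have eq: "(\<lambda>x. x ^ (q - 1)) ` ?U = {x. x ^ ?N = 1}" by (intro card_seteq sub) auto
  have "(b / a) ^ ?N = 1" using assms by (simp add: Nrm_def power_divide)
  then have "b / a \<in> (\<lambda>x. x ^ (q - 1)) ` ?U" unfolding eq by simp
  then obtain c where c: "c \<noteq> 0" "b / a = c ^ (q - 1)" by auto
  then have "b = a * c ^ (q - 1)" using assms by (simp add: field_simps)
  with c(1) show ?thesis unfolding sigma_conj_def by blast
qed

section \<open>The subfield with \<open>q\<close> elements inside the algebraic closure\<close>

definition fixed_field :: "'a alg_closure set" where
  "fixed_field = {x. x ^ q = x}"

text \<open>Zero and the norms of units are already \<open>q\<close> solutions of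
  \<open>x ^ q = x\<close> in the small field. A polynomial of degree \<open>q\<close> leaves no
  room for further ones in the closure.\<close>

lemma fixed_field_eq: "fixed_field = to_ac ` {x :: 'a. x ^ q = x}" and card_fixed_field: "card fixed_field = q"
proof -
  let ?A = "to_ac ` {x :: 'a. x ^ q = x}"
  define p where "p = Polynomial.monom (1 :: 'a alg_closure) q - Polynomial.monom 1 1"
  have "poly.coeff p q = 1" using q_ge2 by (simp add: p_def)
  then have nz: "p \<noteq> 0" by auto
  have deg: "Polynomial.degree p \<le> q" unfolding p_def
    by (rule degree_diff_le) (use q_ge2 in \<open>auto intro: order_trans[OF degree_monom_le]\<close>)
  have eq: "fixed_field = {x. poly p x = 0}" by (simp add: p_def poly_monom fixed_field_def)
  have fin: "finite fixed_field" unfolding eq by (rule poly_roots_finite[OF nz])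
  have le: "card fixed_field \<le> q" unfolding eq using card_poly_roots_bound[OF nz] deg by linarith
  have sub: "?A \<subseteq> fixed_field" unfolding fixed_field_def by (auto simp flip: to_ac_power)
  have "insert 0 (Nrm q m ` (UNIV - {0 :: 'a})) \<subseteq> {x. x ^ q = x}"
  proof -
    have "x ^ q = x" if "x ^ (q - 1) = 1" for x :: 'a
    proof -
      have "x ^ q = x ^ (q - 1) * x" using q_ge2 by (metis power_minus_mult zero_less_numeral order_less_le_trans)
      then show ?thesis using that by simp
    qed
    then show ?thesis using norm_power q_ge2 by (auto simp: power_0_left)
  qed
  then have "card (insert 0 (Nrm q m ` (UNIV - {0 :: 'a}))) \<le> card {x :: 'a. x ^ q = x}"
    by (intro card_mono) auto
  moreover have "0 \<notin> Nrm q m ` (UNIV - {0 :: 'a})" by (auto simp: Nrm_def)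
  ultimately have "Suc (card (Nrm q m ` (UNIV - {0 :: 'a}))) \<le> card {x :: 'a. x ^ q = x}" by simp
  then have "q \<le> card {x :: 'a. x ^ q = x}" using card_norm_image q_ge2 by linarith
  moreover have "card ?A = card {x :: 'a. x ^ q = x}"
    by (rule card_image) (rule inj_on_subset[OF inj_to_ac], simp)
  ultimately have cA: "q \<le> card ?A" by simp
  then show "fixed_field = ?A" using le card_seteq[OF fin sub] by simp
  show "card fixed_field = q" using le cA card_mono[OF fin sub] by linarith
qed

sublocale frobenius_field q fixed_field
proof
  have "prime CHAR('a alg_closure)" using prime_char by simp
  then show "(x + y) ^ q = x ^ q + y ^ q" for x y :: "'a alg_closure"
    using prime_char(2) freshmans_dream'[of q _ x y] by auto
  show "\<exists>y. y ^ q = x" for x :: "'a alg_closure"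
    by (rule nth_root_exists) (use q_ge2 in simp)
qed (use fixed_field_def card_fixed_field q_ge2 infinite_UNIV_alg_closed in auto)

lemma to_ac_power_card: "to_ac (x :: 'a) ^ (q ^ m) = to_ac x"
  by (simp flip: to_ac_power add: power_card)

text \<open>The usual argument for distinct eigenvalues. It applies because the eigenvalues lie in
  the ground field, on which \<open>x \<mapsto> x ^ (q ^ m)\<close> is the identity, so that the map
  is linear over it.\<close>

lemma eigenvectors_independent:
  fixes y :: "nat \<Rightarrow> 'a alg_closure"
  assumes "finite A" "\<And>l. l \<in> A \<Longrightarrow> y l ^ (q ^ m) = to_ac (\<nu> l :: 'a) * y l" "inj_on \<nu> A" "(\<Sum>l\<in>A. y l) = 0"
  shows "\<forall>l\<in>A. y l = 0"
  using assms
proof (induction A arbitrary: y)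
  case (insert b A)
  \<comment> \<open>Subtracting \<open>\<nu> b\<close> times the relation from its image removes
    \<open>y b\<close> and scales every other eigenvector by a nonzero ground field element.\<close>
  let ?z = "\<lambda>l. (to_ac (\<nu> l) - to_ac (\<nu> b)) * y l"
  have "0 = (\<Sum>l\<in>insert b A. y l) ^ (q ^ m)" using insert.prems(3) q_ge2 by (simp add: power_0_left)
  also have "\<dots> = (\<Sum>l\<in>insert b A. to_ac (\<nu> l) * y l)"
    unfolding frob_power_sum using insert.prems(1) by (intro sum.cong) auto
  finally have "(\<Sum>l\<in>insert b A. to_ac (\<nu> l) * y l) - to_ac (\<nu> b) * (\<Sum>l\<in>insert b A. y l) = 0"
    using insert.prems(3) by simp
  then have "(\<Sum>l\<in>insert b A. ?z l) = 0"
    by (simp only: sum_distrib_left sum_subtractf[symmetric] left_diff_distrib)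
  then have "(\<Sum>l\<in>A. ?z l) = 0" using insert.hyps by simp
  moreover have "?z l ^ (q ^ m) = to_ac (\<nu> l) * ?z l" if "l \<in> A" for l
  proof -
    have "?z l = to_ac (\<nu> l - \<nu> b) * y l" by simp
    then have "?z l ^ (q ^ m) = to_ac (\<nu> l - \<nu> b) ^ (q ^ m) * y l ^ (q ^ m)"
      by (simp only: power_mult_distrib)
    also have "\<dots> = to_ac (\<nu> l) * ?z l"
      using insert.prems(1)[of l] that by (simp only: to_ac_power_card) (simp add: algebra_simps)
    finally show ?thesis .
  qed
  moreover have "inj_on \<nu> A" using insert.prems(2) by simp
  ultimately have z0: "\<forall>l\<in>A. ?z l = 0" using insert.IH[of ?z] by blast
  have "y l = 0" if "l \<in> A" for l
  proof -
    have "\<nu> l \<noteq> \<nu> b" using that insert.hyps(2) insert.prems(2) by (auto simp: inj_on_def)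
    then show ?thesis using z0 that by auto
  qed
  then show ?case using insert.prems(3) insert.hyps by simp
qed simp

end

section \<open>Column indices\<close>

lemma col_of_range:
  assumes "l \<in> {1..L}" "t \<in> {1..ns l}"
  shows "col_of ns l t \<in> {1..\<Sum>r=1..L. ns r}"
proof -
  have "(\<Sum>r\<in>{1..<l}. ns r) + ns l = (\<Sum>r\<in>insert l {1..<l}. ns r)" by simp
  also have "\<dots> \<le> (\<Sum>r=1..L. ns r)" by (rule sum_mono2) (use assms in auto)
  finally show ?thesis using assms unfolding col_of_def by auto
qed

lemma col_of_less:
  assumes "1 \<le> l" "l < l'" "t \<in> {1..ns l}" "t' \<in> {1..ns l'}"
  shows "col_of ns l t < col_of ns l' t'"
proof -
  have "(\<Sum>r\<in>{1..<l}. ns r) + ns l = (\<Sum>r\<in>insert l {1..<l}. ns r)" by simp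
  also have "\<dots> \<le> (\<Sum>r\<in>{1..<l'}. ns r)" by (rule sum_mono2) (use assms in auto)
  finally show ?thesis using assms unfolding col_of_def by auto
qed

lemma col_of_inj:
  assumes "1 \<le> l" "1 \<le> l'" "t \<in> {1..ns l}" "t' \<in> {1..ns l'}" "col_of ns l t = col_of ns l' t'"
  shows "l = l' \<and> t = t'"
proof -
  have "l = l'"
  proof (rule ccontr)
    assume "l \<noteq> l'"
    then have "l < l' \<or> l' < l" by linarith
    then show False using col_of_less[of l l' t ns t'] col_of_less[of l' l t' ns t] assms by auto
  qed
  then show ?thesis using assms(5) by (simp add: col_of_def)
qed

lemma col_of_surj:
  "j \<in> {1..\<Sum>r=1..L. ns r} \<Longrightarrow> \<exists>l\<in>{1..L}. \<exists>t\<in>{1..ns l}. col_of ns l t = j"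
proof (induction L)
  case (Suc L)
  show ?case
  proof (cases "j \<le> (\<Sum>r=1..L. ns r)")
    case True
    then obtain l t where "l \<in> {1..L}" "t \<in> {1..ns l}" "col_of ns l t = j" using Suc by auto
    then show ?thesis by (intro bexI[of _ l] bexI[of _ t]) auto
  next
    case False
    have eq: "{1..<Suc L} = {1..L}" by auto
    have "j - (\<Sum>r=1..L. ns r) \<in> {1..ns (Suc L)}" using False Suc.prems by auto
    moreover have "col_of ns (Suc L) (j - (\<Sum>r=1..L. ns r)) = j"
      using False unfolding col_of_def eq by simp
    ultimately show ?thesis by (intro bexI[of _ "Suc L"] bexI[of _ "j - (\<Sum>r=1..L. ns r)"]) auto
  qed
qed simp

lemma sum_columns:
  fixes f :: "nat \<Rightarrow> 'b::comm_monoid_add"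
  assumes "(\<Sum>l=1..L. ns l) = n"
  shows "(\<Sum>j=1..n. f j) = (\<Sum>l=1..L. \<Sum>t=1..ns l. f (col_of ns l t))"
proof -
  let ?S = "Sigma {1..L} (\<lambda>l. {1..ns l})" and ?h = "\<lambda>(l, t). col_of ns l t"
  have "inj_on ?h ?S"
  proof (rule inj_onI)
    fix x y assume xy: "x \<in> ?S" "y \<in> ?S" "?h x = ?h y"
    obtain l t l' t' where "x = (l, t)" "y = (l', t')" by (cases x, cases y)
    then show "x = y" using xy col_of_inj[of l l' t ns t'] by auto
  qed
  moreover have "?h ` ?S = {1..n}"
  proof (rule equalityI; rule subsetI)
    fix j assume "j \<in> ?h ` ?S"
    then show "j \<in> {1..n}" using col_of_range[where L = L and ns = ns] unfolding assms by auto
  next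
    fix j assume "j \<in> {1..n}"
    then obtain l t where lt: "l \<in> {1..L}" "t \<in> {1..ns l}" "col_of ns l t = j"
      using col_of_surj[of j ns L] unfolding assms by blast
    then show "j \<in> ?h ` ?S" by (intro image_eqI[of _ _ "(l, t)"]) auto
  qed
  ultimately have "(\<Sum>j=1..n. f j) = (\<Sum>x\<in>?S. f (?h x))" by (metis sum.reindex_cong)
  also have "\<dots> = (\<Sum>l=1..L. \<Sum>t=1..ns l. f (col_of ns l t))"
    by (subst sum.Sigma) (auto simp: case_prod_unfold)
  finally show ?thesis .
qed

lemma column_positions:
  assumes n: "(\<Sum>l=1..L. ns l) = n"
  shows "\<exists>p. (\<forall>j\<in>{1..n}. fst (p j) \<in> {1..L} \<and> snd (p j) \<in> {1..ns (fst (p j))} \<and>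
      col_of ns (fst (p j)) (snd (p j)) = j) \<and>
    (\<forall>l\<in>{1..L}. \<forall>t\<in>{1..ns l}. p (col_of ns l t) = (l, t))"
proof -
  have "\<exists>p. \<forall>j\<in>{1..n}. fst (p j) \<in> {1..L} \<and> snd (p j) \<in> {1..ns (fst (p j))} \<and>
      col_of ns (fst (p j)) (snd (p j)) = j"
  proof (rule bchoice, rule ballI)
    fix j assume "j \<in> {1..n}"
    then obtain l t where "l \<in> {1..L}" "t \<in> {1..ns l}" "col_of ns l t = j"
      using col_of_surj[of j ns L] n by auto
    then show "\<exists>p. fst p \<in> {1..L} \<and> snd p \<in> {1..ns (fst p)} \<and> col_of ns (fst p) (snd p) = j"
      by (intro exI[of _ "(l, t)"]) simp
  qed
  then obtain p where p: "\<And>j. j \<in> {1..n} \<Longrightarrow> fst (p j) \<in> {1..L} \<and> snd (p j) \<in> {1..ns (fst (p j))} \<and>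
      col_of ns (fst (p j)) (snd (p j)) = j" by blast
  have "p (col_of ns l t) = (l, t)" if "l \<in> {1..L}" "t \<in> {1..ns l}" for l t
  proof -
    have "col_of ns l t \<in> {1..n}" using col_of_range[of l L t ns] that n by simp
    from p[OF this] col_of_inj[of "fst (p (col_of ns l t))" l "snd (p (col_of ns l t))" ns t] that
    have "fst (p (col_of ns l t)) = l \<and> snd (p (col_of ns l t)) = t" by simp
    then show ?thesis by (metis prod.collapse)
  qed
  with p show ?thesis by (intro exI[of _ p]) simp
qed

context finite_extension
begin

section \<open>Linearized polynomials and linearized Reed--Solomon codes\<close>

definition qpoly :: "nat \<Rightarrow> (nat \<Rightarrow> 'a) \<Rightarrow> 'a alg_closure \<Rightarrow> 'a alg_closure" where
  "qpoly k u x = (\<Sum>i=1..k. to_ac (u i) * x ^ (q ^ (i - 1)))"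

definition qpoly_poly :: "nat \<Rightarrow> (nat \<Rightarrow> 'a) \<Rightarrow> 'a alg_closure poly" where
  "qpoly_poly k u = (\<Sum>i=1..k. Polynomial.monom (to_ac (u i)) (q ^ (i - 1)))"

lemma poly_qpoly_poly: "poly (qpoly_poly k u) x = qpoly k u x"
  by (simp add: qpoly_poly_def qpoly_def poly_sum poly_monom)

lemma degree_qpoly_poly: "Polynomial.degree (qpoly_poly k u) \<le> q ^ (k - 1)"
  unfolding qpoly_poly_def
proof (rule degree_sum_le)
  fix i assume "i \<in> {1..k}"
  then have "q ^ (i - 1) \<le> q ^ (k - 1)" using q_ge2 by (intro power_increasing) auto
  then show "Polynomial.degree (Polynomial.monom (to_ac (u i)) (q ^ (i - 1))) \<le> q ^ (k - 1)"
    using degree_monom_le order_trans by blast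
qed simp

lemma coeff_qpoly_poly:
  assumes "r \<in> {1..k}"
  shows "poly.coeff (qpoly_poly k u) (q ^ (r - 1)) = to_ac (u r)"
proof -
  have "q ^ (i - 1) = q ^ (r - 1) \<longleftrightarrow> i = r" if "i \<in> {1..k}" for i
    using that assms q_ge2 by (auto simp: power_inject_exp)
  then have "poly.coeff (qpoly_poly k u) (q ^ (r - 1)) = (\<Sum>i=1..k. if i = r then to_ac (u i) else 0)"
    unfolding qpoly_poly_def coeff_sum by (intro sum.cong refl) auto
  also have "\<dots> = to_ac (u r)" using assms by simp
  finally show ?thesis .
qed

lemma fixed_field_power: "c \<in> fixed_field \<Longrightarrow> c ^ (q ^ r) = c"
proof (induction r)
  case (Suc r)
  have "c ^ (q ^ Suc r) = (c ^ q) ^ (q ^ r)" by (simp add: power_mult)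
  also have "\<dots> = c" using Suc unfolding fixed_field_def by simp
  finally show ?case .
qed simp

lemma qpoly_vanishes_on_span:
  assumes "\<And>j. j \<in> S \<Longrightarrow> qpoly k u (g j) = 0" "\<And>j. j \<in> S \<Longrightarrow> c j \<in> fixed_field"
  shows "qpoly k u (\<Sum>j\<in>S. c j * g j) = 0"
proof -
  have "qpoly k u (\<Sum>j\<in>S. c j * g j) = (\<Sum>i=1..k. \<Sum>j\<in>S. c j * (to_ac (u i) * g j ^ (q ^ (i - 1))))"
    unfolding qpoly_def frob_power_sum
    by (intro sum.cong refl)
      (simp add: sum_distrib_left power_mult_distrib fixed_field_power assms(2) mult.left_commute cong: sum.cong)
  also have "\<dots> = (\<Sum>j\<in>S. c j * qpoly k u (g j))"
    unfolding qpoly_def by (subst sum.swap) (simp add: sum_distrib_left)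
  also have "\<dots> = 0" using assms(1) by simp
  finally show ?thesis .
qed

text \<open>By linearity the polynomial vanishes on the whole span, which has
  \<open>q ^ card S\<close> elements and thus exceeds the degree bound
  \<open>q ^ (k - 1)\<close>.\<close>

lemma qpoly_zero:
  assumes ind: "K_indep g S" "finite S" and S: "k \<le> card S"
    and zero: "\<And>j. j \<in> S \<Longrightarrow> qpoly k u (g j) = 0" and i: "i \<in> {1..k}"
  shows "u i = 0"
proof -
  let ?X = "(\<lambda>c. \<Sum>j\<in>S. c j * g j) ` (S \<rightarrow>\<^sub>E fixed_field)"
  have "q ^ (k - 1) < q ^ card S" using q_ge2 S i by (intro power_strict_increasing) auto
  then have deg: "Polynomial.degree (qpoly_poly k u) < card ?X"
    using degree_qpoly_poly[of k u] card_K_span[OF ind] by linarith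
  have "qpoly_poly k u = 0"
  proof (rule poly_eqI_degree[of ?X])
    fix x assume "x \<in> ?X"
    then show "poly (qpoly_poly k u) x = poly 0 x"
      using qpoly_vanishes_on_span[of S k u g] zero by (auto simp: poly_qpoly_poly PiE_mem)
  qed (use deg in simp_all)
  then have "to_ac (u i) = 0" using coeff_qpoly_poly[OF i, of u] by simp
  then show ?thesis by simp
qed

text \<open>Both sides have degree at most \<open>q ^ (k - 1)\<close>, the same coefficient there,
  and vanish on the \<open>q ^ (k - 1)\<close> elements of the span. A zero leading coefficient is
  allowed, and then everything vanishes.\<close>

lemma qpoly_eq_span_poly:
  assumes ind: "K_indep g S" "finite S" and S: "card S = k - 1" "k \<ge> 1"
    and zero: "\<And>j. j \<in> S \<Longrightarrow> qpoly k u (g j) = 0"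
  shows "qpoly k u x = to_ac (u k) * span_poly g S x"
proof -
  let ?f = "\<lambda>c. \<Sum>j\<in>S. c j * g j"
  let ?X = "?f ` (S \<rightarrow>\<^sub>E fixed_field)"
  define p where "p = (\<Prod>c\<in>S \<rightarrow>\<^sub>E fixed_field. [:- ?f c, 1:])"
  have fin: "finite (S \<rightarrow>\<^sub>E fixed_field)" using ind(2) finite_K by (simp add: finite_PiE)
  have degp: "Polynomial.degree p = q ^ (k - 1)"
    unfolding p_def using ind(2) S(1) by (simp add: degree_prod_eq_sum_degree card_PiE card_K)
  have "Polynomial.lead_coeff p = (\<Prod>c\<in>S \<rightarrow>\<^sub>E fixed_field. Polynomial.lead_coeff [:- ?f c, 1:])"
    unfolding p_def by (rule lead_coeff_prod)
  then have leadp: "poly.coeff p (q ^ (k - 1)) = 1" using degp by simp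
  have "qpoly_poly k u = smult (to_ac (u k)) p"
  proof (rule poly_eqI_degree_lead_coeff[of _ "q ^ (k - 1)" _ ?X])
    show "poly.coeff (qpoly_poly k u) (q ^ (k - 1)) = poly.coeff (smult (to_ac (u k)) p) (q ^ (k - 1))"
      using coeff_qpoly_poly[of k k u] S(2) leadp by simp
    show "q ^ (k - 1) \<le> card ?X" using card_K_span[OF ind] S(1) by simp
    show "Polynomial.degree (smult (to_ac (u k)) p) \<le> q ^ (k - 1)"
      using degp degree_smult_le[of "to_ac (u k)" p] by simp
    fix x assume "x \<in> ?X"
    then obtain c where c: "c \<in> S \<rightarrow>\<^sub>E fixed_field" "x = ?f c" by blast
    have "qpoly k u x = 0"
      unfolding c(2) by (rule qpoly_vanishes_on_span) (use zero c(1) in auto)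
    moreover have "poly p x = 0"
      unfolding p_def poly_prod using c fin by (intro prod_zero bexI[of _ c]) auto
    ultimately show "poly (qpoly_poly k u) x = poly (smult (to_ac (u k)) p) x"
      by (simp add: poly_qpoly_poly)
  qed (rule degree_qpoly_poly)
  then have "poly (qpoly_poly k u) x = to_ac (u k) * poly p x" by simp
  then show ?thesis by (simp add: poly_qpoly_poly p_def poly_prod span_poly_def)
qed

text \<open>It rests on \<open>q ^ r = 1 + (q - 1) * ((q ^ r - 1) div (q - 1))\<close>. For
  \<open>r < k\<close> it produces the matrix entries, and for \<open>r = m\<close> the eigenvalue
  equation.\<close>

lemma power_eq_norm:
  assumes "c ^ (q - 1) = to_ac (\<alpha> :: 'a)"
  shows "c ^ (q ^ r) = c * to_ac (Nrm q r \<alpha>)"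
proof -
  have "q ^ r = Suc ((q - 1) * ((q ^ r - 1) div (q - 1)))"
    using geometric_quotient[OF q_ge2, of r] q_ge2 by simp
  then have "c ^ (q ^ r) = c * (c ^ (q - 1)) ^ ((q ^ r - 1) div (q - 1))"
    by (metis power_Suc power_mult)
  then show ?thesis unfolding assms Nrm_def to_ac_power .
qed

lemma qpoly_point:
  assumes "c ^ (q - 1) = to_ac (\<alpha> :: 'a)"
  shows "qpoly k u (c * to_ac \<beta>) = c * to_ac (\<Sum>i=1..k. u i * (Nrm q (i - 1) \<alpha> * \<beta> ^ (q ^ (i - 1))))"
  unfolding qpoly_def to_ac_sum sum_distrib_left
proof (rule sum.cong[OF refl])
  fix i
  have "to_ac (u i) * (c * to_ac \<beta>) ^ (q ^ (i - 1))
      = to_ac (u i) * (c * to_ac (Nrm q (i - 1) \<alpha>) * to_ac \<beta> ^ (q ^ (i - 1)))"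
    unfolding power_mult_distrib power_eq_norm[OF assms] ..
  then show "to_ac (u i) * (c * to_ac \<beta>) ^ (q ^ (i - 1))
      = c * to_ac (u i * (Nrm q (i - 1) \<alpha> * \<beta> ^ (q ^ (i - 1))))"
    by (simp add: mult_ac)
qed

section \<open>Independence of the points and necessity of the condition\<close>

lemma LRS_points_K_indep:
  assumes par: "LRS_params q m L ns a beta" and n: "(\<Sum>l=1..L. ns l) = n"
    and c: "\<And>l. l \<in> {1..L} \<Longrightarrow> c l ^ (q - 1) = to_ac (a l :: 'a)"
    and g: "\<And>l t. l \<in> {1..L} \<Longrightarrow> t \<in> {1..ns l} \<Longrightarrow> g (col_of ns l t) = c l * to_ac (beta l t)"
  shows "K_indep g {1..n}"
proof (rule K_indepI)
  fix e j assume e: "\<And>j. j \<in> {1..n} \<Longrightarrow> e j \<in> fixed_field" and sum: "(\<Sum>j=1..n. e j * g j) = 0"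
    and j: "j \<in> {1..n}"
  \<comment> \<open>The coefficients lie in the closure but come from the ground field, so each
    block sum is \<open>c l\<close> times a ground field element and hence an eigenvector.\<close>
  define f where "f j = (SOME x. x ^ q = x \<and> to_ac x = e j)" for j
  have f: "f j ^ q = f j" "to_ac (f j) = e j" if "j \<in> {1..n}" for j
  proof -
    have "\<exists>x. x ^ q = x \<and> to_ac x = e j" using e[OF that] unfolding fixed_field_eq by auto
    from someI_ex[OF this] show "f j ^ q = f j" "to_ac (f j) = e j" unfolding f_def by auto
  qed
  have col: "col_of ns l t \<in> {1..n}" if "l \<in> {1..L}" "t \<in> {1..ns l}" for l t
    using col_of_range[of l L t ns] that n by simp
  define s where "s l = (\<Sum>t=1..ns l. f (col_of ns l t) * beta l t)" for l
  have a: "a l \<noteq> 0" "Fq_lin_indep q (ns l) (beta l)" if "l \<in> {1..L}" for l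
    using par that unfolding LRS_params_def by auto
  have "(\<Sum>j=1..n. e j * g j) = (\<Sum>l=1..L. c l * to_ac (s l))"
    unfolding sum_columns[OF n] s_def to_ac_sum sum_distrib_left
    by (intro sum.cong refl) (use f(2)[OF col] g in \<open>auto simp: mult_ac\<close>)
  then have sum0: "(\<Sum>l=1..L. c l * to_ac (s l)) = 0" using sum by simp
  have "\<forall>l\<in>{1..L}. c l * to_ac (s l) = 0"
  proof (rule eigenvectors_independent[OF _ _ _ sum0])
    show "(c l * to_ac (s l)) ^ (q ^ m) = to_ac (Nrm q m (a l)) * (c l * to_ac (s l))" if "l \<in> {1..L}" for l
      using power_eq_norm[OF c[OF that], of m] to_ac_power_card[of "s l"]
      by (simp add: power_mult_distrib mult_ac)
    show "inj_on (\<lambda>l. Nrm q m (a l)) {1..L}"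
    proof (rule inj_onI, rule ccontr)
      fix l l' assume l: "l \<in> {1..L}" "l' \<in> {1..L}" "Nrm q m (a l) = Nrm q m (a l')" "l \<noteq> l'"
      then have "sigma_conj q (a l) (a l')" using a by (intro conj_if_norm_eq) auto
      then show False using par l unfolding LRS_params_def by blast
    qed
  qed simp
  moreover have "c l \<noteq> 0" if "l \<in> {1..L}" for l
    using c[OF that] a(1)[OF that] q_ge2 by (auto simp: power_0_left split: if_splits)
  ultimately have s0: "s l = 0" if "l \<in> {1..L}" for l using that by auto
  obtain l t where lt: "l \<in> {1..L}" "t \<in> {1..ns l}" "col_of ns l t = j"
    using col_of_surj[of j ns L] j n by auto
  have "\<forall>t\<in>{1..ns l}. f (col_of ns l t) = 0"
    using spec[OF a(2)[OF lt(1), unfolded Fq_lin_indep_def], of "\<lambda>t. f (col_of ns l t)"]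
      s0[OF lt(1)] f(1)[OF col[OF lt(1)]] unfolding s_def by simp
  then show "e j = 0" using lt f(2)[OF j] by auto
qed

lemma point_roots_exist: "\<exists>c. \<forall>l. c l ^ (q - 1) = to_ac (a l :: 'a)"
  by (rule choice, rule allI, rule nth_root_exists) (use q_ge2 in simp)

text \<open>The maximum distance property of the code, in the form needed for counting.\<close>

lemma LRS_code_vanishing:
  assumes par: "LRS_params q m L ns a beta" and n: "(\<Sum>l=1..L. ns l) = n"
    and v: "v \<in> LRS_code q L ns n k a (beta :: nat \<Rightarrow> nat \<Rightarrow> 'a)"
    and S: "S \<subseteq> {1..n}" "k \<le> card S" "\<And>j. j \<in> S \<Longrightarrow> v j = 0"
  shows "v j = 0"
proof (cases "j \<in> {1..n}")
  case True
  obtain c where c: "\<And>l. c l ^ (q - 1) = to_ac (a l)" using point_roots_exist by blast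
  obtain u where u: "\<And>l t. l \<in> {1..L} \<Longrightarrow> t \<in> {1..ns l} \<Longrightarrow>
      v (col_of ns l t) = (\<Sum>i=1..k. u i * lrs_entry q a beta i l t)"
    using v unfolding LRS_code_def by blast
  obtain p where p: "\<And>j. j \<in> {1..n} \<Longrightarrow> fst (p j) \<in> {1..L} \<and> snd (p j) \<in> {1..ns (fst (p j))} \<and>
      col_of ns (fst (p j)) (snd (p j)) = j"
    and pcol: "\<And>l t. l \<in> {1..L} \<Longrightarrow> t \<in> {1..ns l} \<Longrightarrow> p (col_of ns l t) = (l, t)"
    using column_positions[OF n] by blast
  define g where "g j = c (fst (p j)) * to_ac (beta (fst (p j)) (snd (p j)))" for j
  have ind: "K_indep g {1..n}"
    by (rule LRS_points_K_indep[OF par n c]) (simp add: g_def pcol)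
  have eval: "qpoly k u (g j) = c (fst (p j)) * to_ac (v j)" if "j \<in> {1..n}" for j
    using qpoly_point[OF c, of k u "fst (p j)" "beta (fst (p j)) (snd (p j))"] p[OF that]
      u[of "fst (p j)" "snd (p j)"]
    by (simp add: g_def lrs_entry_def)
  have fin: "finite S" using S(1) finite_subset by blast
  have "u i = 0" if "i \<in> {1..k}" for i
  proof (rule qpoly_zero[OF K_indep_subset[OF ind _ S(1)] fin S(2) _ that])
    fix j assume "j \<in> S"
    then show "qpoly k u (g j) = 0" using eval[of j] S by auto
  qed simp
  then show ?thesis using u[of "fst (p j)" "snd (p j)"] p[OF True] by simp
next
  case False
  then show ?thesis using v unfolding LRS_code_def by blast
qed

text \<open>Combinations of the rows in \<open>\<Omega>\<close> vanish on the common zeros. They are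
  therefore determined by the remaining positions of a \<open>k\<close>-element set
  \<open>T\<close>, which bounds their number.\<close>

lemma LRS_support_necessary:
  assumes par: "LRS_params q m L ns a beta" and n: "(\<Sum>l=1..L. ns l) = n" and kn: "k \<le> n"
    and G: "is_generator_matrix k n G (LRS_code q L ns n k a (beta :: nat \<Rightarrow> nat \<Rightarrow> 'a))"
    and zero: "\<And>i j. i \<in> {1..k} \<Longrightarrow> j \<in> Z i \<Longrightarrow> G i j = 0"
    and Z: "\<And>i. i \<in> {1..k} \<Longrightarrow> Z i \<subseteq> {1..n}"
    and \<Omega>: "\<Omega> \<subseteq> {1..k}" "\<Omega> \<noteq> {}"
  shows "card (\<Inter>i\<in>\<Omega>. Z i) + card \<Omega> \<le> k"
proof -
  let ?S = "\<Inter>i\<in>\<Omega>. Z i"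
  have S: "?S \<subseteq> {1..n}" using \<Omega> Z by blast
  have fin\<Omega>: "finite \<Omega>" using \<Omega>(1) finite_subset by blast
  \<comment> \<open>The intersection could a priori have more than \<open>k\<close> elements, so it
    is cut down to fit into a set of size \<open>k\<close>.\<close>
  obtain S0 where S0: "S0 \<subseteq> ?S" "card S0 = min (card ?S) k" "finite S0"
    by (rule obtain_subset_with_card_n[of "min (card ?S) k" ?S]) auto
  have "\<exists>T. S0 \<subseteq> T \<and> T \<subseteq> {1..n} \<and> card T = k"
    by (rule exists_subset_between) (use S0 S kn in auto)
  then obtain T where T: "S0 \<subseteq> T" "T \<subseteq> {1..n}" "card T = k" by blast
  have finT: "finite T" using T(2) finite_subset by blast
  let ?\<Phi> = "\<lambda>y. \<lambda>j\<in>T - S0. \<Sum>i\<in>\<Omega>. y i * G i j"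
  let ?A = "\<Omega> \<rightarrow>\<^sub>E (UNIV :: 'a set)" and ?B = "(T - S0) \<rightarrow>\<^sub>E (UNIV :: 'a set)"
  have "inj_on ?\<Phi> ?A"
  proof (rule inj_onI)
    fix y y' assume y: "y \<in> ?A" "y' \<in> ?A" "?\<Phi> y = ?\<Phi> y'"
    define d where "d i = (if i \<in> \<Omega> then y i - y' i else 0)" for i
    have d_sum: "(\<Sum>i=1..k. d i * G i j) = (\<Sum>i\<in>\<Omega>. y i * G i j) - (\<Sum>i\<in>\<Omega>. y' i * G i j)" for j
    proof -
      have "(\<Sum>i=1..k. d i * G i j) = (\<Sum>i\<in>\<Omega>. (y i - y' i) * G i j)"
        using \<Omega>(1) by (intro sum.mono_neutral_cong_right) (auto simp: d_def)
      then show ?thesis by (simp add: left_diff_distrib sum_subtractf)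
    qed
    define v where "v j = (if j \<in> {1..n} then \<Sum>i=1..k. d i * G i j else 0)" for j
    have "v \<in> rowspace k n G"
      unfolding rowspace_def by (intro CollectI exI[of _ d] allI) (rule v_def)
    then have v: "v \<in> LRS_code q L ns n k a beta" using G unfolding is_generator_matrix_def by simp
    have "v j = 0" if "j \<in> T" for j
    proof (cases "j \<in> S0")
      case True
      have "G i j = 0" if "i \<in> \<Omega>" for i
        using that True S0(1) \<Omega>(1) by (intro zero) auto
      then show ?thesis unfolding v_def d_sum by simp
    next
      case False
      then have "(\<Sum>i\<in>\<Omega>. y i * G i j) = (\<Sum>i\<in>\<Omega>. y' i * G i j)"
        using fun_cong[OF y(3), of j] that by simp
      then show ?thesis unfolding v_def d_sum by simp
    qed
    then have "v j = 0" for j using LRS_code_vanishing[OF par n v T(2)] T(3) by simp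
    then have "\<forall>j\<in>{1..n}. (\<Sum>i=1..k. d i * G i j) = 0" unfolding v_def by (metis (full_types))
    then have "\<forall>i\<in>{1..k}. d i = 0" using G unfolding is_generator_matrix_def rows_indep_def by blast
    then have "y i = y' i" if "i \<in> \<Omega>" for i using that \<Omega>(1) unfolding d_def by fastforce
    then show "y = y'" using y by (intro PiE_ext[of y \<Omega> "\<lambda>_. UNIV" y']) auto
  qed
  moreover have "?\<Phi> ` ?A \<subseteq> ?B" by (intro image_subsetI) (unfold restrict_PiE_iff, blast)
  moreover have "finite ?B" using finT by (simp add: finite_PiE)
  ultimately have "card ?A \<le> card ?B" by (rule card_inj_on_le)
  then have "CARD('a) ^ card \<Omega> \<le> CARD('a) ^ card (T - S0)"
    using fin\<Omega> finT by (simp add: card_PiE)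
  moreover have "CARD('a) > 1" using card_F one_less_power[of q m] q_ge2 m_pos by simp
  ultimately have "card \<Omega> \<le> card (T - S0)" by (simp add: power_increasing_iff)
  also have "card (T - S0) = k - min (card ?S) k"
    using T S0 by (simp add: card_Diff_subset)
  finally have "card \<Omega> \<le> k - min (card ?S) k" .
  \<comment> \<open>If the cut were effective, the difference would be zero; nonemptiness of
    \<open>\<Omega>\<close> excludes this and turns \<open>min\<close> into the full
    cardinality.\<close>
  moreover have "card \<Omega> > 0" using \<Omega>(2) fin\<Omega> by (simp add: card_gt_0_iff)
  ultimately show ?thesis by linarith
qed

end

section \<open>Choosing the evaluation points\<close>

text \<open>The admissible set for a coordinate depends on earlier coordinates alone, so later
  changes do not spoil it. At each step it has more elements than the current univariate restriction
  has roots.\<close>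

lemma choose_coordinates:
  fixes P :: "(nat \<Rightarrow> 'e::field) \<Rightarrow> 'e" and S :: "nat \<Rightarrow> (nat \<Rightarrow> 'e) \<Rightarrow> 'e set"
  assumes nz: "P v \<noteq> 0" and pol: "\<And>j. j \<in> {1..N} \<Longrightarrow> poly_in j (d j) P"
    and card: "\<And>j w. j \<in> {1..N} \<Longrightarrow> d j < card (S j w)"
    and dep: "\<And>j w w'. (\<And>i. i < j \<Longrightarrow> w i = w' i) \<Longrightarrow> S j w = S j w'"
  shows "\<exists>w. P w \<noteq> 0 \<and> (\<forall>j\<in>{1..N}. w j \<in> S j w)"
  using pol card
proof (induction N)
  case 0
  show ?case using nz by auto
next
  case (Suc N)
  have "\<exists>w. P w \<noteq> 0 \<and> (\<forall>j\<in>{1..N}. w j \<in> S j w)" by (rule Suc.IH) (use Suc.prems in auto)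
  then obtain w where w: "P w \<noteq> 0" "\<forall>j\<in>{1..N}. w j \<in> S j w" by blast
  have "poly_in (Suc N) (d (Suc N)) P" by (rule Suc.prems(1)) simp
  then obtain p where p: "Polynomial.degree p \<le> d (Suc N)" "\<forall>x. P (w(Suc N := x)) = poly p x"
    unfolding poly_in_def by blast
  have "poly p (w (Suc N)) \<noteq> 0" using p(2) w(1) by (metis fun_upd_triv)
  then have p0: "p \<noteq> 0" by auto
  have "card {x. poly p x = 0} < card (S (Suc N) w)"
    using card_poly_roots_bound[OF p0] p(1) Suc.prems(2)[of "Suc N" w] by simp
  then have "\<not> S (Suc N) w \<subseteq> {x. poly p x = 0}"
    using card_mono[OF poly_roots_finite[OF p0]] by (meson not_le)
  then obtain x where x: "x \<in> S (Suc N) w" "poly p x \<noteq> 0" by blast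
  let ?w = "w(Suc N := x)"
  have same: "S j ?w = S j w" if "j \<le> Suc N" for j by (rule dep) (use that in auto)
  have "?w j \<in> S j ?w" if "j \<in> {1..Suc N}" for j
    using that x(1) w(2) same[of j] by (cases "j = Suc N") auto
  moreover have "P ?w \<noteq> 0" using p(2) x(2) by simp
  ultimately show ?case by blast
qed

text \<open>Padding with pairwise disjoint fresh indices makes all sets have size \<open>k - 1\<close> without changing any
  intersection of two or more of them.\<close>
lemma fresh_sets:
  fixes n k :: nat and r :: "nat \<Rightarrow> nat"
  shows "\<exists>W N. n \<le> N \<and> (\<forall>i\<in>{1..k}. W i \<subseteq> {n<..N} \<and> card (W i) = r i) \<and>
    (\<forall>i\<in>{1..k}. \<forall>j\<in>{1..k}. i \<noteq> j \<longrightarrow> W i \<inter> W j = {})"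
proof (induction k)
  case 0
  show ?case by (intro exI[of _ "\<lambda>_. {}"] exI[of _ n]) simp
next
  case (Suc k)
  then obtain W N where WN: "n \<le> N" "\<forall>i\<in>{1..k}. W i \<subseteq> {n<..N} \<and> card (W i) = r i"
    "\<forall>i\<in>{1..k}. \<forall>j\<in>{1..k}. i \<noteq> j \<longrightarrow> W i \<inter> W j = {}"
    by (elim exE conjE) (rule that)
  note W = WN(1) WN(2)[rule_format] WN(3)[rule_format]
  let ?X = "{N<..N + r (Suc k)}"
  let ?W = "W(Suc k := ?X)"
  have new: "?W i \<subseteq> {n<..N + r (Suc k)} \<and> card (?W i) = r i" if "i \<in> {1..Suc k}" for i
  proof (cases "i = Suc k")
    case True
    then show ?thesis using W(1) by auto
  next
    case False
    then have "i \<in> {1..k}" using that by auto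
    then show ?thesis using W(2)[of i] False by fastforce
  qed
  have disj: "W i \<inter> ?X = {}" if "i \<in> {1..k}" for i
    using W(2)[OF that] by fastforce
  have "?W i \<inter> ?W j = {}" if ij: "i \<in> {1..Suc k}" "j \<in> {1..Suc k}" "i \<noteq> j" for i j
  proof -
    consider "i = Suc k" "j \<in> {1..k}" | "j = Suc k" "i \<in> {1..k}" | "i \<in> {1..k}" "j \<in> {1..k}"
      using ij by fastforce
    then show ?thesis
    proof cases
      case 1
      then show ?thesis using disj[of j] by auto
    next
      case 2
      then show ?thesis using disj[of i] by auto
    next
      case 3
      then show ?thesis using W(3)[of i j] ij(3) by simp
    qed
  qed
  with new W(1) show ?case by (intro exI[of _ ?W] exI[of _ "N + r (Suc k)"] conjI ballI impI) auto
qed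

context finite_extension
begin

text \<open>For point \<open>j\<close> there are \<open>q ^ m\<close> candidates in its coset; at
  most \<open>q ^ card (D j)\<close> lie in the forbidden span, and the left side of
  \<open>bound\<close> is the degree of the determinant in that point.\<close>

lemma generic_points_in_cosets:
  assumes k: "k \<ge> 1" and Z: "\<And>i. i \<in> {1..k} \<Longrightarrow> finite (Z i) \<and> card (Z i) = k - 1"
    and cond: "\<And>\<Omega>. \<Omega> \<subseteq> {1..k} \<Longrightarrow> \<Omega> \<noteq> {} \<Longrightarrow> card (\<Inter>i\<in>\<Omega>. Z i) + card \<Omega> \<le> k"
    and D: "\<And>j. j \<in> {1..N} \<Longrightarrow> D j \<subseteq> {..<j}"
    and bound: "\<And>j. j \<in> {1..N} \<Longrightarrow>
      card {i \<in> {1..k}. j \<in> Z i} * (q ^ (k - 1) - q ^ (k - 1 - 1)) < q ^ m - q ^ card (D j)"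
    and c: "\<And>j. j \<in> {1..N} \<Longrightarrow> c j \<noteq> 0"
  shows "\<exists>w. functions_independent {1..k} (\<lambda>i. span_poly w (Z i)) \<and>
    (\<forall>j\<in>{1..N}. (\<exists>\<beta> :: 'a. w j = c j * to_ac \<beta>) \<and> span_poly w (D j) (w j) \<noteq> 0)"
proof -
  let ?\<Delta> = "q ^ (k - 1) - q ^ (k - 1 - 1)"
  have "admissible k {1..k} Z (\<lambda>_. 0)"
  proof (rule admissibleI)
    fix \<Omega> :: "nat set" and t :: nat
    assume \<Omega>: "\<Omega> \<subseteq> {1..k}" "\<Omega> \<noteq> {}" and t: "\<And>i. i \<in> \<Omega> \<Longrightarrow> t \<le> 0"
    have "(\<Sum>i\<in>\<Omega>. k - 0 - card (Z i)) = (\<Sum>i\<in>\<Omega>. 1)"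
      by (intro sum.cong refl) (use \<Omega>(1) Z k in auto)
    then show "(\<Sum>i\<in>\<Omega>. k - 0 - card (Z i)) + t + card (\<Inter>i\<in>\<Omega>. Z i) \<le> k"
      using cond[OF \<Omega>] t \<Omega>(2) by auto
  qed (use Z in auto)
  then obtain g0 where g0: "functions_independent (frob_index k {1..k} Z (\<lambda>_. 0)) (frob_family g0 Z)"
    using frob_family_independent by blast
  \<comment> \<open>With sets of size \<open>k - 1\<close> and no lower twists, every index
    contributes just its untwisted polynomial.\<close>
  have idx: "frob_index k {1..k} Z (\<lambda>_. 0) = {1..k} \<times> {0}"
    unfolding frob_index_def using Z k by auto
  have "functions_independent {1..k} (\<lambda>i. span_poly g0 (Z i))"
  proof (rule functions_independent_reindex[OF _ _ g0])
    show "bij_betw (\<lambda>i. (i, 0)) {1..k} (frob_index k {1..k} Z (\<lambda>_. 0))"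
      unfolding idx by (rule bij_betw_byWitness[where f' = fst]) auto
  qed (simp add: frob_family_def)
  moreover have h: "bij_betw Suc {..<k} {1..k}"
    by (rule bij_betw_byWitness[where f' = "\<lambda>i. i - 1"]) auto
  ultimately obtain xs where xs: "det (mat k k (\<lambda>(i, s). span_poly g0 (Z (Suc i)) (xs s))) \<noteq> 0"
    using functions_independent_det[of "{1..k}" "\<lambda>i. span_poly g0 (Z i)" Suc k] by blast
  define P where "P g = det (mat k k (\<lambda>(i, s). span_poly g (Z (Suc i)) (xs s)))" for g
  define d where "d j = card {i \<in> {1..k}. j \<in> Z i} * ?\<Delta>" for j
  \<comment> \<open>Intersecting with \<open>{..<j}\<close> guarantees dependence on earlier
    coordinates for every \<open>j\<close>; for \<open>j \<le> N\<close> it changes nothing.\<close>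
  define S where "S j w = (\<lambda>\<beta> :: 'a. c j * to_ac \<beta>) ` UNIV -
      (\<lambda>e. \<Sum>i\<in>D j \<inter> {..<j}. e i * w i) ` ((D j \<inter> {..<j}) \<rightarrow>\<^sub>E fixed_field)" for j w
  have pol: "poly_in j (d j) P" for j
  proof -
    have "poly_in j (\<Sum>i<k. if j \<in> Z (Suc i) then ?\<Delta> else 0) P"
      unfolding P_def
    proof (rule poly_in_det)
      fix i s assume "i < k"
      then have fin: "finite (Z (Suc i))" and cd: "card (Z (Suc i)) = k - 1" using Z[of "Suc i"] by auto
      from poly_in_span_poly[OF fin, of j "xs s", unfolded cd]
      show "poly_in j (if j \<in> Z (Suc i) then ?\<Delta> else 0) (\<lambda>g. span_poly g (Z (Suc i)) (xs s))" .
    qed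
    moreover have "(\<Sum>i<k. if j \<in> Z (Suc i) then ?\<Delta> else 0) = (\<Sum>i\<in>{1..k}. if j \<in> Z i then ?\<Delta> else 0)"
      by (rule sum.reindex_bij_betw[OF h])
    moreover have "\<dots> = d j" unfolding d_def by (simp add: sum.If_cases Int_def)
    ultimately show ?thesis by simp
  qed
  have "\<exists>w. P w \<noteq> 0 \<and> (\<forall>j\<in>{1..N}. w j \<in> S j w)"
  proof (rule choose_coordinates[of P g0 N d S])
    show "P g0 \<noteq> 0" using xs unfolding P_def .
    show "poly_in j (d j) P" for j by (rule pol)
    show "S j w = S j w'" if "\<And>i. i < j \<Longrightarrow> w i = w' i" for j w w'
    proof -
      have "(\<Sum>i\<in>D j \<inter> {..<j}. e i * w i) = (\<Sum>i\<in>D j \<inter> {..<j}. e i * w' i)" for e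
        by (intro sum.cong refl) (simp add: that)
      then show ?thesis unfolding S_def by simp
    qed
    fix j w assume j: "j \<in> {1..N}"
    have Dj: "D j \<inter> {..<j} = D j" using D[OF j] by blast
    have finD: "finite (D j)" using D[OF j] finite_subset by blast
    let ?A = "(\<lambda>\<beta> :: 'a. c j * to_ac \<beta>) ` UNIV" and ?B = "(\<lambda>e. \<Sum>i\<in>D j. e i * w i) ` (D j \<rightarrow>\<^sub>E fixed_field)"
    have "card ?A = q ^ m" using c[OF j] card_F by (subst card_image) (auto simp: inj_on_def)
    moreover have "card ?B \<le> q ^ card (D j)"
      using card_image_le[of "D j \<rightarrow>\<^sub>E fixed_field" "\<lambda>e. \<Sum>i\<in>D j. e i * w i"] finD finite_K
      by (simp add: finite_PiE card_PiE card_K)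
    moreover have "card ?A - card ?B \<le> card (?A - ?B)"
      by (rule diff_card_le_card_Diff) (use finD finite_K in \<open>simp add: finite_PiE\<close>)
    ultimately show "d j < card (S j w)"
      using bound[OF j] unfolding S_def Dj d_def by linarith
  qed
  then obtain w where w: "P w \<noteq> 0" "\<And>j. j \<in> {1..N} \<Longrightarrow> w j \<in> S j w" by blast
  have "functions_independent {1..k} (\<lambda>i. span_poly w (Z i))"
    using w(1) unfolding P_def by (rule det_functions_independent[OF _ h])
  moreover have "(\<exists>\<beta> :: 'a. w j = c j * to_ac \<beta>) \<and> span_poly w (D j) (w j) \<noteq> 0" if "j \<in> {1..N}" for j
  proof
    show "\<exists>\<beta> :: 'a. w j = c j * to_ac \<beta>" using w(2)[OF that] unfolding S_def by blast
    have Dj: "D j \<inter> {..<j} = D j" using D[OF that] by blast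
    have finD: "finite (D j)" using D[OF that] finite_subset by blast
    show "span_poly w (D j) (w j) \<noteq> 0"
      using w(2)[OF that] unfolding S_def Dj span_poly_eq_0_iff[OF finD] by blast
  qed
  ultimately show ?thesis by blast
qed

end

section \<open>Construction of the generator matrix\<close>

text \<open>Pigeonhole over a finite field in place of a rank argument.\<close>

lemma kernel_nontrivial:
  fixes M :: "nat \<Rightarrow> nat \<Rightarrow> 'a::{field,finite}"
  assumes "finite S" "card S < k"
  shows "\<exists>u. (\<exists>r\<in>{1..k}. u r \<noteq> 0) \<and> (\<forall>j\<in>S. (\<Sum>r=1..k. u r * M r j) = 0)"
proof -
  let ?A = "{1..k} \<rightarrow>\<^sub>E (UNIV :: 'a set)" and ?B = "S \<rightarrow>\<^sub>E (UNIV :: 'a set)"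
  let ?\<Phi> = "\<lambda>u. \<lambda>j\<in>S. \<Sum>r=1..k. u r * M r j"
  have "card {0, 1 :: 'a} \<le> CARD('a)" by (rule card_mono) auto
  then have "CARD('a) > 1" by simp
  then have "CARD('a) ^ card S < CARD('a) ^ k" using assms(2) by (rule power_strict_increasing[rotated])
  then have "card ?B < card ?A" using assms(1) by (simp add: card_PiE)
  moreover have "?\<Phi> ` ?A \<subseteq> ?B" by (intro image_subsetI) (unfold restrict_PiE_iff, blast)
  moreover have "finite ?B" using assms(1) by (simp add: finite_PiE)
  ultimately have "\<not> inj_on ?\<Phi> ?A" using card_inj_on_le not_le by blast
  then obtain u v where uv: "u \<in> ?A" "v \<in> ?A" "?\<Phi> u = ?\<Phi> v" "u \<noteq> v" unfolding inj_on_def by blast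
  have "\<exists>r\<in>{1..k}. u r \<noteq> v r"
  proof (rule ccontr)
    assume "\<not> (\<exists>r\<in>{1..k}. u r \<noteq> v r)"
    then have "u = v" using uv(1,2) by (intro PiE_ext[of u "{1..k}" "\<lambda>_. UNIV" v]) auto
    with uv(4) show False by simp
  qed
  moreover have "(\<Sum>r=1..k. (u r - v r) * M r j) = 0" if "j \<in> S" for j
    using fun_cong[OF uv(3), of j] that by (simp add: left_diff_distrib sum_subtractf)
  ultimately show ?thesis by (intro exI[of _ "\<lambda>r. u r - v r"]) auto
qed

lemma independent_rows_span:
  fixes u :: "nat \<Rightarrow> nat \<Rightarrow> 'a::{field,finite}"
  assumes "\<And>y i. (\<And>r. r \<in> {1..k} \<Longrightarrow> (\<Sum>i=1..k. y i * u i r) = 0) \<Longrightarrow> i \<in> {1..k} \<Longrightarrow> y i = 0"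
  shows "\<exists>y. \<forall>r\<in>{1..k}. (\<Sum>i=1..k. y i * u i r) = c r"
proof -
  let ?A = "{1..k} \<rightarrow>\<^sub>E (UNIV :: 'a set)"
  let ?\<Phi> = "\<lambda>y. \<lambda>r\<in>{1..k}. \<Sum>i=1..k. y i * u i r"
  have inj: "inj_on ?\<Phi> ?A"
  proof (rule inj_onI)
    fix y z assume yz: "y \<in> ?A" "z \<in> ?A" "?\<Phi> y = ?\<Phi> z"
    have "(\<Sum>i=1..k. (y i - z i) * u i r) = 0" if "r \<in> {1..k}" for r
      using fun_cong[OF yz(3), of r] that by (simp add: left_diff_distrib sum_subtractf)
    then have "y i - z i = 0" if "i \<in> {1..k}" for i using assms[of "\<lambda>i. y i - z i"] that by blast
    then show "y = z" using yz(1,2) by (intro PiE_ext[of y "{1..k}" "\<lambda>_. UNIV" z]) auto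
  qed
  have sub: "?\<Phi> ` ?A \<subseteq> ?A" by (intro image_subsetI) (unfold restrict_PiE_iff, blast)
  have fin: "finite ?A" by (simp add: finite_PiE)
  have "?\<Phi> ` ?A = ?A" by (rule endo_inj_surj[OF fin sub inj])
  moreover have "restrict c {1..k} \<in> ?A" by simp
  ultimately obtain y where y: "restrict c {1..k} = ?\<Phi> y" by blast
  have "(\<Sum>i=1..k. y i * u i r) = c r" if "r \<in> {1..k}" for r
    using fun_cong[OF y, of r] that by simp
  then show ?thesis by blast
qed

context finite_extension
begin

text \<open>Row \<open>i\<close> solves \<open>k - 1\<close> linear equations in \<open>k\<close>
  unknowns. Its linearized polynomial must be a nonzero multiple of the subspace polynomial of
  \<open>Y i\<close>, so independence of the latter makes the rows a basis.\<close>

lemma LRS_generator_matrix: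
  fixes a :: "nat \<Rightarrow> 'a"
  assumes par: "LRS_params q m L ns a beta" and n: "(\<Sum>l=1..L. ns l) = n" and k: "k \<ge> 1" "k \<le> n"
    and c: "\<And>l. c l ^ (q - 1) = to_ac (a l)"
    and w: "\<And>l t. l \<in> {1..L} \<Longrightarrow> t \<in> {1..ns l} \<Longrightarrow> w (col_of ns l t) = c l * to_ac (beta l t)"
    and Y: "\<And>i. i \<in> {1..k} \<Longrightarrow> finite (Y i)" "\<And>i. i \<in> {1..k} \<Longrightarrow> card (Y i) = k - 1"
      "\<And>i. i \<in> {1..k} \<Longrightarrow> K_indep w (Y i)"
    and pts: "\<And>i j. i \<in> {1..k} \<Longrightarrow> j \<in> Y i \<Longrightarrow> \<exists>l \<beta>. l \<in> {1..L} \<and> w j = c l * to_ac \<beta>"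
    and ind: "functions_independent {1..k} (\<lambda>i. span_poly w (Y i))"
  shows "\<exists>G. is_generator_matrix k n G (LRS_code q L ns n k a beta) \<and>
    (\<forall>i\<in>{1..k}. \<forall>j\<in>Y i \<inter> {1..n}. G i j = 0)"
proof -
  obtain p where p: "\<And>j. j \<in> {1..n} \<Longrightarrow> fst (p j) \<in> {1..L} \<and> snd (p j) \<in> {1..ns (fst (p j))} \<and>
      col_of ns (fst (p j)) (snd (p j)) = j"
    and pcol: "\<And>l t. l \<in> {1..L} \<Longrightarrow> t \<in> {1..ns l} \<Longrightarrow> p (col_of ns l t) = (l, t)"
    using column_positions[OF n] by blast
  have col: "col_of ns l t \<in> {1..n}" if "l \<in> {1..L}" "t \<in> {1..ns l}" for l t
    using col_of_range[of l L t ns] that n by simp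
  have c0: "c l \<noteq> 0" if "l \<in> {1..L}" for l
  proof -
    have "a l \<noteq> 0" using par that unfolding LRS_params_def by blast
    then show ?thesis using c[of l] q_ge2 by (auto simp: power_0_left split: if_splits)
  qed
  have Kn: "K_indep w {1..n}" by (rule LRS_points_K_indep[OF par n c w])
  define e where "e r j = lrs_entry q a beta r (fst (p j)) (snd (p j))" for r j
  have eval: "qpoly k v (w j) = c (fst (p j)) * to_ac (\<Sum>r=1..k. v r * e r j)" if "j \<in> {1..n}" for v j
  proof -
    have "w j = c (fst (p j)) * to_ac (beta (fst (p j)) (snd (p j)))"
      using w[of "fst (p j)" "snd (p j)"] p[OF that] by simp
    then show ?thesis
      using qpoly_point[OF c, of k v "fst (p j)" "beta (fst (p j)) (snd (p j))"]
      by (simp add: e_def lrs_entry_def)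
  qed
  have eval0: "(\<Sum>r=1..k. v r * e r j) = 0 \<longleftrightarrow> qpoly k v (w j) = 0" if "j \<in> {1..n}" for v j
    using eval[OF that, of v] c0[of "fst (p j)"] p[OF that] by simp
  have vzero: "v r = 0" if "\<And>j. j \<in> {1..n} \<Longrightarrow> qpoly k v (w j) = 0" "r \<in> {1..k}" for v r
    by (rule qpoly_zero[OF Kn _ _ that(1) that(2)]) (use k in auto)
  have "\<exists>u. (\<exists>r\<in>{1..k}. u r \<noteq> 0) \<and> (\<forall>j\<in>Y i. qpoly k u (w j) = 0)" if i: "i \<in> {1..k}" for i
  proof -
    \<comment> \<open>Every point, padding included, is \<open>c l\<close> times a ground field
      element; cancelling \<open>c l\<close> leaves equations over the ground field.\<close>
    have "\<exists>f. \<forall>j\<in>Y i. fst (f j) \<in> {1..L} \<and> w j = c (fst (f j)) * to_ac (snd (f j))"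
    proof (rule bchoice, rule ballI)
      fix j assume "j \<in> Y i"
      then obtain l \<beta> where "l \<in> {1..L}" "w j = c l * to_ac \<beta>" using pts[OF i] by blast
      then show "\<exists>f. fst f \<in> {1..L} \<and> w j = c (fst f) * to_ac (snd f)"
        by (intro exI[of _ "(l, \<beta>)"]) simp
    qed
    then obtain f where f: "\<And>j. j \<in> Y i \<Longrightarrow> w j = c (fst (f j)) * to_ac (snd (f j))" by blast
    obtain u where u: "\<exists>r\<in>{1..k}. u r \<noteq> 0"
      "\<And>j. j \<in> Y i \<Longrightarrow> (\<Sum>r=1..k. u r * (Nrm q (r - 1) (a (fst (f j))) * snd (f j) ^ (q ^ (r - 1)))) = 0"
      using kernel_nontrivial[of "Y i" k "\<lambda>r j. Nrm q (r - 1) (a (fst (f j))) * snd (f j) ^ (q ^ (r - 1))"]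
        Y(1,2)[OF i] k(1) by auto
    have "qpoly k u (w j) = 0" if "j \<in> Y i" for j
      unfolding f[OF that] qpoly_point[OF c] u(2)[OF that] by simp
    with u(1) show ?thesis by blast
  qed
  then have "\<exists>u. \<forall>i\<in>{1..k}. (\<exists>r\<in>{1..k}. u i r \<noteq> 0) \<and> (\<forall>j\<in>Y i. qpoly k (u i) (w j) = 0)"
    by (intro bchoice ballI)
  then obtain u where unz: "\<And>i. i \<in> {1..k} \<Longrightarrow> \<exists>r\<in>{1..k}. u i r \<noteq> 0"
    and uY: "\<And>i j. i \<in> {1..k} \<Longrightarrow> j \<in> Y i \<Longrightarrow> qpoly k (u i) (w j) = 0" by blast
  have multiple: "qpoly k (u i) x = to_ac (u i k) * span_poly w (Y i) x" if "i \<in> {1..k}" for i x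
    by (rule qpoly_eq_span_poly[OF Y(3)[OF that] Y(1)[OF that] Y(2)[OF that] k(1) uY[OF that]])
  \<comment> \<open>Otherwise the polynomial would vanish everywhere, in particular at the
    \<open>n \<ge> k\<close> independent points of the code, so all its coefficients would be
    zero.\<close>
  have lead: "u i k \<noteq> 0" if i: "i \<in> {1..k}" for i
  proof
    assume "u i k = 0"
    then have "qpoly k (u i) x = 0" for x using multiple[OF i] by simp
    then have "u i r = 0" if "r \<in> {1..k}" for r using vzero that by blast
    with unz[OF i] show False by blast
  qed
  have rows: "y i = 0" if y: "\<And>r. r \<in> {1..k} \<Longrightarrow> (\<Sum>i=1..k. y i * u i r) = 0" and i: "i \<in> {1..k}" for y i
  proof -
    have "(\<Sum>i=1..k. (to_ac (y i) * to_ac (u i k)) * span_poly w (Y i) x) = 0" for x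
    proof -
      have "(\<Sum>i=1..k. (to_ac (y i) * to_ac (u i k)) * span_poly w (Y i) x)
          = (\<Sum>i=1..k. to_ac (y i) * qpoly k (u i) x)"
        by (intro sum.cong refl) (simp add: multiple mult.assoc)
      also have "\<dots> = (\<Sum>r=1..k. to_ac (\<Sum>i=1..k. y i * u i r) * x ^ (q ^ (r - 1)))"
        unfolding qpoly_def sum_distrib_left to_ac_sum sum_distrib_right
        by (subst sum.swap) (simp add: mult.assoc)
      also have "\<dots> = 0" using y by (intro sum.neutral) simp
      finally show ?thesis .
    qed
    then have "to_ac (y i) * to_ac (u i k) = 0"
      using functions_independentD[OF ind, of "\<lambda>i. to_ac (y i) * to_ac (u i k)" i] i by blast
    then show ?thesis using lead[OF i] by simp
  qed
  define G where "G i j = (\<Sum>r=1..k. u i r * e r j)" for i j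
  have comb: "(\<Sum>i=1..k. y i * G i j) = (\<Sum>r=1..k. (\<Sum>i=1..k. y i * u i r) * e r j)" for y j
    unfolding G_def sum_distrib_left sum_distrib_right by (subst sum.swap) (simp add: mult.assoc)
  have "rows_indep k n G"
    unfolding rows_indep_def
  proof (intro allI impI ballI)
    fix y i assume zero: "\<forall>j\<in>{1..n}. (\<Sum>i=1..k. y i * G i j) = 0" and i: "i \<in> {1..k}"
    have "qpoly k (\<lambda>r. \<Sum>i=1..k. y i * u i r) (w j) = 0" if "j \<in> {1..n}" for j
      using zero that eval0[OF that, of "\<lambda>r. \<Sum>i=1..k. y i * u i r"] unfolding comb by simp
    then have "(\<Sum>i=1..k. y i * u i r) = 0" if "r \<in> {1..k}" for r
      using vzero[of "\<lambda>r. \<Sum>i=1..k. y i * u i r"] that by blast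
    then show "y i = 0" using rows i by blast
  qed
  moreover have "rowspace k n G = LRS_code q L ns n k a beta"
  proof (rule equalityI; rule subsetI)
    fix v assume "v \<in> rowspace k n G"
    then obtain y where y: "\<And>j. v j = (if j \<in> {1..n} then \<Sum>i=1..k. y i * G i j else 0)"
      unfolding rowspace_def by blast
    have "v (col_of ns l t) = (\<Sum>r=1..k. (\<Sum>i=1..k. y i * u i r) * lrs_entry q a beta r l t)"
      if "l \<in> {1..L}" "t \<in> {1..ns l}" for l t
      using y[of "col_of ns l t"] col[OF that] unfolding comb by (simp add: e_def pcol[OF that])
    moreover have "v j = 0" if "j \<notin> {1..n}" for j using y[of j] that by auto
    ultimately show "v \<in> LRS_code q L ns n k a beta"
      unfolding LRS_code_def by (intro CollectI conjI exI[of _ "\<lambda>r. \<Sum>i=1..k. y i * u i r"]) simp_all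
  next
    fix v assume v: "v \<in> LRS_code q L ns n k a beta"
    then obtain d where d: "\<And>l t. l \<in> {1..L} \<Longrightarrow> t \<in> {1..ns l} \<Longrightarrow>
        v (col_of ns l t) = (\<Sum>r=1..k. d r * lrs_entry q a beta r l t)"
      unfolding LRS_code_def by blast
    have "\<exists>y. \<forall>r\<in>{1..k}. (\<Sum>i=1..k. y i * u i r) = d r"
    proof (rule independent_rows_span)
      fix y i assume "\<And>r. r \<in> {1..k} \<Longrightarrow> (\<Sum>i=1..k. y i * u i r) = 0" "i \<in> {1..k}"
      then show "y i = 0" by (rule rows)
    qed
    then obtain y where y: "\<And>r. r \<in> {1..k} \<Longrightarrow> (\<Sum>i=1..k. y i * u i r) = d r" by blast
    have "v j = (if j \<in> {1..n} then \<Sum>i=1..k. y i * G i j else 0)" for j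
    proof (cases "j \<in> {1..n}")
      case True
      have "v j = (\<Sum>r=1..k. d r * e r j)"
        using d[of "fst (p j)" "snd (p j)"] p[OF True] by (simp add: e_def)
      also have "\<dots> = (\<Sum>i=1..k. y i * G i j)" unfolding comb by (intro sum.cong refl) (simp only: y)
      finally show ?thesis using True by simp
    next
      case False
      then show ?thesis using v unfolding LRS_code_def by auto
    qed
    then show "v \<in> rowspace k n G" unfolding rowspace_def by blast
  qed
  moreover have "G i j = 0" if "i \<in> {1..k}" "j \<in> Y i \<inter> {1..n}" for i j
    using eval0[of j "u i"] uY[of i j] that unfolding G_def by simp
  ultimately show ?thesis unfolding is_generator_matrix_def by (intro exI[of _ G]) simp
qed

lemma distinct_norms_exist:
  assumes "L \<le> q - 1"
  shows "\<exists>a :: nat \<Rightarrow> 'a. (\<forall>l\<in>{1..L}. a l \<noteq> 0) \<and>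
    (\<forall>l\<in>{1..L}. \<forall>l'\<in>{1..L}. l \<noteq> l' \<longrightarrow> \<not> sigma_conj q (a l) (a l'))"
proof -
  let ?W = "Nrm q m ` (UNIV - {0 :: 'a})"
  have "card {1..L} \<le> card ?W" using card_norm_image assms by simp
  then obtain f where f: "f ` {1..L} \<subseteq> ?W" "inj_on f {1..L}"
    using card_le_inj[of "{1..L}" ?W] by auto
  have "\<exists>a. \<forall>l\<in>{1..L}. a l \<noteq> 0 \<and> Nrm q m (a l) = f l"
  proof (rule bchoice, rule ballI)
    fix l assume "l \<in> {1..L}"
    then have "f l \<in> ?W" using f(1) by blast
    then show "\<exists>x. x \<noteq> 0 \<and> Nrm q m x = f l" by auto
  qed
  then obtain a where a: "\<And>l. l \<in> {1..L} \<Longrightarrow> a l \<noteq> 0 \<and> Nrm q m (a l) = f l" by blast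
  have "\<not> sigma_conj q (a l) (a l')" if "l \<in> {1..L}" "l' \<in> {1..L}" "l \<noteq> l'" for l l'
  proof
    assume "sigma_conj q (a l) (a l')"
    from norm_conj[OF this] have "f l = f l'" using a that by simp
    then show False using f(2) that unfolding inj_on_def by blast
  qed
  with a show ?thesis by (intro exI[of _ a]) simp
qed

end

text \<open>For \<open>k \<ge> 2\<close>, division by \<open>q - 1\<close> leaves
  \<open>(k - 1) * q ^ (k - 2) < q ^ (m - 1)\<close>, which is the hypothesis divided by
  \<open>q\<close> with \<open>k - 1\<close> in place of \<open>k\<close>. For \<open>k = 1\<close>
  the left side is zero.\<close>

lemma degree_bound:
  fixes q m k :: nat
  assumes q: "q \<ge> 2" and m: "m > 0" and k: "k \<ge> 1" and qm: "k * q ^ (k - 1) \<le> q ^ m"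
  shows "(k - 1) * (q ^ (k - 1) - q ^ (k - 1 - 1)) < q ^ m - q ^ (m - 1)"
proof -
  have diff: "q ^ r - q ^ (r - 1) = (q - 1) * q ^ (r - 1)" if "r > 0" for r
    using that by (cases r) (simp_all add: diff_mult_distrib)
  show ?thesis
  proof (cases "k = 1")
    case True
    then show ?thesis using diff[OF m] q by simp
  next
    case False
    then have k2: "k - 1 > 0" using k by simp
    have "q * (k * q ^ (k - 1 - 1)) = k * q ^ (k - 1)"
      using k2 by (metis mult.left_commute power_eq_if less_numeral_extra(3))
    also have "\<dots> \<le> q ^ m" by (rule qm)
    also have "\<dots> = q * q ^ (m - 1)" using m by (metis power_eq_if less_numeral_extra(3))
    finally have "k * q ^ (k - 1 - 1) \<le> q ^ (m - 1)" using q by simp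
    moreover have "(k - 1) * q ^ (k - 1 - 1) < k * q ^ (k - 1 - 1)" using k q by simp
    ultimately have "(k - 1) * q ^ (k - 1 - 1) < q ^ (m - 1)" by linarith
    then have "(q - 1) * ((k - 1) * q ^ (k - 1 - 1)) < (q - 1) * q ^ (m - 1)" using q by simp
    then show ?thesis unfolding diff[OF k2] diff[OF m] by (simp add: mult.left_commute)
  qed
qed

context finite_extension
begin

lemma LRS_support_sufficient:
  fixes ns :: "nat \<Rightarrow> nat" and Z :: "nat \<Rightarrow> nat set"
  assumes L: "L > 0" "L \<le> q - 1" and n: "(\<Sum>l=1..L. ns l) = n" and k: "k \<ge> 1" "k \<le> n"
    and nsm: "\<And>l. l \<in> {1..L} \<Longrightarrow> ns l \<le> m" and qm: "k * q ^ (k - 1) \<le> q ^ m"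
    and Z: "\<And>i. i \<in> {1..k} \<Longrightarrow> Z i \<subseteq> {1..n}"
    and cond: "\<And>\<Omega>. \<Omega> \<subseteq> {1..k} \<Longrightarrow> \<Omega> \<noteq> {} \<Longrightarrow> card (\<Inter>i\<in>\<Omega>. Z i) + card \<Omega> \<le> k"
  shows "\<exists>(a :: nat \<Rightarrow> 'a) beta G. LRS_params q m L ns a beta \<and>
    is_generator_matrix k n G (LRS_code q L ns n k a beta) \<and> (\<forall>i\<in>{1..k}. \<forall>j\<in>Z i. G i j = 0)"
proof -
  obtain a :: "nat \<Rightarrow> 'a" where a: "\<forall>l\<in>{1..L}. a l \<noteq> 0"
    "\<forall>l\<in>{1..L}. \<forall>l'\<in>{1..L}. l \<noteq> l' \<longrightarrow> \<not> sigma_conj q (a l) (a l')"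
    using distinct_norms_exist[OF L(2)] by (elim exE conjE) (rule that)
  obtain c where c: "\<And>l. c l ^ (q - 1) = to_ac (a l)" using point_roots_exist by blast
  have c0: "c l \<noteq> 0" if "l \<in> {1..L}" for l
  proof -
    have "a l \<noteq> 0" using a(1) that by blast
    then show ?thesis using c[of l] q_ge2 by (auto simp: power_0_left split: if_splits)
  qed
  obtain p where p: "\<And>j. j \<in> {1..n} \<Longrightarrow> fst (p j) \<in> {1..L} \<and> snd (p j) \<in> {1..ns (fst (p j))} \<and>
      col_of ns (fst (p j)) (snd (p j)) = j"
    and pcol: "\<And>l t. l \<in> {1..L} \<Longrightarrow> t \<in> {1..ns l} \<Longrightarrow> p (col_of ns l t) = (l, t)"
    using column_positions[OF n] by blast
  have col: "col_of ns l t \<in> {1..n}" if "l \<in> {1..L}" "t \<in> {1..ns l}" for l t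
    using col_of_range[of l L t ns] that n by simp
  obtain W N where WN: "n \<le> N" "\<forall>i\<in>{1..k}. W i \<subseteq> {n<..N} \<and> card (W i) = k - 1 - card (Z i)"
    "\<forall>i\<in>{1..k}. \<forall>j\<in>{1..k}. i \<noteq> j \<longrightarrow> W i \<inter> W j = {}"
    using fresh_sets[of n k "\<lambda>i. k - 1 - card (Z i)"] by (elim exE conjE) (rule that)
  have finZ: "finite (Z i)" and cardZ: "card (Z i) \<le> k - 1" if "i \<in> {1..k}" for i
    using finite_subset[OF Z[OF that]] cond[of "{i}"] that by auto
  have Wsub: "W i \<subseteq> {n<..N}" and cardW: "card (W i) = k - 1 - card (Z i)" if "i \<in> {1..k}" for i
    using WN(2) that by blast+
  have uniqW: "i = i'" if "i \<in> {1..k}" "i' \<in> {1..k}" "j \<in> W i" "j \<in> W i'" for i i' j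
    using WN(3) that by blast
  have finW: "finite (W i)" if "i \<in> {1..k}" for i using Wsub[OF that] finite_subset by blast
  define Y where "Y i = Z i \<union> W i" for i
  have ZW: "Z i \<inter> W i' = {}" if "i \<in> {1..k}" "i' \<in> {1..k}" for i i'
    using Z[OF that(1)] Wsub[OF that(2)] by fastforce
  have finY: "finite (Y i)" if "i \<in> {1..k}" for i unfolding Y_def using finZ finW that by simp
  have cardY: "card (Y i) = k - 1" if "i \<in> {1..k}" for i
    unfolding Y_def
    using card_Un_disjoint[OF finZ[OF that] finW[OF that] ZW[OF that that]] cardZ[OF that] cardW[OF that]
    by linarith
  have YN: "Y i \<subseteq> {1..N}" if "i \<in> {1..k}" for i
    unfolding Y_def using Z[OF that] Wsub[OF that] WN(1) by fastforce
  have condY: "card (\<Inter>i\<in>\<Omega>. Y i) + card \<Omega> \<le> k" if \<Omega>: "\<Omega> \<subseteq> {1..k}" "\<Omega> \<noteq> {}" for \<Omega>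
  proof (cases "\<exists>i. \<Omega> = {i}")
    case True
    then obtain i where i: "\<Omega> = {i}" by blast
    then have "card (\<Inter>i\<in>\<Omega>. Y i) = k - 1" using cardY[of i] \<Omega>(1) by simp
    then show ?thesis using i k(1) by simp
  next
    case False
    then obtain i i' where i: "i \<in> \<Omega>" "i' \<in> \<Omega>" "i \<noteq> i'" using \<Omega>(2) by blast
    \<comment> \<open>A fresh index belongs to one padded set only, so it disappears from any
      intersection of two.\<close>
    have "(\<Inter>i\<in>\<Omega>. Y i) \<subseteq> (\<Inter>i\<in>\<Omega>. Z i)"
    proof (intro subsetI INT_I)
      fix x j assume x: "x \<in> (\<Inter>i\<in>\<Omega>. Y i)" and j: "j \<in> \<Omega>"
      have "x \<notin> W i \<or> x \<notin> W i'" using uniqW[of i i' x] i \<Omega>(1) by blast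
      then obtain h where h: "h \<in> \<Omega>" "x \<in> Z h" using x i unfolding Y_def by blast
      then have "x \<notin> W j" using ZW[of h j] j \<Omega>(1) by blast
      then show "x \<in> Z j" using x j unfolding Y_def by blast
    qed
    moreover have "finite (\<Inter>i\<in>\<Omega>. Z i)"
      by (rule finite_subset[of _ "Z i"]) (use i finZ \<Omega>(1) in auto)
    ultimately have "card (\<Inter>i\<in>\<Omega>. Y i) \<le> card (\<Inter>i\<in>\<Omega>. Z i)" by (intro card_mono)
    then show ?thesis using cond[OF \<Omega>] by linarith
  qed
  \<comment> \<open>Padding points belong to no column; block 1 is an arbitrary existing choice for
    their coset.\<close>
  define blk where "blk j = (if j \<le> n then fst (p j) else 1)" for j
  have blk: "blk j \<in> {1..L}" if "j \<in> {1..N}" for j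
    using p[of j] that L(1) unfolding blk_def by auto
  \<comment> \<open>A column point must avoid earlier points of its own block, since different
    blocks are independent through their norms. A padding point shares its coset with a real block
    and must avoid the earlier points of its padded set instead.\<close>
  define D where "D j = (if j \<le> n then {x \<in> {1..n}. x < j \<and> fst (p x) = fst (p j)}
    else {x. x < j \<and> (\<exists>l\<in>{1..k}. j \<in> W l \<and> x \<in> Y l)})" for j
  have D_low: "D j = {x \<in> {1..n}. x < j \<and> fst (p x) = fst (p j)}" if "j \<le> n" for j
    using that unfolding D_def by simp
  have D_high: "D j = {x \<in> Y l. x < j}" if "l \<in> {1..k}" "j \<in> W l" for l j
  proof -
    have "\<not> j \<le> n" using Wsub[OF that(1)] that(2) by auto
    moreover have "(\<exists>l'\<in>{1..k}. j \<in> W l' \<and> x \<in> Y l') \<longleftrightarrow> x \<in> Y l" for x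
      using uniqW[OF _ that(1) _ that(2)] that by blast
    ultimately show ?thesis unfolding D_def by auto
  qed
  have Dsub: "D j \<subseteq> {..<j}" for j unfolding D_def by auto
  have bound: "card {i \<in> {1..k}. j \<in> Y i} * (q ^ (k - 1) - q ^ (k - 1 - 1)) < q ^ m - q ^ card (D j)"
    if j: "j \<in> {1..N}" for j
  proof (cases "j \<le> n")
    case True
    have fp: "fst (p j) \<in> {1..L}" "snd (p j) \<in> {1..ns (fst (p j))}"
        "col_of ns (fst (p j)) (snd (p j)) = j" using p[of j] True j by auto
    have "D j \<subseteq> col_of ns (fst (p j)) ` {1..<snd (p j)}"
    proof
      fix x assume "x \<in> D j"
      then have x: "x \<in> {1..n}" "x < j" "fst (p x) = fst (p j)" unfolding D_low[OF True] by auto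
      have px: "snd (p x) \<ge> 1" "col_of ns (fst (p j)) (snd (p x)) = x" using p[OF x(1)] x(3) by auto
      then have "snd (p x) < snd (p j)" using x(2) fp(3) unfolding col_of_def by linarith
      with px show "x \<in> col_of ns (fst (p j)) ` {1..<snd (p j)}"
        by (intro image_eqI[of _ _ "snd (p x)"]) auto
    qed
    then have "card (D j) \<le> card {1..<snd (p j)}" by (rule surj_card_le[rotated]) simp
    then have "card (D j) \<le> m - 1" using fp(2) nsm[OF fp(1)] by auto
    then have Dle: "q ^ card (D j) \<le> q ^ (m - 1)" using q_ge2 by (intro power_increasing) auto
    let ?\<Omega> = "{i \<in> {1..k}. j \<in> Y i}"
    \<comment> \<open>The index \<open>j\<close> itself lies in the intersection, so the counting
      condition loses one.\<close>
    have "card ?\<Omega> \<le> k - 1"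
    proof (cases "?\<Omega> = {}")
      case False
      then obtain i0 where i0: "i0 \<in> {1..k}" "j \<in> Y i0" by blast
      have "finite (\<Inter>i\<in>?\<Omega>. Y i)"
        by (rule finite_subset[of _ "Y i0"]) (use i0 finY in auto)
      moreover have "j \<in> (\<Inter>i\<in>?\<Omega>. Y i)" by blast
      ultimately have "card (\<Inter>i\<in>?\<Omega>. Y i) > 0" using card_gt_0_iff by blast
      moreover have "?\<Omega> \<subseteq> {1..k}" by blast
      ultimately show ?thesis using condY[OF _ False] by linarith
    qed (simp only: card.empty)
    then have "card ?\<Omega> * (q ^ (k - 1) - q ^ (k - 1 - 1)) \<le> (k - 1) * (q ^ (k - 1) - q ^ (k - 1 - 1))"
      by (rule mult_le_mono1)
    also have "\<dots> < q ^ m - q ^ (m - 1)" by (rule degree_bound[OF q_ge2 m_pos k(1) qm])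
    also have "\<dots> \<le> q ^ m - q ^ card (D j)" using Dle by (rule diff_le_mono2)
    finally show ?thesis .
  next
    case False
    let ?\<Omega> = "{i \<in> {1..k}. j \<in> Y i}"
    have YW: "?\<Omega> = {i \<in> {1..k}. j \<in> W i}"
    proof -
      have "j \<notin> Z i" if "i \<in> {1..k}" for i using Z[OF that] False by auto
      then show ?thesis unfolding Y_def by blast
    qed
    show ?thesis
    proof (cases "?\<Omega> = {}")
      case True
      have "\<not> (\<exists>l\<in>{1..k}. j \<in> W l)" using True YW by blast
      then have D0: "D j = {}" using False unfolding D_def by auto
      \<comment> \<open>An index in no set adds no degree, and its point merely has to be
        nonzero.\<close>
      have "q ^ m > 1" using one_less_power[of q m] q_ge2 m_pos by simp
      then show ?thesis unfolding True D0 by simp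
    next
      case ne: False
      then obtain l where l: "l \<in> {1..k}" "j \<in> W l" using YW by blast
      have "?\<Omega> = {l}" unfolding YW using l uniqW[OF _ l(1) _ l(2)] by blast
      then have one: "card ?\<Omega> = 1" by simp
      have jY: "j \<in> Y l" using l unfolding Y_def by blast
      have "card (Y l) > 0" using jY finY[OF l(1)] card_gt_0_iff by blast
      \<comment> \<open>Hence \<open>2 * q ^ (k - 1) \<le> q ^ m\<close>, which leaves room for the
        degree coming from a single set and for the span of the earlier points.\<close>
      then have k2: "k \<ge> 2" using cardY[OF l(1)] by linarith
      have "card (D j) \<le> card (Y l - {j})"
        unfolding D_high[OF l] by (rule card_mono) (use finY[OF l(1)] in auto)
      then have "card (D j) \<le> k - 1 - 1" using jY finY[OF l(1)] cardY[OF l(1)] by simp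
      then have Dle: "q ^ card (D j) \<le> q ^ (k - 1 - 1)" using q_ge2 by (intro power_increasing) auto
      have "q ^ (k - 1 - 1) \<le> q ^ (k - 1)" using q_ge2 by (intro power_increasing) auto
      moreover have "q ^ (k - 1) > 0" using q_ge2 by simp
      moreover have "2 * q ^ (k - 1) \<le> k * q ^ (k - 1)" using k2 by (rule mult_le_mono1)
      ultimately have "q ^ (k - 1) - q ^ (k - 1 - 1) < q ^ m - q ^ card (D j)"
        using Dle qm by linarith
      then show ?thesis unfolding one by simp
    qed
  qed
  obtain w where ind: "functions_independent {1..k} (\<lambda>i. span_poly w (Y i))"
    and w: "\<And>j. j \<in> {1..N} \<Longrightarrow> (\<exists>\<beta> :: 'a. w j = c (blk j) * to_ac \<beta>) \<and> span_poly w (D j) (w j) \<noteq> 0"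
  proof -
    have "\<exists>w. functions_independent {1..k} (\<lambda>i. span_poly w (Y i)) \<and>
      (\<forall>j\<in>{1..N}. (\<exists>\<beta> :: 'a. w j = c (blk j) * to_ac \<beta>) \<and> span_poly w (D j) (w j) \<noteq> 0)"
      by (rule generic_points_in_cosets[OF k(1) _ condY Dsub bound]) (use finY cardY c0 blk in auto)
    then show thesis using that by blast
  qed
  have "\<exists>bt. \<forall>j\<in>{1..N}. w j = c (blk j) * to_ac (bt j :: 'a)"
    by (rule bchoice, rule ballI) (use w in blast)
  then obtain bt where bt: "\<And>j. j \<in> {1..N} \<Longrightarrow> w j = c (blk j) * to_ac (bt j :: 'a)" by blast
  define beta where "beta l t = bt (col_of ns l t)" for l t
  have wcol: "w (col_of ns l t) = c l * to_ac (beta l t)" if "l \<in> {1..L}" "t \<in> {1..ns l}" for l t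
    using bt[of "col_of ns l t"] col[OF that] WN(1) pcol[OF that] unfolding beta_def blk_def by simp
  have "Fq_lin_indep q (ns l) (beta l)" if l: "l \<in> {1..L}" for l
  proof -
    let ?B = "col_of ns l ` {1..ns l}"
    have Bmem: "x \<in> ?B \<longleftrightarrow> x \<in> {1..n} \<and> fst (p x) = l" for x
    proof
      assume "x \<in> ?B"
      then obtain t where "t \<in> {1..ns l}" "x = col_of ns l t" by blast
      then show "x \<in> {1..n} \<and> fst (p x) = l" using col[OF l] pcol[OF l] by simp
    next
      assume x: "x \<in> {1..n} \<and> fst (p x) = l"
      then have "snd (p x) \<in> {1..ns l}" "col_of ns l (snd (p x)) = x" using p[of x] by auto
      then show "x \<in> ?B" by (metis imageI)
    qed
    have "K_indep w ?B"
    proof (rule K_indep_sequential)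
      fix j assume "j \<in> ?B"
      then have j: "j \<in> {1..n}" "fst (p j) = l" using Bmem by blast+
      then have "{x \<in> ?B. x < j} = D j" using D_low[of j] Bmem by auto
      then show "span_poly w {x \<in> ?B. x < j} (w j) \<noteq> 0" using w[of j] j(1) WN(1) by simp
    qed simp
    show ?thesis
      unfolding Fq_lin_indep_def
    proof (intro allI impI ballI)
      fix e t assume e: "(\<forall>t\<in>{1..ns l}. e t ^ q = e t) \<and> (\<Sum>t = 1..ns l. e t * beta l t) = 0"
        and t: "t \<in> {1..ns l}"
      let ?e = "\<lambda>j. to_ac (e (snd (p j)))"
      have "inj_on (col_of ns l) {1..ns l}" by (auto simp: inj_on_def col_of_def)
      then have "(\<Sum>j\<in>?B. ?e j * w j) = (\<Sum>t=1..ns l. ?e (col_of ns l t) * w (col_of ns l t))"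
        by (rule sum.reindex_cong) simp_all
      also have "\<dots> = c l * to_ac (\<Sum>t = 1..ns l. e t * beta l t)"
        unfolding to_ac_sum sum_distrib_left
        by (intro sum.cong refl) (simp add: pcol[OF l] wcol[OF l] mult_ac)
      finally have sum: "(\<Sum>j\<in>?B. ?e j * w j) = 0" using e by simp
      have "?e (col_of ns l t) = 0"
      proof (rule K_indepD[OF \<open>K_indep w ?B\<close> _ sum])
        fix j assume "j \<in> ?B"
        then obtain t where "t \<in> {1..ns l}" "j = col_of ns l t" by blast
        then show "?e j \<in> fixed_field" using e pcol[OF l] unfolding fixed_field_eq by auto
      qed (use t in blast)
      then show "e t = 0" using pcol[OF l t] by simp
    qed
  qed
  then have par: "LRS_params q m L ns a beta" unfolding LRS_params_def using a nsm by blast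
  have Kn: "K_indep w {1..n}" by (rule LRS_points_K_indep[OF par n c wcol])
  have KY: "K_indep w (Y i)" if i: "i \<in> {1..k}" for i
  proof (rule K_indep_sequential[OF finY[OF i]])
    fix j assume j: "j \<in> Y i"
    \<comment> \<open>Real columns precede all padding indices. So a real \<open>j\<close> has only
      real predecessors, covered by the independence of all column points, while a padding
      \<open>j\<close> was chosen outside the span.\<close>
    show "span_poly w {x \<in> Y i. x < j} (w j) \<noteq> 0"
    proof (cases "j \<in> W i")
      case True
      then show ?thesis using w[of j] YN[OF i] j unfolding D_high[OF i True] by blast
    next
      case False
      then have jn: "j \<in> {1..n}" using j Z[OF i] unfolding Y_def by blast
      have "insert j {x \<in> Y i. x < j} \<subseteq> {1..n}" using jn YN[OF i] by fastforce
      then have "K_indep w (insert j {x \<in> Y i. x < j})" by (intro K_indep_subset[OF Kn]) auto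
      then show ?thesis by (rule K_indep_insertD) (use finY[OF i] in auto)
    qed
  qed
  have "\<exists>G. is_generator_matrix k n G (LRS_code q L ns n k a beta) \<and>
    (\<forall>i\<in>{1..k}. \<forall>j\<in>Y i \<inter> {1..n}. G i j = 0)"
  proof (rule LRS_generator_matrix[OF par n k c wcol finY cardY KY _ ind])
    fix i j assume "i \<in> {1..k}" "j \<in> Y i"
    then have "j \<in> {1..N}" using YN by blast
    then show "\<exists>l \<beta>. l \<in> {1..L} \<and> w j = c l * to_ac \<beta>" using bt blk by blast
  qed
  then obtain G where G: "is_generator_matrix k n G (LRS_code q L ns n k a beta)"
    "\<forall>i\<in>{1..k}. \<forall>j\<in>Y i \<inter> {1..n}. G i j = 0" by blast
  have "\<forall>i\<in>{1..k}. \<forall>j\<in>Z i. G i j = 0"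
    using G(2) Z unfolding Y_def by blast
  with par G(1) show ?thesis by blast
qed

end

theorem mainTheorem1:
  fixes q m L n k :: nat and ns :: "nat \<Rightarrow> nat" and Z :: "nat \<Rightarrow> nat set"
  assumes field_card: "CARD('a::{field,finite}) = q ^ m"
    and qpp: "\<exists>p e. prime p \<and> e > 0 \<and> q = p ^ e"
    and pos: "L > 0" "m > 0" "n > 0" "k \<ge> 1" "k \<le> n"
    and Lq: "L \<le> q - 1"
    and part: "\<forall>l\<in>{1..L}. ns l > 0" "(\<Sum>l=1..L. ns l) = n"
    and Zsub: "\<forall>i\<in>{1..k}. Z i \<subseteq> {1..n}"
    and q_ge: "q \<ge> L + 1"
    and m_ge: "\<forall>l\<in>{1..L}. real k - 1 + log (real q) (real k) \<le> real m \<and> ns l \<le> m"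
  shows "(\<exists>(a :: nat \<Rightarrow> 'a) beta G. LRS_params q m L ns a beta
            \<and> is_generator_matrix k n G (LRS_code q L ns n k a beta)
            \<and> (\<forall>i\<in>{1..k}. \<forall>j\<in>Z i. G i j = 0))
         \<longleftrightarrow> (\<forall>\<Omega>. \<Omega> \<subseteq> {1..k} \<and> \<Omega> \<noteq> {} \<longrightarrow> card (\<Inter>i\<in>\<Omega>. Z i) + card \<Omega> \<le> k)"
proof -
  interpret finite_extension q m "TYPE('a)"
    by unfold_locales (use field_card qpp pos in auto)
  \<comment> \<open>The bound on \<open>m\<close>, exponentiated to base \<open>q\<close>; it is
    read off at block 1, which exists because \<open>L > 0\<close>.\<close>
  have qm: "k * q ^ (k - 1) \<le> q ^ m"
  proof -
    have q1: "real q > 1" using q_ge2 by simp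
    have "real k - 1 + log (real q) (real k) \<le> real m" using bspec[OF m_ge, of 1] pos(1) by simp
    then have "real q powr (real k - 1 + log (real q) (real k)) \<le> real q powr real m"
      using q1 by simp
    moreover have "real q powr (real k - 1 + log (real q) (real k)) = real q ^ (k - 1) * real k"
    proof -
      have 1: "real k - 1 = real (k - 1)" using pos(4) by simp
      have 2: "real q powr log (real q) (real k) = real k" using q1 pos(4) by simp
      have 3: "real q powr real (k - 1) = real q ^ (k - 1)" using q1 by (intro powr_realpow) simp
      show ?thesis unfolding powr_add 1 2 3 ..
    qed
    moreover have "real q powr real m = real q ^ m" using q1 by (intro powr_realpow) simp
    ultimately have "real (k * q ^ (k - 1)) \<le> real (q ^ m)"
      by (simp only: of_nat_mult of_nat_power mult.commute)
    then show ?thesis by (simp only: of_nat_le_iff)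
  qed
  show ?thesis
  proof
    assume "\<exists>(a :: nat \<Rightarrow> 'a) beta G. LRS_params q m L ns a beta
      \<and> is_generator_matrix k n G (LRS_code q L ns n k a beta)
      \<and> (\<forall>i\<in>{1..k}. \<forall>j\<in>Z i. G i j = 0)"
    then obtain a :: "nat \<Rightarrow> 'a" and beta G where G: "LRS_params q m L ns a beta"
      "is_generator_matrix k n G (LRS_code q L ns n k a beta)"
      "\<forall>i\<in>{1..k}. \<forall>j\<in>Z i. G i j = 0" by (elim exE conjE) (rule that)
    show "\<forall>\<Omega>. \<Omega> \<subseteq> {1..k} \<and> \<Omega> \<noteq> {} \<longrightarrow> card (\<Inter>i\<in>\<Omega>. Z i) + card \<Omega> \<le> k"
    proof (intro allI impI)
      fix \<Omega> assume \<Omega>: "\<Omega> \<subseteq> {1..k} \<and> \<Omega> \<noteq> {}"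
      show "card (\<Inter>i\<in>\<Omega>. Z i) + card \<Omega> \<le> k"
        by (rule LRS_support_necessary[OF G(1) part(2) pos(5) G(2)]) (use G(3) Zsub \<Omega> in blast)+
    qed
  next
    assume cond: "\<forall>\<Omega>. \<Omega> \<subseteq> {1..k} \<and> \<Omega> \<noteq> {} \<longrightarrow> card (\<Inter>i\<in>\<Omega>. Z i) + card \<Omega> \<le> k"
    show "\<exists>(a :: nat \<Rightarrow> 'a) beta G. LRS_params q m L ns a beta
      \<and> is_generator_matrix k n G (LRS_code q L ns n k a beta)
      \<and> (\<forall>i\<in>{1..k}. \<forall>j\<in>Z i. G i j = 0)"
      by (rule LRS_support_sufficient[OF pos(1) Lq part(2) pos(4,5) _ qm]) (use m_ge Zsub cond in blast)+
  qed
qed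

end
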